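(* Suppose $n = 2^{\alpha} k$ where $\alpha \geq 2$ and $k$ is odd. Let $K$ be an algebraic number field such that $-1$ is not a square in $K$. Then there exists a cyclic Galois extension $L$ of $K$ of degree $n$ with Galois group $G = \langle \sigma \rangle$, together with $K$-subspaces $\mathcal{E}_1,\dots,\mathcal{E}_{\alpha-1},\mathcal{V}_1,\mathcal{V}_2$ of $A^1 = A^{\sigma}$, such that $$A^1 = \mathcal{E}_1 \oplus \cdots \oplus \mathcal{E}_{\alpha-1} \oplus \mathcal{V}_1 \oplus \mathcal{V}_2,$$ where (i) $\mathcal{E}_i$ is an $n$-subspace of dimension $n/2^i$ for $1 \leq i \leq \alpha - 1$; (ii) $\mathcal{V}_j$ is an $(n-2)$-subspace of dimension $k$ for $1 \leq j \leq 2$.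
   Context: For a finite Galois extension $L/K$, $\mathrm{Alt}_K(L)$ denotes the $K$-space of alternating $K$-bilinear forms (skew-forms) $L \times L \to K$, and $\mathrm{Tr}^L_K(a) = \sum_{\theta \in \mathrm{Gal}(L/K)} \theta(a)$. For $\tau \in \mathrm{Gal}(L/K)$ and $b \in L$ define the skew-form $f_{b,\tau}(x,y) = \mathrm{Tr}^L_K\big(b(x\tau(y) - \tau(x)y)\big)$ for $x,y \in L$, and the subspace $A^{\tau} = \{ f_{b,\tau} : b \in L\}$ of $\mathrm{Alt}_K(L)$. If $\mathrm{Gal}(L/K) = \langle \sigma\rangle$ is cyclic, write $A^i = A^{\sigma^i}$. An $r$-subspace of $\mathrm{Alt}_K(L)$ is a $K$-subspace all of whose nonzero skew-forms have rank $r$. Dimensions are over $K$. *)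

theory Defs
  imports
    "HOL-Algebra.Algebraic_Closure_Type"
    "HOL-Algebra.Generated_Groups"
    "HOL-Library.FuncSet"
    "HOL-Library.Function_Algebras"
begin

text \<open>
  The base field \<open>K\<close> is a type \<open>'k\<close> of class \<^class>\<open>field\<close>.  Finite extensions \<open>L\<close> of \<open>K\<close> are
  taken inside the algebraic closure \<open>'k alg_closure\<close>, in which \<open>K\<close> is embedded by \<^const>\<open>to_ac\<close>.
  Every finite extension of \<open>K\<close> is isomorphic over \<open>K\<close> to one of these.
\<close>

definition number_field :: "'k::field_char_0 itself \<Rightarrow> bool" where
  "number_field _ \<longleftrightarrow>
     (\<exists>B. finite_dimensional_vector_space (\<lambda>(q::rat) (x::'k). of_rat q * x) B)"

definition ac_scale :: "'k::field \<Rightarrow> 'k alg_closure \<Rightarrow> 'k alg_closure" where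
  "ac_scale c x = to_ac c * x"

global_interpretation ac: vector_space "ac_scale :: 'k::field \<Rightarrow> _"
  by unfold_locales (simp_all add: ac_scale_def algebra_simps)

definition intermediate_field :: "'k::field alg_closure set \<Rightarrow> bool" where
  "intermediate_field L \<longleftrightarrow>
     subfield L (ring_of_type_algebra :: 'k alg_closure ring) \<and> range to_ac \<subseteq> L"

text \<open>
  An automorphism of \<open>L\<close> is represented by the function on \<open>'k alg_closure\<close> that extends it by the
  identity outside \<open>L\<close> (this is the convention of \<open>permutes\<close>), so that composition is \<open>(\<circ>)\<close>.
\<close>

definition Gal :: "'k::field alg_closure set \<Rightarrow> ('k alg_closure \<Rightarrow> 'k alg_closure) set" where
  "Gal L = {\<theta>. \<theta> permutes L \<and>
     (\<forall>x\<in>L. \<forall>y\<in>L. \<theta> (x + y) = \<theta> x + \<theta> y \<and> \<theta> (x * y) = \<theta> x * \<theta> y) \<and>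
     (\<forall>c. \<theta> (to_ac c) = to_ac c)}"

definition Gal_group :: "'k::field alg_closure set \<Rightarrow> ('k alg_closure \<Rightarrow> 'k alg_closure) monoid" where
  "Gal_group L = \<lparr>carrier = Gal L, monoid.mult = (\<circ>), one = id\<rparr>"

definition finite_galois_extension :: "'k::field alg_closure set \<Rightarrow> bool" where
  "finite_galois_extension L \<longleftrightarrow>
     intermediate_field L \<and>
     (\<exists>B. finite B \<and> ac.span B = L) \<and>
     {x \<in> L. \<forall>\<theta>\<in>Gal L. \<theta> x = x} = range to_ac"

definition cyclic_galois_extension ::
  "'k::field alg_closure set \<Rightarrow> ('k alg_closure \<Rightarrow> 'k alg_closure) \<Rightarrow> bool" where
  "cyclic_galois_extension L \<sigma> \<longleftrightarrow>
     finite_galois_extension L \<and> \<sigma> \<in> Gal L \<and> generate (Gal_group L) {\<sigma>} = Gal L"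

text \<open>
  For a finite Galois extension and \<open>a \<in> L\<close> the sum lies in \<open>range to_ac\<close>; \<^const>\<open>of_ac\<close> is the
  inverse of \<^const>\<open>to_ac\<close> there.
\<close>

definition Tr :: "'k::field alg_closure set \<Rightarrow> 'k alg_closure \<Rightarrow> 'k" where
  "Tr L a = of_ac (\<Sum>\<theta>\<in>Gal L. \<theta> a)"

text \<open>
  A form \<open>L \<times> L \<rightarrow> K\<close> is represented by its extension by zero outside \<open>L \<times> L\<close>, so that forms on \<open>L\<close>
  are equal iff they agree on \<open>L\<close>.
\<close>

type_synonym 'k form = "'k alg_closure \<Rightarrow> 'k alg_closure \<Rightarrow> 'k"

definition form_scale :: "'k::field \<Rightarrow> 'k form \<Rightarrow> 'k form" where
  "form_scale c f = (\<lambda>x y. c * f x y)"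

global_interpretation form: vector_space "form_scale :: 'k::field \<Rightarrow> _"
  by unfold_locales (auto simp: form_scale_def fun_eq_iff algebra_simps)

definition Alt :: "'k::field alg_closure set \<Rightarrow> 'k form set" where
  "Alt L = {f.
     (\<forall>x y. x \<notin> L \<or> y \<notin> L \<longrightarrow> f x y = 0) \<and>
     (\<forall>x\<in>L. \<forall>x'\<in>L. \<forall>y\<in>L. f (x + x') y = f x y + f x' y \<and> f y (x + x') = f y x + f y x') \<and>
     (\<forall>c. \<forall>x\<in>L. \<forall>y\<in>L. f (ac_scale c x) y = c * f x y \<and> f x (ac_scale c y) = c * f x y) \<and>
     (\<forall>x\<in>L. f x x = 0)}"

definition radical :: "'k::field alg_closure set \<Rightarrow> 'k form \<Rightarrow> 'k alg_closure set" where
  "radical L f = {x \<in> L. \<forall>y\<in>L. f x y = 0}"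

definition form_rank :: "'k::field alg_closure set \<Rightarrow> 'k form \<Rightarrow> nat" where
  "form_rank L f = ac.dim L - ac.dim (radical L f)"

definition rank_subspace :: "'k::field alg_closure set \<Rightarrow> nat \<Rightarrow> 'k form set \<Rightarrow> bool" where
  "rank_subspace L r U \<longleftrightarrow>
     U \<subseteq> Alt L \<and> form.subspace U \<and> (\<forall>f\<in>U. f \<noteq> 0 \<longrightarrow> form_rank L f = r)"

definition skew_form ::
  "'k::field alg_closure set \<Rightarrow> 'k alg_closure \<Rightarrow> ('k alg_closure \<Rightarrow> 'k alg_closure) \<Rightarrow> 'k form" where
  "skew_form L b \<tau> =
     (\<lambda>x y. if x \<in> L \<and> y \<in> L then Tr L (b * (x * \<tau> y - \<tau> x * y)) else 0)"

definition skew_space ::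
  "'k::field alg_closure set \<Rightarrow> ('k alg_closure \<Rightarrow> 'k alg_closure) \<Rightarrow> 'k form set" where
  "skew_space L \<tau> = {skew_form L b \<tau> | b. b \<in> L}"

definition is_direct_sum :: "'b::comm_monoid_add set \<Rightarrow> 'i set \<Rightarrow> ('i \<Rightarrow> 'b set) \<Rightarrow> bool" where
  "is_direct_sum A I U \<longleftrightarrow> bij_betw (\<lambda>u. \<Sum>i\<in>I. u i) (\<Pi>\<^sub>E i\<in>I. U i) A"

end

theory Submission
  imports Defs "HOL-Number_Theory.Number_Theory" Complex_Main
begin

text \<open>
  Let \<open>L/K\<close> be cyclic of even degree \<open>n\<close> with group generated by \<open>\<sigma>\<close>, and let \<open>F\<close> be the fixed field of
  \<open>\<sigma>\<^sup>2\<close>, a quadratic extension of \<open>K\<close>.  Moving \<open>\<sigma>\<close> across the trace shows that the radical of the form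
  with coefficient \<open>b\<close> consists of the \<open>x\<close> with \<open>b x = \<sigma>(b) \<sigma>\<^sup>2(x)\<close>.  If this space is nonzero, it is a
  line over \<open>F\<close>, so that the rank is \<open>n - 2\<close>; and taking norms from \<open>L\<close> to \<open>F\<close> shows that it vanishes
  unless the norm of \<open>b\<close> to \<open>F\<close> is fixed by \<open>\<sigma>\<close>.

  The summands correspond to the factors of
  \<open>X\<^sup>n - 1 = (X\<^sup>k - 1) (X\<^sup>k + 1) (X\<^bsup>2k\<^esup> + 1) \<cdots> (X\<^bsup>n/2\<^esup> + 1)\<close>
  evaluated at \<open>\<sigma>\<close>: the coefficient \<open>b\<close> of a form in \<open>E\<^sub>i\<close> satisfies \<open>\<sigma>\<^sup>m(b) = - b\<close> with \<open>m = n/2\<^sup>i\<close>, and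
  \<open>V\<^sub>1\<close>, \<open>V\<^sub>2\<close> belong to \<open>\<sigma>\<^sup>k(b) = b\<close> and \<open>\<sigma>\<^sup>k(b) = - b\<close>.  For \<open>V\<^sub>1\<close> and \<open>V\<^sub>2\<close> an element of the radical can
  be written down, because \<open>k\<close> is odd and so \<open>\<sigma>\<close> agrees up to sign with the even power \<open>\<sigma>\<^bsup>k+1\<^esup>\<close> on \<open>b\<close>
  (\<open>form_rank_eq_order_minus_2\<close>).  For \<open>E\<^sub>i\<close> let \<open>y\<close> be the product of the \<open>\<sigma>\<^bsup>2t\<^esup>(b)\<close> over \<open>t < m\<close>, and \<open>q\<close>
  that of the \<open>\<sigma>\<^sup>t(b)\<close> over \<open>t < m\<close>.  Then \<open>y \<sigma>(y) = q\<^sup>2\<close> and \<open>\<sigma>(q) = - q\<close>, and the norm of \<open>b\<close> to \<open>F\<close> is a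
  power of \<open>y\<close> with exponent a power of 2.  If \<open>L\<close> has no square root of \<open>- 1\<close>, a norm fixed by \<open>\<sigma>\<close> forces
  \<open>\<sigma>(y) = y\<close> or \<open>\<sigma>(y) = - y\<close>; the first gives \<open>q = y\<close> or \<open>q = - y\<close>, which \<open>\<sigma>\<close> would fix, and the second
  makes \<open>q/y\<close> a square root of \<open>- 1\<close> (\<open>form_rank_eq_order\<close>).  Hence every cyclic \<open>L\<close> of degree \<open>n\<close>
  without a square root of \<open>- 1\<close> has the required decomposition (\<open>skew_space_decomposition\<close>).

  Such an \<open>L\<close> is found in \<open>K(\<zeta>)\<close>, where \<open>\<zeta>\<close> is a root of unity of prime order \<open>p\<close>.  Put \<open>d = [K:\<rat>]\<close> and
  take \<open>p\<close> congruent to 1 modulo \<open>4 n d!\<close> (\<open>exists_prime_cong_1\<close>).  The extension \<open>K(\<zeta>)/K\<close> is cyclic of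
  degree \<open>(p - 1)/e\<close> for some \<open>e\<close> (\<open>cyclic_action_ext_field\<close>), and \<open>e \<le> d\<close> because \<open>p - 1\<close> powers of \<open>\<zeta>\<close>
  are independent over \<open>\<rat>\<close> (\<open>degree_bound\<close>).  So \<open>e\<close> divides \<open>d!\<close>, hence \<open>n\<close> divides the degree, and the
  fixed field of the \<open>n\<close>th power of a generator has degree \<open>n\<close> (\<open>Fix_cyclic_action\<close>).  As 4 divides
  \<open>p - 1\<close>, the field \<open>K(\<zeta>)\<close> contains a square root of \<open>p\<close> (\<open>p_eq_square\<close>).  If it also contained a square
  root of \<open>- 1\<close> and neither of the two were in \<open>K\<close>, a generator of the group would negate both and fix
  their product, so \<open>- p\<close> would be a square in \<open>K\<close> (\<open>no_sqrt_minus_1\<close>).  Only finitely many primes are, up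
  to sign, squares in \<open>K\<close> (\<open>finite_primes_pm_square\<close>), so \<open>p\<close> can be chosen to avoid this.
\<close>

section \<open>Primes in the residue class 1\<close>

lemma map_poly_mult_hom:
  fixes \<phi> :: "'a::comm_ring_1 \<Rightarrow> 'b::comm_ring_1"
  assumes "\<phi> 0 = 0" "\<And>x y. \<phi> (x + y) = \<phi> x + \<phi> y" "\<And>x y. \<phi> (x * y) = \<phi> x * \<phi> y"
  shows "map_poly \<phi> (p * q) = map_poly \<phi> p * map_poly \<phi> q"
proof (rule poly_eqI)
  fix i
  have s: "\<phi> (sum f A) = (\<Sum>a\<in>A. \<phi> (f a))" if "finite A" for f and A :: "nat set"
    using that by (induction A rule: finite_induct) (auto simp: assms)
  show "poly.coeff (map_poly \<phi> (p * q)) i = poly.coeff (map_poly \<phi> p * map_poly \<phi> q) i"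
    by (simp add: coeff_map_poly coeff_mult assms s)
qed

text \<open>
  Let \<open>G\<close> be the least common multiple in \<open>\<int>[X]\<close> of the \<open>X\<^sup>d - 1\<close> for proper divisors \<open>d\<close> of \<open>N\<close>, and
  \<open>X\<^sup>N - 1 = G H\<close>.  A primitive \<open>N\<close>th root of unity is not a root of \<open>G\<close>, so \<open>H\<close> is not constant.  A prime
  \<open>q\<close> dividing \<open>H(x)\<close> divides \<open>x\<^sup>N - 1\<close>; if the order of \<open>x\<close> modulo \<open>q\<close> were smaller than \<open>N\<close>, \<open>q\<close> would
  divide \<open>G(x)\<close> as well, hence the derivative \<open>N x\<^bsup>N-1\<^esup>\<close>.  Taking \<open>x\<close> divisible by \<open>N\<close> and by \<open>B!\<close> excludes
  this and makes \<open>q\<close> larger than \<open>B\<close>; then \<open>N\<close> is the order of \<open>x\<close> and divides \<open>q - 1\<close>.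
\<close>
lemma exists_prime_cong_1:
  fixes N B :: nat
  assumes "N > 0"
  shows "\<exists>p::nat. Factorial_Ring.prime p \<and> p > B \<and> N dvd p - 1"
proof -
  define P where "P = (\<lambda>d. Polynomial.monom 1 d - 1 :: int poly)"
  define D where "D = {d. d dvd N \<and> d < N}"
  have finD: "finite D" unfolding D_def by simp
  define G where "G = Lcm (P ` D)"
  have PD: "P d dvd P N" if "d dvd N" for d
  proof -
    obtain e where "N = d * e" using \<open>d dvd N\<close> by blast
    then have "P N = Polynomial.monom 1 d ^ e - 1 ^ e"
      by (simp add: P_def monom_power mult.commute)
    also have "\<dots> = (Polynomial.monom 1 d - 1) * (\<Sum>i<e. 1 ^ (e - Suc i) * Polynomial.monom 1 d ^ i)"
      by (rule power_diff_sumr2)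
    finally show ?thesis by (simp add: P_def)
  qed
  have "G dvd P N" unfolding G_def by (rule Lcm_least) (auto simp: D_def PD)
  then obtain H where H: "P N = G * H" by blast
  define ev where "ev = (\<lambda>(h :: int poly) (z :: complex). poly (map_poly of_int h) z)"
  have ev_mult: "ev (a * b) z = ev a z * ev b z" for a b z
    by (simp add: ev_def map_poly_mult_hom)
  have ev_P: "ev (P d) z = z ^ d - 1" for d z
  proof -
    have "map_poly of_int (P d) = (Polynomial.monom 1 d - 1 :: complex poly)"
      by (rule poly_eqI) (auto simp: P_def coeff_map_poly)
    then show ?thesis by (simp add: ev_def poly_monom)
  qed
  define z where "z = cis (2 * pi / N)"
  have zN: "z ^ N = 1" using assms by (simp add: z_def DeMoivre)
  have zd: "z ^ d \<noteq> 1" if "d \<in> D" for d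
  proof
    have "d > 0" "d < N" using that assms by (auto simp: D_def intro: Nat.gr0I)
    assume "z ^ d = 1"
    then have "cis (2 * pi * d / N) = 1" by (simp add: z_def DeMoivre mult_ac)
    then have "cos (2 * pi * d / N) = 1" by (metis cis.sel(1) one_complex.sel(1))
    then obtain n :: int where "2 * pi * d / N = n * 2 * pi" by (auto simp: cos_one_2pi_int)
    then have "real d = n * real N" using assms by (simp add: field_simps)
    then have "int d = n * int N" by (metis of_int_eq_iff of_int_mult of_int_of_nat_eq)
    then have "N dvd d" by (metis dvd_triv_right int_dvd_int_iff)
    then show False using \<open>d > 0\<close> \<open>d < N\<close> by (auto dest: dvd_imp_le)
  qed
  have "G dvd (\<Prod>d\<in>D. P d)" unfolding G_def by (rule Lcm_least) (auto simp: finD)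
  then obtain R where "(\<Prod>d\<in>D. P d) = G * R" by blast
  moreover have "ev (\<Prod>d\<in>A. P d) z = (\<Prod>d\<in>A. z ^ d - 1)" for A
    by (induction A rule: infinite_finite_induct) (auto simp: ev_mult ev_P, auto simp: ev_def)
  ultimately have "ev G z * ev R z = (\<Prod>d\<in>D. z ^ d - 1)" by (metis ev_mult)
  then have "ev G z \<noteq> 0" using zd finD by auto
  moreover have "ev G z * ev H z = 0" using H zN by (metis ev_P ev_mult right_minus_eq)
  ultimately have "ev H z = 0" by simp
  have "P N \<noteq> 0"
  proof
    assume "P N = 0"
    then have "poly.coeff (P N) N = 0" by simp
    then show False using assms by (simp add: P_def)
  qed
  have degH: "Polynomial.degree H > 0"
  proof (rule ccontr)
    assume "\<not> ?thesis"
    then obtain c where c: "H = [:c:]" by (metis degree_eq_zeroE gr0I)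
    then have "ev H z = of_int c" by (simp add: ev_def map_poly_pCons)
    then have "H = 0" using \<open>ev H z = 0\<close> c by simp
    then show False using H \<open>P N \<noteq> 0\<close> by simp
  qed
  \<comment> \<open>Avoiding the roots of \<open>H\<close>, \<open>H - 1\<close> and \<open>H + 1\<close> makes the value of \<open>H\<close> divisible by some prime.\<close>
  define Q where "Q = int N * fact B"
  have "finite {x. poly (H * (H - 1) * (H + 1)) x = 0}"
  proof (rule poly_roots_finite)
    have "H \<noteq> 0" "H \<noteq> 1" "H \<noteq> - 1" using degH by auto
    then show "H * (H - 1) * (H + 1) \<noteq> 0" by (auto simp: add_eq_0_iff2)
  qed
  moreover have "infinite ((\<lambda>y. Q * y) ` {1 :: int..})"
    using assms by (subst finite_image_iff) (auto simp: Q_def infinite_Ici intro!: inj_onI)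
  ultimately have "\<not> (\<lambda>y. Q * y) ` {1..} \<subseteq> {x. poly (H * (H - 1) * (H + 1)) x = 0}"
    using finite_subset by blast
  then obtain y where y: "y \<ge> 1" "poly (H * (H - 1) * (H + 1)) (Q * y) \<noteq> 0"
    by blast
  define x where "x = Q * y"
  have "\<not> is_unit (poly H x)" using y by (auto simp: x_def)
  then obtain q where q: "Factorial_Ring.prime q" "q dvd poly H x"
    using y by (metis mult_zero_left poly_0 poly_mult prime_divisor_exists x_def)
  have xN: "[x ^ N = 1] (mod q)"
  proof -
    have "poly (P N) x = poly G x * poly H x" by (simp add: H)
    then have "q dvd x ^ N - 1" using q by (simp add: P_def poly_monom)
    then show ?thesis by (simp add: cong_iff_dvd_diff)
  qed
  have ndx: "\<not> q dvd x"
  proof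
    assume "q dvd x"
    then have "q dvd x ^ N" using assms by (metis dvd_power dvd_trans)
    then have "q dvd 1" using xN by (metis cong_dvd_iff)
    then show False using q by (simp add: prime_int_iff)
  qed
  have qB: "q > int B"
  proof (rule ccontr)
    assume "\<not> ?thesis"
    then have "nat q \<le> B" "nat q > 0" using prime_gt_0_int[OF q(1)] by auto
    then have "nat q dvd fact B" by (simp add: dvd_fact)
    then have "int (nat q) dvd int (fact B)" by (simp only: int_dvd_int_iff)
    then have "q dvd fact B" using prime_gt_0_int[OF q(1)] by simp
    then show False using ndx by (simp add: x_def Q_def)
  qed
  have ndN: "\<not> q dvd int N" using ndx by (auto simp: x_def Q_def)
  have nxd: "\<not> [x ^ d = 1] (mod q)" if "d \<in> D" for d
  proof
    assume "[x ^ d = 1] (mod q)"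
    then have "q dvd poly (P d) x" by (simp add: P_def poly_monom cong_iff_dvd_diff)
    moreover have "P d dvd G" unfolding G_def using that by (intro dvd_Lcm) auto
    ultimately have "q dvd poly G x" by (metis dvd_def dvd_mult2 poly_mult)
    then have "q dvd poly (pderiv (P N)) x"
      using q by (simp add: H pderiv_mult)
    then have "q dvd int N * x ^ (N - 1)"
      by (simp add: P_def pderiv_diff pderiv_monom poly_monom)
    then show False using ndN ndx q prime_dvd_mult_iff prime_dvd_power by blast
  qed
  have copr: "coprime (nat q) (nat (x mod q))" and ppos: "Factorial_Ring.prime (nat q)"
  proof -
    show p: "Factorial_Ring.prime (nat q)" using q by (metis prime_nat_iff_prime prime_ge_0_int nat_int prime_int_nat_transfer)
    have "\<not> nat q dvd nat (x mod q)"
    proof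
      assume "nat q dvd nat (x mod q)"
      then have "q dvd x mod q" using prime_gt_0_int[OF q(1)] by (simp add: nat_dvd_iff)
      then show False using ndx by (simp add: dvd_mod_iff)
    qed
    then show "coprime (nat q) (nat (x mod q))" using p prime_imp_coprime by blast
  qed
  have congp: "[nat (x mod q) ^ d = 1] (mod nat q) \<longleftrightarrow> [x ^ d = 1] (mod q)" for d
  proof -
    have "[nat (x mod q) ^ d = 1] (mod nat q) \<longleftrightarrow> [int (nat (x mod q) ^ d) = int 1] (mod int (nat q))"
      by (simp only: cong_int_iff)
    also have "\<dots> \<longleftrightarrow> [(x mod q) ^ d = 1] (mod q)"
      using prime_gt_0_int[OF q(1)] by simp
    also have "\<dots> \<longleftrightarrow> [x ^ d = 1] (mod q)"
      by (simp add: cong_def power_mod)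
    finally show ?thesis .
  qed
  define r where "r = ord (nat q) (nat (x mod q))"
  have "r dvd N" unfolding r_def ord_divides[symmetric] congp by (rule xN)
  moreover have "[x ^ r = 1] (mod q)" unfolding congp[symmetric] r_def by (rule ord)
  ultimately have "r = N" using nxd assms by (force simp: D_def dest: dvd_imp_le)
  then have "N dvd nat q - 1"
    using order_divides_totient[OF copr] ppos by (simp add: r_def totient_prime)
  then show ?thesis using ppos qB by (intro exI[of _ "nat q"]) auto
qed

section \<open>Square roots of primes in a number field\<close>

lemma prod_primes_not_square:
  fixes T :: "nat set" and x :: rat
  assumes T: "finite T" "T \<noteq> {}" "\<And>p. p \<in> T \<Longrightarrow> Factorial_Ring.prime p"
    and \<epsilon>: "\<epsilon> \<in> {1, - 1}"
  shows "x ^ 2 \<noteq> \<epsilon> * of_nat (\<Prod>T)"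
proof
  assume x: "x ^ 2 = \<epsilon> * of_nat (\<Prod>T)"
  have pos: "\<Prod>T > 0" using T by (simp add: prime_gt_0_nat prod_pos)
  have "\<epsilon> = 1"
  proof (rule ccontr)
    assume "\<epsilon> \<noteq> 1"
    then have "x ^ 2 < 0" using x \<epsilon> pos by (simp del: of_nat_prod)
    then show False by simp
  qed
  obtain a b where ab: "quotient_of x = (a, b)" by (cases "quotient_of x") auto
  have b: "b > 0" and cop: "coprime a b" and xab: "x = of_int a / of_int b"
    using quotient_of_denom_pos[OF ab] quotient_of_coprime[OF ab] quotient_of_div[OF ab] by auto
  have "(of_int (a ^ 2) :: rat) = of_int (b ^ 2 * int (\<Prod>T))"
    using x b \<open>\<epsilon> = 1\<close> by (simp add: xab field_simps del: of_nat_prod)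
  then have eq: "a ^ 2 = b ^ 2 * int (\<Prod>T)" by (simp only: of_int_eq_iff)
  obtain p where p: "p \<in> T" using T by blast
  have pp: "Factorial_Ring.prime (int p)" using T(3)[OF p] by simp
  have P: "int (\<Prod>T) = int p * int (\<Prod>(T - {p}))"
    using T(1) p by (simp add: prod.remove[of T p] del: of_nat_prod)
  have "int p dvd a ^ 2" using eq P by simp
  then have "int p dvd a" using pp prime_dvd_power by blast
  then obtain c where c: "a = int p * c" by blast
  have "int p * (int p * c ^ 2) = int p * (b ^ 2 * int (\<Prod>(T - {p})))"
    using eq unfolding P c by (simp add: power2_eq_square algebra_simps del: of_nat_prod)
  then have "int p * c ^ 2 = b ^ 2 * int (\<Prod>(T - {p}))"
    using prime_gt_0_nat[OF T(3)[OF p]] by (simp del: of_nat_prod)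
  then have "int p dvd b ^ 2 * int (\<Prod>(T - {p}))" by (metis dvd_triv_left)
  then have "int p dvd b \<or> int p dvd int (\<Prod>(T - {p}))"
    using pp prime_dvd_mult_iff prime_dvd_power by blast
  moreover have "\<not> int p dvd b"
    using cop \<open>int p dvd a\<close> pp by (meson coprime_common_divisor not_prime_unit)
  moreover have "\<not> p dvd \<Prod>(T - {p})"
  proof
    assume "p dvd \<Prod>(T - {p})"
    then obtain q where "q \<in> T - {p}" "p dvd q"
      using T(1) T(3)[OF p] prime_dvd_prod_iff[of "T - {p}" p "\<lambda>x. x"] by auto
    then show False using T(3) p primes_dvd_imp_eq by blast
  qed
  ultimately show False by (metis int_dvd_int_iff)
qed

text \<open>
  Closure under subtraction is implied: \<open>- 1\<close> is rational.
\<close>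
definition contains_rats_as_subfield :: "'a::field_char_0 set \<Rightarrow> bool" where
  "contains_rats_as_subfield F \<longleftrightarrow> range of_rat \<subseteq> F \<and>
     (\<forall>x\<in>F. \<forall>y\<in>F. x + y \<in> F \<and> x * y \<in> F) \<and> (\<forall>x\<in>F. inverse x \<in> F)"

text \<open>
  The field obtained from \<open>\<rat>\<close> by adjoining the \<open>s p\<close>, provided each of them has its square, but not
  itself, in the field generated by those after it in the list.
\<close>
primrec sqrt_tower :: "(nat \<Rightarrow> 'a::field_char_0) \<Rightarrow> nat list \<Rightarrow> 'a set" where
  "sqrt_tower s [] = range of_rat"
| "sqrt_tower s (p # ps) = {x + y * s p | x y. x \<in> sqrt_tower s ps \<and> y \<in> sqrt_tower s ps}"

text \<open>
  The inverse of \<open>x + y s\<close> is \<open>(x - y s)/(x\<^sup>2 - y\<^sup>2 s\<^sup>2)\<close>; the denominator is nonzero since \<open>s\<close> is not in \<open>F\<close>.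
\<close>
lemma adjoin_sqrt_subfield:
  fixes F :: "'a::field_char_0 set"
  assumes F: "contains_rats_as_subfield F" and s: "s ^ 2 \<in> F" "s \<notin> F"
  shows "contains_rats_as_subfield {x + y * s | x y. x \<in> F \<and> y \<in> F}" (is "contains_rats_as_subfield ?G")
proof -
  have rat: "of_rat q \<in> F" for q using F by (auto simp: contains_rats_as_subfield_def)
  have add: "x + y \<in> F" and mult: "x * y \<in> F" if "x \<in> F" "y \<in> F" for x y
    using F that by (auto simp: contains_rats_as_subfield_def)
  have inv: "inverse x \<in> F" if "x \<in> F" for x
    using F that by (auto simp: contains_rats_as_subfield_def)
  have "- 1 \<in> F" using rat[of "- 1"] by simp
  then have neg: "- x \<in> F" if "x \<in> F" for x using mult[of "- 1" x] that by simp
  have zero: "0 \<in> F" using rat[of 0] by simp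
  have G: "x + y * s \<in> ?G" if "x \<in> F" "y \<in> F" for x y using that by blast
  have r1: "of_rat q \<in> ?G" for q using G[OF rat[of q] zero] by simp
  have r2: "u + v \<in> ?G" and r3: "u * v \<in> ?G" if "u \<in> ?G" "v \<in> ?G" for u v
  proof -
    obtain x y x' y' where u: "u = x + y * s" "x \<in> F" "y \<in> F" and v: "v = x' + y' * s" "x' \<in> F" "y' \<in> F"
      using \<open>u \<in> ?G\<close> \<open>v \<in> ?G\<close> by blast
    have "u + v = (x + x') + (y + y') * s" by (simp add: u v algebra_simps)
    then show "u + v \<in> ?G" using u v add by (metis (mono_tags, lifting) G)
    have "u * v = (x * x' + y * y' * s ^ 2) + (x * y' + y * x') * s"
      by (simp add: u v algebra_simps power2_eq_square)
    then show "u * v \<in> ?G" using u v add mult s by (metis (mono_tags, lifting) G)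
  qed
  have r4: "inverse u \<in> ?G" if "u \<in> ?G" for u
  proof -
    obtain x y where u: "u = x + y * s" "x \<in> F" "y \<in> F" using \<open>u \<in> ?G\<close> by blast
    define N where "N = x * x + - (y * y * s ^ 2)"
    have NF: "N \<in> F" unfolding N_def using u s by (intro add mult neg)
    have uN: "u * (x + - y * s) = N"
      by (simp add: u N_def algebra_simps power2_eq_square)
    show ?thesis
    proof (cases "u = 0")
      case True
      then show ?thesis using G[OF zero zero] by simp
    next
      case False
      have "x + - y * s \<noteq> 0"
      proof
        assume z: "x + - y * s = 0"
        show False
        proof (cases "y = 0")
          case True
          then show False using z False u by simp
        next
          case y: False
          then have "s = x * inverse y" using z by (simp add: field_simps)
          then show False using s mult inv u by blast
        qed
      qed
      then have "N \<noteq> 0" using uN False by (metis mult_eq_0_iff)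
      then have "inverse u = inverse N * x + (inverse N * - y) * s"
        using uN False by (simp add: field_simps)
      then show ?thesis using G[of "inverse N * x" "inverse N * - y"] NF u mult inv neg by simp
    qed
  qed
  show ?thesis
    unfolding contains_rats_as_subfield_def by (intro conjI ballI image_subsetI r1 r2 r3 r4)
qed

text \<open>
  The statement about products of several further primes is what makes the induction work.  If
  \<open>(x + y s)\<^sup>2\<close> is rational, then \<open>x y = 0\<close> because \<open>s\<close> is not in the smaller field; in the case \<open>x = 0\<close>
  multiplication by \<open>p\<close> turns a square root of the product over \<open>T\<close> into one of the product over
  \<open>T \<union> {p}\<close>, which the induction hypothesis excludes.
\<close>
lemma sqrt_tower:
  fixes s :: "nat \<Rightarrow> 'a::field_char_0"
  assumes S: "\<And>p. p \<in> S \<Longrightarrow> Factorial_Ring.prime p \<and> s p ^ 2 \<in> {of_nat p, - of_nat p}"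
  shows "\<lbrakk>distinct ps; set ps \<subseteq> S\<rbrakk> \<Longrightarrow> contains_rats_as_subfield (sqrt_tower s ps) \<and>
    (\<forall>T x \<epsilon>. finite T \<and> T \<noteq> {} \<and> T \<inter> set ps = {} \<and> (\<forall>p\<in>T. Factorial_Ring.prime p) \<and> \<epsilon> \<in> {1, - 1} \<and> x \<in> sqrt_tower s ps
       \<longrightarrow> x ^ 2 \<noteq> \<epsilon> * of_nat (\<Prod>T))"
proof (induction ps)
  case Nil
  have "of_rat q ^ 2 \<noteq> (\<epsilon> * of_nat (\<Prod>T) :: 'a)"
    if "finite T" "T \<noteq> {}" "\<forall>p\<in>T. Factorial_Ring.prime p" "\<epsilon> \<in> {1, - 1}" for T q and \<epsilon> :: 'a
  proof
    assume eq: "of_rat q ^ 2 = (\<epsilon> * of_nat (\<Prod>T) :: 'a)"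
    obtain e :: rat where e: "\<epsilon> = of_rat e" "e \<in> {1, - 1}"
      using \<open>\<epsilon> \<in> _\<close> by (metis insert_iff of_rat_1 of_rat_minus singletonD)
    have "(of_rat (q ^ 2) :: 'a) = of_rat (e * of_nat (\<Prod>T))"
      using eq by (simp add: e of_rat_power of_rat_mult del: of_nat_prod)
    then show False using prod_primes_not_square[of T e q] that e by (simp only: of_rat_eq_iff) blast
  qed
  moreover have "contains_rats_as_subfield (range of_rat :: 'a set)"
    unfolding contains_rats_as_subfield_def
    by (auto simp flip: of_rat_add of_rat_mult of_rat_inverse)
  ultimately show ?case by auto
next
  case (Cons p ps)
  let ?F = "sqrt_tower s ps"
  have F: "contains_rats_as_subfield ?F"
    and nsq: "\<And>T x \<epsilon>. \<lbrakk>finite T; T \<noteq> {}; T \<inter> set ps = {}; \<forall>p\<in>T. Factorial_Ring.prime p; \<epsilon> \<in> {1, - 1}; x \<in> ?F\<rbrakk>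
      \<Longrightarrow> x ^ 2 \<noteq> \<epsilon> * of_nat (\<Prod>T)"
    using Cons by auto
  have rat: "of_rat q \<in> ?F" for q using F by (auto simp: contains_rats_as_subfield_def)
  have add: "x + y \<in> ?F" and mult: "x * y \<in> ?F" if "x \<in> ?F" "y \<in> ?F" for x y
    using F that by (auto simp: contains_rats_as_subfield_def)
  have inv: "inverse x \<in> ?F" if "x \<in> ?F" for x
    using F that by (auto simp: contains_rats_as_subfield_def)
  have nat: "of_nat k \<in> ?F" for k using rat[of "of_nat k"] by simp
  have "- 1 \<in> ?F" using rat[of "- 1"] by simp
  then have neg: "- x \<in> ?F" if "x \<in> ?F" for x using mult[of "- 1" x] that by simp
  have p: "Factorial_Ring.prime p" "p \<notin> set ps" using Cons S by auto
  obtain \<delta> :: 'a where \<delta>: "\<delta> \<in> {1, - 1}" "s p ^ 2 = \<delta> * of_nat p"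
    using Cons.prems S[of p] by (cases "s p ^ 2 = of_nat p") force+
  have \<delta>F: "\<delta> \<in> ?F" using \<delta>(1) rat[of 1] neg by auto
  have sF: "s p \<notin> ?F" using nsq[of "{p}" \<delta> "s p"] p \<delta> by auto
  have "s p ^ 2 \<in> ?F" using \<delta> \<delta>F nat mult by simp
  then have 1: "contains_rats_as_subfield (sqrt_tower s (p # ps))"
    using adjoin_sqrt_subfield[OF F _ sF] by simp
  have "w ^ 2 \<noteq> \<epsilon> * of_nat (\<Prod>T)" if T: "finite T" "T \<noteq> {}" "T \<inter> set (p # ps) = {}" "\<forall>p\<in>T. Factorial_Ring.prime p"
    and \<epsilon>: "\<epsilon> \<in> {1, - 1}" and w: "w \<in> sqrt_tower s (p # ps)" for T w \<epsilon>
  proof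
    assume eq: "w ^ 2 = \<epsilon> * of_nat (\<Prod>T)"
    have \<epsilon>F: "\<epsilon> \<in> ?F" using \<epsilon> rat[of 1] neg by auto
    obtain x y where xy: "w = x + y * s p" "x \<in> ?F" "y \<in> ?F" using w by auto
    have "w ^ 2 = x * x + y * y * s p ^ 2 + 2 * x * y * s p"
      by (simp add: xy algebra_simps power2_eq_square)
    then have main: "2 * x * y * s p = \<epsilon> * of_nat (\<Prod>T) + - (x * x + y * y * (\<delta> * of_nat p))"
      using eq \<delta> by (simp add: algebra_simps)
    consider "x * y \<noteq> 0" | "y = 0" | "x = 0" by auto
    then show False
    proof cases
      case 1
      then have "s p = inverse (of_nat 2 * x * y) * (2 * x * y * s p)" by (simp add: field_simps)
      also have "\<dots> = inverse (of_nat 2 * x * y) * (\<epsilon> * of_nat (\<Prod>T) + - (x * x + y * y * (\<delta> * of_nat p)))"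
        by (simp only: main)
      also have "\<dots> \<in> ?F" using xy \<epsilon>F \<delta>F by (intro mult add inv neg nat)
      finally show False using sF by simp
    next
      case 2
      then have "x ^ 2 = \<epsilon> * of_nat (\<Prod>T)" using eq xy by simp
      then show False using nsq[of T \<epsilon> x] T \<epsilon> xy by auto
    next
      case 3
      have "\<delta> * \<delta> = 1" using \<delta>(1) by auto
      then have "(y * of_nat p) ^ 2 = (\<delta> * \<delta>) * (y * of_nat p) ^ 2" by simp
      also have "\<dots> = \<delta> * of_nat p * (y ^ 2 * s p ^ 2)"
        unfolding \<delta>(2) by (simp add: power2_eq_square mult_ac)
      also have "y ^ 2 * s p ^ 2 = \<epsilon> * of_nat (\<Prod>T)" using eq xy 3 by (simp add: power_mult_distrib)
      also have "\<delta> * of_nat p * (\<epsilon> * of_nat (\<Prod>T)) = (\<delta> * \<epsilon>) * of_nat (\<Prod>(insert p T))"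
        using T by (subst prod.insert) (auto simp: algebra_simps)
      finally show False
        using nsq[of "insert p T" "\<delta> * \<epsilon>" "y * of_nat p"] T \<epsilon> \<delta>(1) xy p nat mult by auto
    qed
  qed
  then show ?case using 1 by blast
qed

text \<open>
  Each new square root lies outside the tower over the previous ones, hence outside their rational
  span.  So the square roots are linearly independent over \<open>\<rat>\<close>, and there are at most \<open>[K:\<rat>]\<close> of them.
\<close>
lemma finite_primes_pm_square:
  assumes "number_field TYPE('k::field_char_0)"
  shows "finite {p::nat. Factorial_Ring.prime p \<and> (\<exists>s::'k. s ^ 2 \<in> {of_nat p, - of_nat p})}" (is "finite ?S")
proof (rule ccontr)
  assume inf: "infinite ?S"
  obtain B where B: "finite_dimensional_vector_space (\<lambda>(q::rat) (x::'k). of_rat q * x) B"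
    using assms by (auto simp: number_field_def)
  interpret q: finite_dimensional_vector_space "\<lambda>(q::rat) (x::'k). of_rat q * x" B by (rule B)
  obtain s :: "nat \<Rightarrow> 'k" where s: "\<And>p. p \<in> ?S \<Longrightarrow> s p ^ 2 \<in> {of_nat p, - of_nat p}"
    using bchoice[of ?S "\<lambda>p s. s ^ 2 \<in> {of_nat p, - of_nat p}"] by blast
  have S: "Factorial_Ring.prime p \<and> s p ^ 2 \<in> {of_nat p, - of_nat p}" if "p \<in> ?S" for p
    using s that by blast
  note tower = sqrt_tower[of ?S s, OF S]
  have ind: "\<lbrakk>distinct ps; set ps \<subseteq> ?S\<rbrakk> \<Longrightarrow> s ` set ps \<subseteq> sqrt_tower s ps \<and> q.independent (s ` set ps) \<and> card (s ` set ps) = length ps" for ps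
  proof (induction ps)
    case Nil
    then show ?case by (simp add: q.independent_empty)
  next
    case (Cons p ps)
    let ?F = "sqrt_tower s ps"
    have F: "contains_rats_as_subfield ?F"
      and nsq: "\<And>T x \<epsilon>. \<lbrakk>finite T; T \<noteq> {}; T \<inter> set ps = {}; \<forall>p\<in>T. Factorial_Ring.prime p; \<epsilon> \<in> {1, - 1}; x \<in> ?F\<rbrakk>
        \<Longrightarrow> x ^ 2 \<noteq> \<epsilon> * of_nat (\<Prod>T)"
      using tower[of ps] Cons.prems by auto
    have rat: "of_rat q \<in> ?F" for q using F by (auto simp: contains_rats_as_subfield_def)
    have add: "x + y \<in> ?F" and mult: "x * y \<in> ?F" if "x \<in> ?F" "y \<in> ?F" for x y
      using F that by (auto simp: contains_rats_as_subfield_def)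
    have p: "p \<in> ?S" "p \<notin> set ps" using Cons.prems by auto
    have "s p ^ 2 \<in> {1 * of_nat (\<Prod>{p}), - 1 * of_nat (\<Prod>{p})}" using s[OF p(1)] by simp
    then have nF: "s p \<notin> ?F" using nsq[of "{p}" 1 "s p"] nsq[of "{p}" "- 1" "s p"] p by auto
    have "q.subspace ?F"
      using rat[of 0] rat add mult by (intro q.subspaceI) auto
    then have "q.span (s ` set ps) \<subseteq> ?F" using Cons by (intro q.span_minimal) auto
    then have nspan: "s p \<notin> q.span (s ` set ps)" using nF by blast
    then have "s p \<notin> s ` set ps" using q.span_base by blast
    moreover have "q.independent (insert (s p) (s ` set ps))"
      using Cons nspan by (simp add: q.independent_insertI)
    moreover have "x \<in> sqrt_tower s (p # ps)" if "x \<in> ?F" for x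
      using that rat[of 0] by force
    moreover have "s p \<in> sqrt_tower s (p # ps)" using rat[of 0] rat[of 1] by force
    moreover have "s ` set ps \<subseteq> ?F" "card (s ` set ps) = length ps" using Cons by auto
    ultimately show ?case by (simp add: image_subset_iff)
  qed
  obtain T where T: "T \<subseteq> ?S" "finite T" "card T = Suc (card B)"
    using inf by (meson infinite_arbitrarily_large)
  obtain ps where ps: "set ps = T" "distinct ps" using finite_distinct_list[OF T(2)] by blast
  have "length ps = Suc (card B)" using ps T distinct_card by metis
  moreover have "q.independent (s ` set ps)" "card (s ` set ps) = length ps"
    using ind[of ps] ps T by auto
  moreover have "s ` set ps \<subseteq> q.span B" by (simp add: q.span_Basis)
  ultimately show False
    using q.independent_span_bound[OF q.finite_Basis, of "s ` set ps"] by simp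
qed

section \<open>Polynomials with coefficients in the integers and in the base field\<close>

abbreviation int_eval :: "int poly \<Rightarrow> 'a::field_char_0 \<Rightarrow> 'a" where
  "int_eval h z \<equiv> poly (map_poly of_int h) z"

lemma int_eval_mult: "int_eval (g * h) z = int_eval g z * int_eval h z"
  by (simp add: map_poly_mult_hom)

lemma int_eval_add: "int_eval (g + h) z = int_eval g z + int_eval h z"
proof -
  have "map_poly of_int (g + h) = (map_poly of_int g + map_poly of_int h :: 'a poly)"
    by (rule poly_eqI) (simp add: coeff_map_poly)
  then show ?thesis by simp
qed

lemma int_eval_smult: "int_eval (Polynomial.smult c h) z = of_int c * int_eval h z"
proof -
  have "map_poly of_int (Polynomial.smult c h) = (Polynomial.smult (of_int c) (map_poly of_int h) :: 'a poly)"
    by (rule poly_eqI) (simp add: coeff_map_poly)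
  then show ?thesis by simp
qed

lemma int_eval_pCons: "int_eval (pCons c h) z = of_int c + z * int_eval h z"
  by (cases "c = 0 \<and> h = 0") (auto simp: map_poly_pCons)

lemma int_eval_pcompose_monom:
  "int_eval (pcompose h (Polynomial.monom 1 b)) z = int_eval h (z ^ b)"
proof (induction h)
  case (pCons c h)
  have "int_eval (Polynomial.monom 1 b) z = z ^ b"
    by (simp add: map_poly_monom poly_monom)
  then show ?case
    using pCons by (simp add: pcompose_pCons int_eval_add int_eval_mult int_eval_pCons)
qed auto

lemma int_eval_prod: "int_eval (\<Prod>i\<in>A. h i) z = (\<Prod>i\<in>A. int_eval (h i) z)"
  by (induction A rule: infinite_finite_induct) (auto simp: int_eval_mult)

lemma card_roots_int_eval:
  fixes h :: "int poly"
  assumes "h \<noteq> 0"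
  shows "card {z :: 'a::field_char_0. int_eval h z = 0} \<le> Polynomial.degree h"
proof -
  have "map_poly of_int h \<noteq> (0 :: 'a poly)"
    using assms by (simp add: map_poly_eq_0_iff)
  then show ?thesis
    using card_poly_roots_bound[of "map_poly of_int h :: 'a poly"] by (simp add: degree_map_poly)
qed

lemma degree_map_poly_le: "f 0 = 0 \<Longrightarrow> Polynomial.degree (map_poly f p) \<le> Polynomial.degree p"
  by (rule degree_le) (simp add: coeff_map_poly coeff_eq_0)

abbreviation K_poly :: "'k::field poly \<Rightarrow> 'k alg_closure \<Rightarrow> 'k alg_closure" where
  "K_poly h x \<equiv> poly (map_poly to_ac h) x"

lemma K_poly_pCons: "K_poly (pCons c h) x = to_ac c + x * K_poly h x"
  by (cases "c = 0 \<and> h = 0") (auto simp: map_poly_pCons)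

lemma K_poly_diff: "K_poly (g - h) x = K_poly g x - K_poly h x"
proof -
  have "map_poly to_ac (g - h) = map_poly to_ac g - map_poly to_ac h"
    by (rule poly_eqI) (simp add: coeff_map_poly)
  then show ?thesis by simp
qed

lemma K_poly_altdef: "K_poly h x = (\<Sum>i\<le>Polynomial.degree h. to_ac (poly.coeff h i) * x ^ i)"
  by (simp add: poly_altdef degree_map_poly coeff_map_poly)

lemma K_poly_eq_0:
  assumes "Polynomial.degree h < card A" "\<And>x. x \<in> A \<Longrightarrow> K_poly h x = 0"
  shows "h = 0"
proof (rule ccontr)
  assume h: "h \<noteq> 0"
  let ?h = "map_poly to_ac h"
  have h': "?h \<noteq> 0" using h by (simp add: map_poly_eq_0_iff)
  have "card A \<le> card {x. poly ?h x = 0}"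
    using assms(2) poly_roots_finite[OF h'] by (intro card_mono) auto
  also have "\<dots> \<le> Polynomial.degree ?h" by (rule card_poly_roots_bound[OF h'])
  finally show False using assms(1) by (simp add: degree_map_poly)
qed

lemma K_poly_mult: "K_poly (g * h) x = K_poly g x * K_poly h x"
  by (simp add: map_poly_mult_hom)

lemma K_poly_add: "K_poly (g + h) x = K_poly g x + K_poly h x"
proof -
  have "map_poly to_ac (g + h) = map_poly to_ac g + map_poly to_ac h"
    by (rule poly_eqI) (simp add: coeff_map_poly)
  then show ?thesis by simp
qed

lemma K_poly_monom: "K_poly (Polynomial.monom c n) x = to_ac c * x ^ n"
  by (simp add: map_poly_monom poly_monom)

lemma K_poly_pcompose_monom: "K_poly (pcompose h (Polynomial.monom 1 b)) x = K_poly h (x ^ b)"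
  by (induction h) (simp_all add: pcompose_pCons K_poly_add K_poly_mult K_poly_pCons K_poly_monom)

lemma K_poly_eq_int_eval: "K_poly (map_poly of_int h) x = int_eval h x"
  by (simp add: map_poly_map_poly o_def)

text \<open>
  A nonzero polynomial of least degree vanishing at \<open>x\<close>; division with remainder gives the rest.
\<close>
lemma exists_minimal_poly:
  fixes x :: "'k::field_char_0 alg_closure"
  shows "\<exists>f. f \<noteq> 0 \<and> K_poly f x = 0 \<and> (\<forall>h. K_poly h x = 0 \<longrightarrow> f dvd h)"
proof -
  obtain f0 where "f0 \<noteq> 0" "K_poly f0 x = 0" using alg_closure_algebraic by blast
  then obtain f where f: "f \<noteq> 0" "K_poly f x = 0"
    and min: "\<And>g. g \<noteq> 0 \<Longrightarrow> K_poly g x = 0 \<Longrightarrow> Polynomial.degree f \<le> Polynomial.degree g"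
    using exists_least_iff[of "\<lambda>d. \<exists>g. g \<noteq> 0 \<and> K_poly g x = 0 \<and> Polynomial.degree g = d"]
    by (metis not_le)
  have "f dvd h" if h: "K_poly h x = 0" for h
  proof -
    have "K_poly h x = K_poly (f * (h div f) + h mod f) x" by simp
    then have "K_poly (h mod f) x = 0" using f h by (simp only: K_poly_add K_poly_mult) simp
    then have "h mod f = 0" using min[of "h mod f"] degree_mod_less[OF f(1), of h] by fastforce
    then show ?thesis by (simp add: dvd_eq_mod_eq_0)
  qed
  then show ?thesis using f by blast
qed

section \<open>Roots of unity of prime order\<close>

locale root_of_unity =
  fixes p :: nat and \<zeta> :: "'a::field_char_0"
  assumes prime: "Factorial_Ring.prime p" and power_p: "\<zeta> ^ p = 1" and neq_1: "\<zeta> \<noteq> 1"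
begin

lemma power_mod_p: "\<zeta> ^ (a mod p) = \<zeta> ^ a"
proof -
  have "\<zeta> ^ a = (\<zeta> ^ p) ^ (a div p) * \<zeta> ^ (a mod p)"
    by (simp flip: power_mult power_add)
  then show ?thesis by (simp add: power_p)
qed

lemma power_cong: "[a = b] (mod p) \<Longrightarrow> \<zeta> ^ a = \<zeta> ^ b"
  by (metis power_mod_p unique_euclidean_semiring_class.cong_def)

lemma power_eq_1_iff: "\<zeta> ^ a = 1 \<longleftrightarrow> p dvd a"
proof
  show "\<zeta> ^ a = 1" if "p dvd a" using that by (auto simp: power_mult power_p)
  show "p dvd a" if a: "\<zeta> ^ a = 1"
  proof (rule ccontr)
    assume "\<not> p dvd a"
    then have "coprime a p" using prime prime_imp_coprime coprime_commute by blast
    moreover have "a \<noteq> 0" using \<open>\<not> p dvd a\<close> by (auto intro: Nat.gr0I)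
    ultimately obtain x y where "a * x = p * y + 1"
      using bezout_nat[of a p] by auto
    then have "\<zeta> ^ (a * x) = \<zeta> ^ (p * y + 1)" by simp
    then show False using a neq_1 power_p by (simp add: power_mult)
  qed
qed

lemma nonzero: "\<zeta> \<noteq> 0"
  using power_p prime by (metis power_0_left prime_gt_0_nat less_not_refl zero_neq_one)

lemma power_eq_iff: "\<zeta> ^ a = \<zeta> ^ b \<longleftrightarrow> [a = b] (mod p)"
proof (induction a b rule: linorder_wlog)
  case (le a b)
  then obtain c where c: "b = a + c" using le_Suc_ex by blast
  have "\<zeta> ^ a = \<zeta> ^ b \<longleftrightarrow> \<zeta> ^ c = 1" using nonzero by (auto simp: c power_add)
  also have "\<dots> \<longleftrightarrow> [a = b] (mod p)"
    unfolding power_eq_1_iff c by (metis add.right_neutral cong_0_iff cong_add_lcancel_nat cong_sym)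
  finally show ?case .
next
  case (sym a b)
  then show ?case by (metis cong_sym)
qed

lemma inj_on_power: "inj_on (\<lambda>a. \<zeta> ^ a) {..<p}"
  by (rule inj_onI) (simp add: power_eq_iff unique_euclidean_semiring_class.cong_def)

text \<open>
  The cyclotomic polynomial of prime order.
\<close>
definition \<Phi> :: "int poly" where "\<Phi> = (\<Sum>i<p. Polynomial.monom 1 i)"

lemma poly_\<Phi>_1: "poly \<Phi> 1 = int p"
  by (simp add: \<Phi>_def poly_sum poly_monom)

lemma coeff_\<Phi>: "poly.coeff \<Phi> i = (if i < p then 1 else 0)"
  by (auto simp: \<Phi>_def coeff_sum coeff_monom)

lemma degree_\<Phi>: "Polynomial.degree \<Phi> = p - 1"
proof (rule antisym)
  show "Polynomial.degree \<Phi> \<le> p - 1" by (rule degree_le) (auto simp: coeff_\<Phi>)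
  show "p - 1 \<le> Polynomial.degree \<Phi>"
    using prime_gt_0_nat[OF prime] by (intro le_degree) (auto simp: coeff_\<Phi>)
qed

lemma int_eval_\<Phi>: "\<not> p dvd a \<Longrightarrow> int_eval \<Phi> (\<zeta> ^ a) = 0"
proof -
  assume a: "\<not> p dvd a"
  have "map_poly of_int \<Phi> = (\<Sum>i<p. Polynomial.monom 1 i :: 'a poly)"
    by (rule poly_eqI) (auto simp: coeff_map_poly coeff_\<Phi> coeff_sum coeff_monom)
  then have "int_eval \<Phi> (\<zeta> ^ a) = (\<Sum>i<p. (\<zeta> ^ a) ^ i)" by (simp add: poly_sum poly_monom)
  also have "\<dots> = ((\<zeta> ^ a) ^ p - 1) / (\<zeta> ^ a - 1)"
    using a by (intro geometric_sum) (simp add: power_eq_1_iff)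
  also have "\<dots> = 0" by (simp add: power_eq_1_iff flip: power_mult)
  finally show ?thesis .
qed

lemma card_nontrivial_powers: "card ((\<lambda>a. \<zeta> ^ a) ` {1..<p}) = p - 1"
  by (subst card_image) (auto intro: inj_on_subset[OF inj_on_power])

lemma nontrivial_powers_eq_0:
  assumes "Polynomial.degree h < p - 1" "\<And>a. a \<in> {1..<p} \<Longrightarrow> int_eval h (\<zeta> ^ a) = 0"
  shows "h = 0"
proof (rule ccontr)
  assume h: "h \<noteq> 0"
  then have "finite {z :: 'a. int_eval h z = 0}"
    by (intro poly_roots_finite) (simp add: map_poly_eq_0_iff)
  then have "card ((\<lambda>a. \<zeta> ^ a) ` {1..<p}) \<le> card {z :: 'a. int_eval h z = 0}"
    using assms(2) by (intro card_mono) auto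
  then show False using card_roots_int_eval[OF h, where 'a = 'a] assms(1) card_nontrivial_powers by simp
qed

text \<open>
  The product of the \<open>u(X\<^sup>b)\<close> over \<open>0 < b < p\<close> vanishes at all primitive \<open>p\<close>th roots of unity, so the
  monic polynomial \<open>\<Phi>\<close> divides it in \<open>\<int>[X]\<close>.  At 1 this says that \<open>p\<close> divides a power of \<open>u(1)\<close>.
\<close>
lemma prime_dvd_at_1:
  assumes u: "int_eval u (\<zeta> ^ a) = 0" and a: "\<not> p dvd a"
  shows "int p dvd poly u 1"
proof -
  define U where "U = (\<Prod>b\<in>{1..<p}. pcompose u (Polynomial.monom 1 b))"
  have root: "int_eval U (\<zeta> ^ c) = 0" if c: "c \<in> {1..<p}" for c
  proof -
    have "\<not> p dvd c" using c by (auto dest: dvd_imp_le)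
    then have "coprime c p" using prime prime_imp_coprime coprime_commute by blast
    then obtain c' where c': "[c * c' = 1] (mod p)" using cong_solve_coprime_nat by auto
    define b where "b = (c' * a) mod p"
    have "[c * b = c * (c' * a)] (mod p)"
      unfolding b_def by (simp add: unique_euclidean_semiring_class.cong_def mod_mult_right_eq)
    also have "[c * (c' * a) = 1 * a] (mod p)"
      using cong_mult[OF c' cong_refl[of a]] by (simp add: mult.assoc)
    finally have cb: "[c * b = a] (mod p)" by simp
    have "b \<noteq> 0" using cb a by (metis cong_0_iff cong_sym mult_0_right)
    then have "b \<in> {1..<p}" using prime_gt_0_nat[OF prime] by (auto simp: b_def)
    moreover have "int_eval (pcompose u (Polynomial.monom 1 b)) (\<zeta> ^ c) = 0"
      using power_cong[OF cb] u by (simp add: int_eval_pcompose_monom power_mult)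
    ultimately show ?thesis by (auto simp: U_def int_eval_prod)
  qed
  obtain Q R where QR: "pseudo_divmod U \<Phi> = (Q, R)" by fastforce
  have lc: "Polynomial.lead_coeff \<Phi> = 1"
    using prime_gt_0_nat[OF prime] by (simp add: degree_\<Phi> coeff_\<Phi>)
  have \<Phi>0: "\<Phi> \<noteq> 0" using lc by auto
  have UQR: "U = \<Phi> * Q + R" and R: "R = 0 \<or> Polynomial.degree R < p - 1"
    using pseudo_divmod[OF \<Phi>0 QR] lc by (auto simp: degree_\<Phi>)
  have "int_eval R (\<zeta> ^ c) = 0" if c: "c \<in> {1..<p}" for c
  proof -
    have "\<not> p dvd c" using c by (auto dest: dvd_imp_le)
    then show ?thesis
      using root[OF c] by (simp add: UQR int_eval_add int_eval_mult int_eval_\<Phi>)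
  qed
  then have "R = 0" using R nontrivial_powers_eq_0 by blast
  then have "poly U 1 = int p * poly Q 1" by (simp add: UQR poly_\<Phi>_1)
  moreover have "poly U 1 = poly u 1 ^ (p - 1)"
    by (simp add: U_def poly_prod poly_pcompose poly_monom)
  ultimately have "int p dvd poly u 1 ^ (p - 1)" by simp
  then show ?thesis using prime prime_dvd_power[of "int p"] by simp
qed

text \<open>
  The irreducibility of \<open>\<Phi>\<close>.  By Gauss's lemma a vanishing polynomial of smaller degree would give
  a factorization of \<open>\<Phi>\<close>, up to sign, in \<open>\<int>[X]\<close> in which both factors have a primitive \<open>p\<close>th root of unity as
  a root.  By \<open>prime_dvd_at_1\<close> both would be divisible by \<open>p\<close> at 1, but \<open>\<Phi>(1) = p\<close>.
\<close>
lemma degree_lower_bound: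
  assumes h: "int_eval h \<zeta> = 0" and h0: "h \<noteq> 0"
  shows "Polynomial.degree h \<ge> p - 1"
proof (rule ccontr)
  assume small: "\<not> ?thesis"
  have p1: "\<not> p dvd 1" using prime by auto
  obtain g0 where g0: "g0 \<noteq> 0" "int_eval g0 \<zeta> = 0"
    and min: "\<And>g. g \<noteq> 0 \<Longrightarrow> int_eval g \<zeta> = 0 \<Longrightarrow> Polynomial.degree g0 \<le> Polynomial.degree g"
    using exists_least_iff[of "\<lambda>d. \<exists>g. g \<noteq> 0 \<and> int_eval g \<zeta> = 0 \<and> Polynomial.degree g = d"] h h0
    by (metis not_le)
  define g where "g = primitive_part g0"
  have gg0: "g0 = Polynomial.smult (content g0) g" by (simp add: g_def content_times_primitive_part)
  have g: "g \<noteq> 0" "content g = 1" "Polynomial.degree g = Polynomial.degree g0"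
    using g0 by (auto simp: g_def)
  have geval: "int_eval g \<zeta> = 0"
  proof -
    have "of_int (content g0) * int_eval g \<zeta> = 0"
      using g0(2) gg0 by (metis int_eval_smult)
    then show ?thesis using g0 by simp
  qed
  obtain a q where aq: "a \<noteq> 0" "Polynomial.smult a \<Phi> = g * q + pseudo_mod \<Phi> g"
    using pseudo_mod(1)[OF g(1), of \<Phi>] by blast
  have \<Phi>\<zeta>: "int_eval \<Phi> \<zeta> = 0" using int_eval_\<Phi>[OF p1] by simp
  have "int_eval (Polynomial.smult a \<Phi>) \<zeta> = int_eval (g * q + pseudo_mod \<Phi> g) \<zeta>"
    using aq by simp
  then have "int_eval (pseudo_mod \<Phi> g) \<zeta> = 0"
    using geval \<Phi>\<zeta> by (simp add: int_eval_smult int_eval_add int_eval_mult)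
  then have "pseudo_mod \<Phi> g = 0"
    using min[of "pseudo_mod \<Phi> g"] pseudo_mod(2)[OF g(1), of \<Phi>] g(3) by fastforce
  then have eq: "Polynomial.smult a \<Phi> = g * q" using aq by simp
  have lc: "Polynomial.lead_coeff \<Phi> = 1"
    using prime_gt_0_nat[OF prime] by (simp add: degree_\<Phi> coeff_\<Phi>)
  then have "content \<Phi> = 1"
    by (metis content_dvd_coeff is_unit_normalize normalize_content)
  then have cq: "content q = normalize a"
    using arg_cong[OF eq, of content] g(2) by (simp add: content_mult)
  define q' where "q' = primitive_part q"
  have qq': "q = Polynomial.smult (normalize a) q'"
    by (metis q'_def cq content_times_primitive_part)
  have "Polynomial.smult a \<Phi> = Polynomial.smult (normalize a) (g * q')" using eq qq' by simp
  then have "Polynomial.smult (normalize a) (Polynomial.smult (sgn a) \<Phi>) = Polynomial.smult (normalize a) (g * q')"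
    by (simp add: abs_mult_sgn mult.commute)
  then have "normalize a * poly.coeff (Polynomial.smult (sgn a) \<Phi>) i = normalize a * poly.coeff (g * q') i" for i
    by (metis coeff_smult)
  then have fac: "Polynomial.smult (sgn a) \<Phi> = g * q'" using aq by (intro poly_eqI) simp
  have gp: "int p dvd poly g 1" using prime_dvd_at_1[of g 1] geval p1 by simp
  have "\<exists>c\<in>{1..<p}. int_eval g (\<zeta> ^ c) \<noteq> 0"
    using nontrivial_powers_eq_0[of g] g min[OF h0 h] small by (metis le_less_trans not_le)
  then obtain c where c: "c \<in> {1..<p}" "int_eval g (\<zeta> ^ c) \<noteq> 0" by blast
  have pc: "\<not> p dvd c" using c by (auto dest: dvd_imp_le)
  have "int_eval g (\<zeta> ^ c) * int_eval q' (\<zeta> ^ c) = 0"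
    using int_eval_\<Phi>[OF pc] by (simp flip: int_eval_mult fac add: int_eval_smult)
  then have qp: "int p dvd poly q' 1" using prime_dvd_at_1[of q' c] c pc by simp
  have "sgn a * int p = poly g 1 * poly q' 1"
    using arg_cong[OF fac, of "\<lambda>h. poly h 1"] by (simp add: poly_\<Phi>_1)
  then have "int p * int p dvd sgn a * int p" using gp qp by (metis mult_dvd_mono)
  then have "int p dvd sgn a" using prime_gt_0_nat[OF prime] by (simp only: dvd_mult_cancel_right) simp
  then have "int p dvd 1" using aq by (auto simp: sgn_if split: if_splits)
  then show False using p1 by simp
qed

end

lemma (in root_of_unity) prod_one_minus_powers: "(\<Prod>a\<in>{1..<p}. 1 - \<zeta> ^ a) = of_nat p"
proof -
  define P where "P = (\<Prod>a\<in>{1..<p}. [:- (\<zeta> ^ a), 1:])"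
  have degP: "Polynomial.degree P = p - 1"
    unfolding P_def by (subst degree_prod_eq_sum_degree) auto
  have lcP: "poly.coeff P (p - 1) = 1"
    using lead_coeff_prod[of "\<lambda>a. [:- (\<zeta> ^ a), 1:]" "{1..<p}"] degP by (simp add: P_def)
  have "P = map_poly of_int \<Phi>"
  proof (rule poly_eqI_degree_lead_coeff)
    show "poly.coeff P (p - 1) = poly.coeff (map_poly of_int \<Phi>) (p - 1)"
      using lcP prime_gt_0_nat[OF prime] by (simp add: coeff_map_poly coeff_\<Phi>)
    show "p - 1 \<le> card ((\<lambda>a. \<zeta> ^ a) ` {1..<p})" using card_nontrivial_powers by simp
    show "Polynomial.degree P \<le> p - 1" by (simp add: degP)
    show "Polynomial.degree (map_poly of_int \<Phi> :: 'a poly) \<le> p - 1" by (simp add: degree_map_poly degree_\<Phi>)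
    fix z assume "z \<in> (\<lambda>a. \<zeta> ^ a) ` {1..<p}"
    then obtain a where a: "a \<in> {1..<p}" "z = \<zeta> ^ a" by blast
    then have "\<not> p dvd a" by (auto dest: dvd_imp_le)
    then have "poly (map_poly of_int \<Phi>) z = 0" using a int_eval_\<Phi> by simp
    moreover have "poly P z = 0" unfolding P_def poly_prod using a by (intro prod_zero) auto
    ultimately show "poly P z = poly (map_poly of_int \<Phi>) z" by simp
  qed
  then have "poly P 1 = int_eval \<Phi> 1" by simp
  moreover have "int_eval \<Phi> 1 = (of_nat p :: 'a)"
  proof -
    have "map_poly of_int \<Phi> = (\<Sum>i<p. Polynomial.monom 1 i :: 'a poly)"
      by (rule poly_eqI) (auto simp: coeff_map_poly coeff_\<Phi> coeff_sum coeff_monom)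
    then show ?thesis by (simp add: poly_sum poly_monom)
  qed
  ultimately show ?thesis by (simp add: P_def poly_prod)
qed

text \<open>
  In \<open>p = (1 - \<zeta>) (1 - \<zeta>\<^sup>2) \<cdots> (1 - \<zeta>\<^bsup>p-1\<^esup>)\<close> the factors for \<open>a\<close> and \<open>p - a\<close> differ by \<open>- \<zeta>\<^bsup>p-a\<^esup>\<close>.  The powers
  of \<open>\<zeta>\<close> are squares, \<open>p\<close> being odd, and the number \<open>(p - 1)/2\<close> of signs is even.
\<close>
lemma (in root_of_unity) p_eq_square:
  assumes p: "4 dvd p - 1"
  shows "\<exists>h. int_eval h \<zeta> ^ 2 = of_nat p"
proof -
  define r where "r = (p - 1) div 2"
  have p2: "p = 2 * r + 1" and r: "even r"
    using p prime_gt_0_nat[OF prime] by (auto simp: r_def dvd_def)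
  define s where "s = (\<Prod>a\<in>{1..r}. \<zeta> ^ ((p - a) * Suc r) * (1 - \<zeta> ^ a))"
  have "of_nat p = (\<Prod>a\<in>{1..<p}. 1 - \<zeta> ^ a)" by (rule prod_one_minus_powers[symmetric])
  also have "{1..<p} = {1..r} \<union> (\<lambda>a. p - a) ` {1..r}"
  proof
    show "{1..<p} \<subseteq> {1..r} \<union> (\<lambda>a. p - a) ` {1..r}"
    proof
      fix x assume x: "x \<in> {1..<p}"
      show "x \<in> {1..r} \<union> (\<lambda>a. p - a) ` {1..r}"
      proof (cases "x \<le> r")
        case False
        then have "x = p - (p - x)" "p - x \<in> {1..r}" using x p2 by auto
        then show ?thesis by blast
      qed (use x in auto)
    qed
  qed (auto simp: p2)
  also have "(\<Prod>a\<in>{1..r} \<union> (\<lambda>a. p - a) ` {1..r}. 1 - \<zeta> ^ a) = (\<Prod>a\<in>{1..r}. 1 - \<zeta> ^ a) * (\<Prod>a\<in>(\<lambda>a. p - a) ` {1..r}. 1 - \<zeta> ^ a)"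
    by (rule prod.union_disjoint) (auto simp: p2)
  also have "(\<Prod>a\<in>(\<lambda>a. p - a) ` {1..r}. 1 - \<zeta> ^ a) = (\<Prod>a\<in>{1..r}. 1 - \<zeta> ^ (p - a))"
    by (subst prod.reindex) (auto simp: p2 inj_on_def)
  also have "(\<Prod>a\<in>{1..r}. 1 - \<zeta> ^ a) * \<dots> = (\<Prod>a\<in>{1..r}. (1 - \<zeta> ^ a) * (1 - \<zeta> ^ (p - a)))"
    by (simp add: prod.distrib)
  also have "\<dots> = (\<Prod>a\<in>{1..r}. - ((\<zeta> ^ ((p - a) * Suc r) * (1 - \<zeta> ^ a)) ^ 2))"
  proof (rule prod.cong)
    fix a assume a: "a \<in> {1..r}"
    have "\<zeta> ^ (p - a) * \<zeta> ^ a = 1" using a p2 power_p by (simp flip: power_add)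
    then have "1 - \<zeta> ^ (p - a) = - (\<zeta> ^ (p - a) * (1 - \<zeta> ^ a))" by (simp add: right_diff_distrib)
    moreover have "(\<zeta> ^ ((p - a) * Suc r)) ^ 2 = \<zeta> ^ (p - a)"
    proof -
      have "(\<zeta> ^ ((p - a) * Suc r)) ^ 2 = (\<zeta> ^ (2 * Suc r)) ^ (p - a)"
        by (simp only: power_mult[symmetric] mult_ac)
      also have "2 * Suc r = p + 1" using p2 by simp
      finally show ?thesis by (simp add: power_p)
    qed
    ultimately show "(1 - \<zeta> ^ a) * (1 - \<zeta> ^ (p - a)) = - ((\<zeta> ^ ((p - a) * Suc r) * (1 - \<zeta> ^ a)) ^ 2)"
      by (simp only: power_mult_distrib) (simp add: power2_eq_square)
  qed simp
  also have "\<dots> = s ^ 2" using r by (simp add: s_def prod_uminus prod_power_distrib)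
  finally have "s ^ 2 = of_nat p" by simp
  define h where "h = (\<Prod>a\<in>{1..r}. Polynomial.monom 1 ((p - a) * Suc r) * (1 - Polynomial.monom 1 a) :: int poly)"
  have mon: "int_eval (Polynomial.monom 1 a) \<zeta> = \<zeta> ^ a" for a by (simp add: map_poly_monom poly_monom)
  have "int_eval (1 - Polynomial.monom 1 a) \<zeta> = 1 - \<zeta> ^ a" for a
  proof -
    have "map_poly of_int (1 - Polynomial.monom 1 a) = (1 - Polynomial.monom 1 a :: 'a poly)"
      by (rule poly_eqI) (simp add: coeff_map_poly coeff_monom)
    then show ?thesis by (simp add: poly_monom)
  qed
  then have "int_eval h \<zeta> = s" by (simp add: h_def s_def int_eval_prod int_eval_mult mon)
  then show ?thesis using \<open>s ^ 2 = of_nat p\<close> by auto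
qed

lemma common_denominator:
  fixes c :: "'a \<Rightarrow> rat"
  assumes "finite A"
  shows "\<exists>D k. D \<noteq> (0::int) \<and> (\<forall>a\<in>A. of_int D * c a = of_int (k a))"
  using assms
proof (induction A rule: finite_induct)
  case (insert b A)
  then obtain D k where D: "D \<noteq> 0" "\<And>a. a \<in> A \<Longrightarrow> of_int D * c a = of_int (k a)" by auto
  obtain n d where nd: "quotient_of (c b) = (n, d)" by (cases "quotient_of (c b)") auto
  have d: "d > 0" "c b = of_int n / of_int d"
    using quotient_of_denom_pos[OF nd] quotient_of_div[OF nd] by auto
  have "\<forall>a\<in>insert b A. of_int (D * d) * c a = of_int ((k(b := D * n)) a * (if a = b then 1 else d))"
  proof
    fix a assume "a \<in> insert b A"
    then show "of_int (D * d) * c a = of_int ((k(b := D * n)) a * (if a = b then 1 else d))"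
      using d D(2)[of a] by (cases "a = b") (auto simp: mult_ac)
  qed
  moreover have "D * d \<noteq> 0" using D d by simp
  ultimately show ?case by (intro exI[of _ "D * d"] exI conjI)
qed (auto intro: exI[of _ 1])

text \<open>
  The algebraic closure as a vector space over \<open>\<rat>\<close>, with rationals embedded by way of \<open>K\<close>.
\<close>
definition rat_scale :: "rat \<Rightarrow> 'k::field_char_0 alg_closure \<Rightarrow> 'k alg_closure" where
  "rat_scale q x = to_ac (of_rat q) * x"

interpretation rat: vector_space "rat_scale :: rat \<Rightarrow> 'k::field_char_0 alg_closure \<Rightarrow> _"
  by unfold_locales (simp_all add: rat_scale_def of_rat_add of_rat_mult algebra_simps)

lemma rat_independent_powers:
  fixes \<zeta> :: "'k::field_char_0 alg_closure"
  assumes "root_of_unity p \<zeta>"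
  shows "rat.independent ((\<lambda>j. \<zeta> ^ j) ` {..<p - 1})"
proof (rule rat.independent_if_scalars_zero)
  interpret root_of_unity p \<zeta> by (rule assms)
  have inj: "inj_on (\<lambda>j. \<zeta> ^ j) {..<p - 1}" by (rule inj_on_subset[OF inj_on_power]) auto
  fix c v assume s: "(\<Sum>x\<in>(\<lambda>j. \<zeta> ^ j) ` {..<p - 1}. rat_scale (c x) x) = 0" and v: "v \<in> (\<lambda>j. \<zeta> ^ j) ` {..<p - 1}"
  obtain D k where D: "D \<noteq> 0" "\<And>x. x \<in> (\<lambda>j. \<zeta> ^ j) ` {..<p - 1} \<Longrightarrow> of_int D * c x = of_int (k x)"
    using common_denominator[of "(\<lambda>j. \<zeta> ^ j) ` {..<p - 1}" c] by auto
  define h where "h = (\<Sum>j<p - 1. Polynomial.monom (k (\<zeta> ^ j)) j)"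
  have coeff: "poly.coeff h j = (if j < p - 1 then k (\<zeta> ^ j) else 0)" for j
    by (auto simp: h_def coeff_sum coeff_monom)
  have kD: "of_int (k (\<zeta> ^ j)) = of_int D * to_ac (of_rat (c (\<zeta> ^ j)) :: 'k)" if "j < p - 1" for j
  proof -
    have "to_ac (of_rat (of_int (k (\<zeta> ^ j))) :: 'k) = to_ac (of_rat (of_int D * c (\<zeta> ^ j)))"
      using D(2)[of "\<zeta> ^ j"] that by simp
    then show ?thesis by (simp add: of_rat_mult)
  qed
  have "map_poly of_int h = (\<Sum>j<p - 1. Polynomial.monom (of_int (k (\<zeta> ^ j))) j :: 'k alg_closure poly)"
    by (rule poly_eqI) (auto simp: coeff_map_poly coeff coeff_sum coeff_monom)
  then have "int_eval h \<zeta> = (\<Sum>j<p - 1. of_int (k (\<zeta> ^ j)) * \<zeta> ^ j)"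
    by (simp add: poly_sum poly_monom)
  also have "\<dots> = of_int D * (\<Sum>j<p - 1. rat_scale (c (\<zeta> ^ j)) (\<zeta> ^ j))"
    unfolding sum_distrib_left by (intro sum.cong) (simp_all add: kD rat_scale_def)
  also have "(\<Sum>j<p - 1. rat_scale (c (\<zeta> ^ j)) (\<zeta> ^ j)) = 0"
    using s by (simp only: sum.reindex[OF inj] o_def)
  finally have "int_eval h \<zeta> = 0" by simp
  moreover have "p > 1" by (rule prime_gt_1_nat[OF prime])
  then have "Polynomial.degree h < p - 1" by (intro degree_lessI) (auto simp: coeff)
  ultimately have "h = 0" using degree_lower_bound[of h] by fastforce
  obtain j where j: "j < p - 1" "v = \<zeta> ^ j" using v by auto
  then have "k v = 0" using coeff[of j] \<open>h = 0\<close> by simp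
  then have "of_int D * c v = 0" using D(2)[OF v] by simp
  then show "c v = 0" using D(1) by simp
qed simp

lemma exists_root_of_unity:
  assumes "Factorial_Ring.prime p"
  shows "\<exists>\<zeta> :: 'k::field_char_0 alg_closure. root_of_unity p \<zeta>"
proof -
  define F where "F = (\<Sum>i<p. Polynomial.monom 1 i :: 'k alg_closure poly)"
  have p1: "p > 1" using assms by (rule prime_gt_1_nat)
  have "poly.coeff F (p - 1) \<noteq> 0" using p1 by (simp add: F_def coeff_sum coeff_monom)
  then have "Polynomial.degree F \<ge> p - 1" by (rule le_degree)
  then have "Polynomial.degree F > 0" using p1 by simp
  then obtain \<zeta> where "poly F \<zeta> = 0" using alg_closed_imp_poly_has_root by blast
  then have z: "(\<Sum>i<p. \<zeta> ^ i) = 0" by (simp add: F_def poly_sum poly_monom)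
  have "\<zeta> \<noteq> 1" using z p1 by auto
  moreover have "\<zeta> ^ p = 1" using geometric_sum[OF \<open>\<zeta> \<noteq> 1\<close>, of p] z \<open>\<zeta> \<noteq> 1\<close> by simp
  ultimately show ?thesis using assms by (intro exI[of _ \<zeta>]) (simp add: root_of_unity_def)
qed

section \<open>Cyclic actions and cyclic Galois extensions\<close>

lemma prod_cyclic_shift:
  fixes f :: "nat \<Rightarrow> 'a::comm_monoid_mult"
  assumes "f n = f 0"
  shows "(\<Prod>i<n. f (Suc i)) = (\<Prod>i<n. f i)"
proof (cases n)
  case (Suc r)
  then show ?thesis
    using assms prod.lessThan_Suc_shift[of f r] by (simp add: mult.commute del: prod.lessThan_Suc) 
      (simp add: mult.commute)
qed simp

text \<open>
  A ring \<open>R\<close> between \<open>K\<close> and its algebraic closure with an action of a cyclic group of order \<open>m\<close> that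
  fixes only \<open>K\<close>, and an element \<open>z\<close> with \<open>m\<close> different conjugates.  It follows that \<open>R\<close> is a field,
  generated by \<open>z\<close> over \<open>K\<close>, of degree \<open>m\<close>, whose \<open>K\<close>-homomorphisms to itself are the powers of \<open>\<tau>\<close>.  The map \<open>\<tau>\<close> is
  unrestricted outside \<open>R\<close>, so that the same \<open>\<tau>\<close> serves for all intermediate fields.
\<close>
locale cyclic_action =
  fixes R :: "'k::field_char_0 alg_closure set" and \<tau> :: "'k alg_closure \<Rightarrow> 'k alg_closure"
    and m :: nat and z :: "'k alg_closure"
  assumes const_closed: "to_ac c \<in> R"
    and add_closed: "\<lbrakk>x \<in> R; y \<in> R\<rbrakk> \<Longrightarrow> x + y \<in> R"
    and mult_closed: "\<lbrakk>x \<in> R; y \<in> R\<rbrakk> \<Longrightarrow> x * y \<in> R"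
    and act_closed: "x \<in> R \<Longrightarrow> \<tau> x \<in> R"
    and act_add: "\<lbrakk>x \<in> R; y \<in> R\<rbrakk> \<Longrightarrow> \<tau> (x + y) = \<tau> x + \<tau> y"
    and act_mult: "\<lbrakk>x \<in> R; y \<in> R\<rbrakk> \<Longrightarrow> \<tau> (x * y) = \<tau> x * \<tau> y"
    and act_const: "\<tau> (to_ac c) = to_ac c"
    and act_fixed: "\<lbrakk>x \<in> R; \<tau> x = x\<rbrakk> \<Longrightarrow> x \<in> range to_ac"
    and act_order: "x \<in> R \<Longrightarrow> (\<tau> ^^ m) x = x"
    and order_pos: "m > 0"
    and gen_closed: "z \<in> R"
    and conjugates_inj: "inj_on (\<lambda>i. (\<tau> ^^ i) z) {..<m}"
begin

lemma zero_closed [simp]: "0 \<in> R" and one_closed [simp]: "1 \<in> R"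
  using const_closed[of 0] const_closed[of 1] by simp_all

lemma uminus_closed: "x \<in> R \<Longrightarrow> - x \<in> R"
  using mult_closed[OF const_closed[of "- 1"], of x] by simp

lemma diff_closed: "\<lbrakk>x \<in> R; y \<in> R\<rbrakk> \<Longrightarrow> x - y \<in> R"
  using add_closed[of x "- y"] uminus_closed by simp

lemma sum_closed: "(\<And>i. i \<in> A \<Longrightarrow> f i \<in> R) \<Longrightarrow> sum f A \<in> R"
  by (induction A rule: infinite_finite_induct) (auto intro: add_closed)

lemma prod_closed: "(\<And>i. i \<in> A \<Longrightarrow> f i \<in> R) \<Longrightarrow> prod f A \<in> R"
  by (induction A rule: infinite_finite_induct) (auto intro: mult_closed)

lemma pow_closed: "x \<in> R \<Longrightarrow> x ^ i \<in> R"
  by (induction i) (auto intro: mult_closed)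

lemma iter_closed: "x \<in> R \<Longrightarrow> (\<tau> ^^ i) x \<in> R"
  by (induction i) (auto intro: act_closed)

lemma iter_add: "\<lbrakk>x \<in> R; y \<in> R\<rbrakk> \<Longrightarrow> (\<tau> ^^ i) (x + y) = (\<tau> ^^ i) x + (\<tau> ^^ i) y"
  by (induction i) (auto simp: act_add iter_closed)

lemma iter_mult: "\<lbrakk>x \<in> R; y \<in> R\<rbrakk> \<Longrightarrow> (\<tau> ^^ i) (x * y) = (\<tau> ^^ i) x * (\<tau> ^^ i) y"
  by (induction i) (auto simp: act_mult iter_closed)

lemma iter_const: "(\<tau> ^^ i) (to_ac c) = to_ac c"
  by (induction i) (auto simp: act_const)

lemma iter_0: "(\<tau> ^^ i) 0 = 0" and iter_1: "(\<tau> ^^ i) 1 = 1"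
  using iter_const[of i 0] iter_const[of i 1] by simp_all

lemma iter_uminus: "x \<in> R \<Longrightarrow> (\<tau> ^^ i) (- x) = - (\<tau> ^^ i) x"
  using iter_mult[OF const_closed[of "- 1"], of x i] iter_const[of i "- 1"] by simp

lemma iter_diff: "\<lbrakk>x \<in> R; y \<in> R\<rbrakk> \<Longrightarrow> (\<tau> ^^ i) (x - y) = (\<tau> ^^ i) x - (\<tau> ^^ i) y"
  using iter_add[of x "- y" i] by (simp add: uminus_closed iter_uminus)

lemma iter_sum: "(\<And>j. j \<in> A \<Longrightarrow> f j \<in> R) \<Longrightarrow> (\<tau> ^^ i) (sum f A) = (\<Sum>j\<in>A. (\<tau> ^^ i) (f j))"
  by (induction A rule: infinite_finite_induct) (auto simp: iter_0 iter_add sum_closed)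

lemma iter_prod: "(\<And>j. j \<in> A \<Longrightarrow> f j \<in> R) \<Longrightarrow> (\<tau> ^^ i) (prod f A) = (\<Prod>j\<in>A. (\<tau> ^^ i) (f j))"
  by (induction A rule: infinite_finite_induct) (auto simp: iter_1 iter_mult prod_closed)

lemma iter_mult_order: "x \<in> R \<Longrightarrow> (\<tau> ^^ (m * j)) x = x"
  by (induction j) (auto simp: funpow_add act_order)

lemma iter_mod: "x \<in> R \<Longrightarrow> (\<tau> ^^ (i mod m)) x = (\<tau> ^^ i) x"
proof -
  assume x: "x \<in> R"
  have "(\<tau> ^^ i) x = (\<tau> ^^ (i mod m + m * (i div m))) x" by simp
  also have "\<dots> = (\<tau> ^^ (i mod m)) x" using x by (simp only: funpow_add o_apply iter_mult_order)
  finally show ?thesis by simp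
qed

lemma iter_eq_0_iff: "x \<in> R \<Longrightarrow> (\<tau> ^^ i) x = 0 \<longleftrightarrow> x = 0"
proof
  assume x: "x \<in> R" and "(\<tau> ^^ i) x = 0"
  have "i \<le> m * Suc i" using order_pos by (cases m) auto
  then have "(m * Suc i - i) + i = m * Suc i" by (rule le_add_diff_inverse2)
  then have "(\<tau> ^^ (m * Suc i - i)) ((\<tau> ^^ i) x) = (\<tau> ^^ (m * Suc i)) x"
    by (metis funpow_add o_apply)
  also have "\<dots> = x" by (rule iter_mult_order[OF x])
  finally have "x = (\<tau> ^^ (m * Suc i - i)) ((\<tau> ^^ i) x)" by simp
  then show "x = 0" by (simp add: \<open>(\<tau> ^^ i) x = 0\<close> iter_0)
qed (simp add: iter_0)

lemma iter_gen_eq_iff: "(\<tau> ^^ i) z = (\<tau> ^^ j) z \<longleftrightarrow> i mod m = j mod m"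
proof -
  have "(\<tau> ^^ i) z = (\<tau> ^^ j) z \<longleftrightarrow> (\<tau> ^^ (i mod m)) z = (\<tau> ^^ (j mod m)) z"
    by (simp add: iter_mod gen_closed)
  also have "\<dots> \<longleftrightarrow> i mod m = j mod m"
    using conjugates_inj order_pos by (auto dest: inj_onD)
  finally show ?thesis .
qed

lemma norm_in_base:
  assumes "x \<in> R"
  shows "(\<Prod>i<m. (\<tau> ^^ i) x) \<in> range to_ac"
proof (rule act_fixed)
  show "(\<Prod>i<m. (\<tau> ^^ i) x) \<in> R" using assms by (intro prod_closed iter_closed)
  have "\<tau> (\<Prod>i<m. (\<tau> ^^ i) x) = (\<Prod>i<m. (\<tau> ^^ Suc i) x)"
    using iter_prod[of "{..<m}" "\<lambda>i. (\<tau> ^^ i) x" 1] assms by (simp add: iter_closed)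
  also have "\<dots> = (\<Prod>i<m. (\<tau> ^^ i) x)"
    using assms by (intro prod_cyclic_shift) (simp add: act_order)
  finally show "\<tau> (\<Prod>i<m. (\<tau> ^^ i) x) = (\<Prod>i<m. (\<tau> ^^ i) x)" .
qed

text \<open>
  The other conjugates of \<open>x\<close> multiply to the norm divided by \<open>x\<close>, and the norm lies in \<open>K\<close>.
\<close>
lemma inverse_closed: "x \<in> R \<Longrightarrow> inverse x \<in> R"
proof (cases "x = 0")
  assume x: "x \<in> R" and "x \<noteq> 0"
  obtain c where c: "(\<Prod>i<m. (\<tau> ^^ i) x) = to_ac c" using norm_in_base[OF x] by blast
  have "to_ac c \<noteq> 0" unfolding c[symmetric] using x \<open>x \<noteq> 0\<close> by (simp add: iter_eq_0_iff)
  have "x * (\<Prod>i\<in>{..<m} - {0}. (\<tau> ^^ i) x) = to_ac c"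
    unfolding c[symmetric] using order_pos by (simp add: prod.remove[of "{..<m}" 0])
  then have "inverse x = to_ac (inverse c) * (\<Prod>i\<in>{..<m} - {0}. (\<tau> ^^ i) x)"
    using \<open>x \<noteq> 0\<close> \<open>to_ac c \<noteq> 0\<close> by (simp add: field_simps del: to_ac_eq_0_iff)
  also have "\<dots> \<in> R" by (intro mult_closed const_closed prod_closed iter_closed x)
  finally show ?thesis .
qed simp

lemma divide_closed: "\<lbrakk>x \<in> R; y \<in> R\<rbrakk> \<Longrightarrow> x / y \<in> R"
  by (simp add: divide_inverse mult_closed inverse_closed)

lemma iter_inverse: "x \<in> R \<Longrightarrow> (\<tau> ^^ i) (inverse x) = inverse ((\<tau> ^^ i) x)"
proof (cases "x = 0")
  assume x: "x \<in> R" and "x \<noteq> 0"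
  have "(\<tau> ^^ i) x * (\<tau> ^^ i) (inverse x) = 1"
    using x \<open>x \<noteq> 0\<close> by (simp add: iter_mult[symmetric] inverse_closed iter_1)
  then show ?thesis by (metis inverse_unique)
qed (simp add: iter_0)

lemma iter_divide: "\<lbrakk>x \<in> R; y \<in> R\<rbrakk> \<Longrightarrow> (\<tau> ^^ i) (x / y) = (\<tau> ^^ i) x / (\<tau> ^^ i) y"
  by (simp add: divide_inverse iter_mult iter_inverse inverse_closed)

lemma hom_K_poly:
  assumes "\<And>x y. \<lbrakk>x \<in> R; y \<in> R\<rbrakk> \<Longrightarrow> \<theta> (x + y) = \<theta> x + \<theta> y"
    and "\<And>x y. \<lbrakk>x \<in> R; y \<in> R\<rbrakk> \<Longrightarrow> \<theta> (x * y) = \<theta> x * \<theta> y" and "\<And>c. \<theta> (to_ac c) = to_ac c" and "w \<in> R"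
  shows "K_poly h w \<in> R \<and> \<theta> (K_poly h w) = K_poly h (\<theta> w)"
proof (induction h)
  case 0
  then show ?case using assms(3)[of 0] by simp
next
  case (pCons c h)
  then show ?case using assms by (simp add: K_poly_pCons const_closed mult_closed add_closed)
qed

lemma iter_K_poly: "w \<in> R \<Longrightarrow> (\<tau> ^^ i) (K_poly h w) = K_poly h ((\<tau> ^^ i) w)"
  using hom_K_poly[of "\<tau> ^^ i" w h] by (simp add: iter_add iter_mult iter_const)

lemma K_poly_closed: "w \<in> R \<Longrightarrow> K_poly h w \<in> R"
  using hom_K_poly[of "\<lambda>x. x" w h] by simp

lemma act_poly:
  assumes "\<And>i. poly.coeff h i \<in> R" "w \<in> R"
  shows "poly h w \<in> R \<and> \<tau> (poly h w) = poly (map_poly \<tau> h) (\<tau> w)"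
  using assms(1)
proof (induction h)
  case 0
  then show ?case using iter_0[of 1] by simp
next
  case (pCons c h)
  have c: "c \<in> R" and h: "poly.coeff h i \<in> R" for i
    using pCons.prems[of 0] pCons.prems[of "Suc i"] by auto
  have "map_poly \<tau> (pCons c h) = pCons (\<tau> c) (map_poly \<tau> h)"
    using iter_0[of 1] by (cases "c = 0 \<and> h = 0") (auto simp: map_poly_pCons)
  then show ?case using pCons.IH[OF h] c assms(2) by (simp add: act_add act_mult add_closed mult_closed)
qed

lemma poly_mult_coeffs_closed:
  assumes "\<And>i. poly.coeff f i \<in> R" "\<And>i. poly.coeff g i \<in> R"
  shows "poly.coeff (f * g) i \<in> R"
  unfolding coeff_mult using assms by (intro sum_closed mult_closed)

lemma poly_prod_coeffs_closed:
  assumes "\<And>a i. a \<in> A \<Longrightarrow> poly.coeff (f a) i \<in> R"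
  shows "poly.coeff (\<Prod>a\<in>A. f a) i \<in> R"
  using assms
proof (induction A arbitrary: i rule: infinite_finite_induct)
  case (insert a A)
  then show ?case by (simp add: poly_mult_coeffs_closed)
qed (auto simp: coeff_1)

text \<open>
  Lagrange interpolation gives a polynomial \<open>h\<close> over \<open>R\<close> of degree less than \<open>m\<close> that takes each
  conjugate of \<open>z\<close> to the corresponding conjugate of \<open>x\<close>.  Applying \<open>\<tau>\<close> to its coefficients yields a
  polynomial with the same property, so by uniqueness \<open>\<tau>\<close> fixes the coefficients, which are therefore
  in \<open>K\<close>.
\<close>
lemma eq_K_poly_gen:
  assumes x: "x \<in> R"
  shows "\<exists>h. Polynomial.degree h < m \<and> x = K_poly h z"
proof -
  define y where "y = (\<lambda>i. (\<tau> ^^ i) z)"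
  have yR: "y i \<in> R" for i by (simp add: y_def iter_closed gen_closed)
  have y_inj: "y i = y j \<longleftrightarrow> i = j" if "i < m" "j < m" for i j
    using conjugates_inj that by (auto simp: y_def dest: inj_onD)
  define l where "l = (\<lambda>i. \<Prod>j\<in>{..<m} - {i}. [:- y j, 1:])"
  define c where "c = (\<lambda>i. (\<tau> ^^ i) x / poly (l i) (y i))"
  define h where "h = (\<Sum>i<m. Polynomial.smult (c i) (l i))"
  have lR: "poly.coeff (l i) j \<in> R" for i j
    unfolding l_def
  proof (rule poly_prod_coeffs_closed)
    fix a j
    show "poly.coeff [:- y a, 1:] j \<in> R"
      by (auto simp: coeff_pCons uminus_closed yR split: nat.split)
  qed
  have l_other: "poly (l i) (y j) = 0" if "j < m" "i \<noteq> j" for i j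
    unfolding l_def poly_prod using that by (intro prod_zero) auto
  have l_same: "poly (l i) (y i) \<noteq> 0" if "i < m" for i
    unfolding l_def poly_prod using that y_inj by auto
  have cR: "c i \<in> R" for i
    unfolding c_def using act_poly[OF lR yR] x by (intro divide_closed iter_closed) auto
  have hR: "poly.coeff h j \<in> R" for j
    unfolding h_def coeff_sum by (auto intro!: sum_closed mult_closed cR lR)
  have hy: "poly h (y i) = (\<tau> ^^ i) x" if "i < m" for i
  proof -
    have "poly h (y i) = (\<Sum>j<m. c j * poly (l j) (y i))" by (simp add: h_def poly_sum)
    also have "\<dots> = (\<Sum>j<m. if j = i then (\<tau> ^^ i) x else 0)"
      using that l_other l_same by (intro sum.cong) (auto simp: c_def)
    also have "\<dots> = (\<tau> ^^ i) x" using that by simp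
    finally show ?thesis .
  qed
  have deg_l: "Polynomial.degree (l i) \<le> m - 1" if "i < m" for i
  proof -
    have "Polynomial.degree (l i) \<le> sum (Polynomial.degree \<circ> (\<lambda>j. [:- y j, 1:])) ({..<m} - {i})"
      unfolding l_def by (rule degree_prod_sum_le) simp
    then show ?thesis using that by simp
  qed
  have deg_h: "Polynomial.degree h \<le> m - 1"
    unfolding h_def
  proof (rule degree_sum_le)
    show "Polynomial.degree (Polynomial.smult (c i) (l i)) \<le> m - 1" if "i \<in> {..<m}" for i
      using degree_smult_le[of "c i" "l i"] deg_l[of i] that by simp
  qed simp
  define h' where "h' = map_poly \<tau> h"
  have "h' = h"
  proof (rule poly_eqI_degree)
    have card: "card (y ` {..<m}) = m"
      using conjugates_inj by (simp add: y_def card_image)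
    show "card (y ` {..<m}) > Polynomial.degree h" using deg_h order_pos unfolding card by linarith
    have "Polynomial.degree h' \<le> Polynomial.degree h" unfolding h'_def using iter_0[of 1] by (intro degree_map_poly_le) simp
    then show "card (y ` {..<m}) > Polynomial.degree h'" using deg_h order_pos unfolding card by linarith
    fix w assume "w \<in> y ` {..<m}"
    then obtain i where i: "i < m" "w = y i" by blast
    \<comment> \<open>The cyclic predecessor of \<open>i\<close>: the value at the conjugate number \<open>i\<close> is the image under \<open>\<tau>\<close> of the value at number \<open>i'\<close>.\<close>
    define i' where "i' = (i + m - 1) mod m"
    have i': "i' < m" using order_pos by (simp add: i'_def)
    have si: "(\<tau> ^^ Suc i') v = (\<tau> ^^ i) v" if "v \<in> R" for v
    proof -
      have "Suc i' mod m = i mod m" unfolding i'_def using order_pos by (simp add: mod_Suc_eq)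
      then show ?thesis by (metis iter_mod that)
    qed
    have "poly h' (\<tau> (y i')) = \<tau> (poly h (y i'))"
      using act_poly[OF hR yR] by (simp add: h'_def)
    moreover have "\<tau> (y i') = y i" using si[OF gen_closed] by (simp add: y_def)
    ultimately show "poly h' w = poly h w"
      using hy[OF i'] hy[OF i(1)] si[OF x] i by simp
  qed
  have "\<tau> (poly.coeff h j) = poly.coeff h j" for j
  proof -
    have "poly.coeff h' j = \<tau> (poly.coeff h j)"
      unfolding h'_def using iter_0[of 1] by (simp add: coeff_map_poly)
    then show ?thesis using \<open>h' = h\<close> by simp
  qed
  then have const: "poly.coeff h j \<in> range to_ac" for j using act_fixed hR by blast
  define h0 where "h0 = map_poly of_ac h"
  have h0: "map_poly to_ac h0 = h"
    unfolding h0_def using const by (intro poly_eqI) (simp add: coeff_map_poly to_ac_of_ac)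
  have "Polynomial.degree h0 < m"
    using deg_h order_pos degree_map_poly_le[of of_ac h, OF of_ac_0] unfolding h0_def by linarith
  moreover have "x = K_poly h0 z" using hy[OF order_pos] by (simp add: h0 y_def)
  ultimately show ?thesis by blast
qed

lemma K_poly_gen_eq_0:
  assumes "Polynomial.degree h < m" "K_poly h z = 0"
  shows "h = 0"
proof (rule K_poly_eq_0)
  show "Polynomial.degree h < card ((\<lambda>i. (\<tau> ^^ i) z) ` {..<m})"
    using assms conjugates_inj by (simp add: card_image)
  fix w assume "w \<in> (\<lambda>i. (\<tau> ^^ i) z) ` {..<m}"
  then obtain i where "w = (\<tau> ^^ i) z" by blast
  then show "K_poly h w = 0" using iter_K_poly[OF gen_closed, of i h] assms by (simp add: iter_0)
qed

lemma subspace: "ac.subspace R"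
  by (rule ac.subspaceI) (auto simp: ac_scale_def add_closed mult_closed const_closed)

lemma inj_on_gen_powers: "inj_on (\<lambda>i. z ^ i) {..<m}"
proof (rule inj_onI)
  fix i j assume ij: "i \<in> {..<m}" "j \<in> {..<m}" and eq: "z ^ i = z ^ j"
  have "K_poly (Polynomial.monom 1 i - Polynomial.monom 1 j) z = 0"
    using eq by (simp add: K_poly_diff map_poly_monom poly_monom)
  moreover have "Polynomial.degree (Polynomial.monom 1 i - Polynomial.monom 1 j :: 'k poly) < m"
    using ij by (intro degree_diff_less) (auto simp: degree_monom_eq)
  ultimately have "Polynomial.monom 1 i - Polynomial.monom 1 j = (0 :: 'k poly)"
    using K_poly_gen_eq_0 by blast
  then show "i = j" by (simp add: monom_eq_iff') 
qed

lemma span_gen_powers: "ac.span ((\<lambda>i. z ^ i) ` {..<m}) = R"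
proof
  show "ac.span ((\<lambda>i. z ^ i) ` {..<m}) \<subseteq> R"
    by (intro ac.span_minimal subspace) (auto intro: pow_closed gen_closed)
  show "R \<subseteq> ac.span ((\<lambda>i. z ^ i) ` {..<m})"
  proof
    fix x assume "x \<in> R"
    then obtain h where h: "Polynomial.degree h < m" "x = K_poly h z" using eq_K_poly_gen by blast
    have "x = (\<Sum>i\<le>Polynomial.degree h. ac_scale (poly.coeff h i) (z ^ i))"
      by (simp add: h K_poly_altdef ac_scale_def)
    also have "\<dots> \<in> ac.span ((\<lambda>i. z ^ i) ` {..<m})"
      using h by (intro ac.span_sum ac.span_scale ac.span_base) auto
    finally show "x \<in> ac.span ((\<lambda>i. z ^ i) ` {..<m})" .
  qed
qed

lemma independent_gen_powers: "ac.independent ((\<lambda>i. z ^ i) ` {..<m})"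
proof (rule ac.independent_if_scalars_zero)
  show "finite ((\<lambda>i. z ^ i) ` {..<m})" by simp
  fix f v assume s: "(\<Sum>x\<in>(\<lambda>i. z ^ i) ` {..<m}. ac_scale (f x) x) = 0" and v: "v \<in> (\<lambda>i. z ^ i) ` {..<m}"
  define h where "h = (\<Sum>i<m. Polynomial.monom (f (z ^ i)) i)"
  have coeff: "poly.coeff h i = (if i < m then f (z ^ i) else 0)" for i
    by (auto simp: h_def coeff_sum coeff_monom)
  have "map_poly to_ac h = (\<Sum>i<m. Polynomial.monom (to_ac (f (z ^ i))) i)"
    by (rule poly_eqI) (auto simp: coeff_map_poly coeff coeff_sum coeff_monom)
  then have "K_poly h z = (\<Sum>i<m. ac_scale (f (z ^ i)) (z ^ i))"
    by (simp add: poly_sum poly_monom ac_scale_def)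
  also have "\<dots> = 0" using s by (simp add: sum.reindex[OF inj_on_gen_powers])
  finally have "K_poly h z = 0" .
  moreover have "Polynomial.degree h < m"
    using order_pos by (intro degree_lessI) (auto simp: coeff)
  ultimately have "h = 0" using K_poly_gen_eq_0 by blast
  then show "f v = 0" using v coeff by (metis (no_types, lifting) coeff_0 imageE lessThan_iff)
qed

lemma dim: "ac.dim R = m"
proof (rule ac.dim_unique)
  show "card ((\<lambda>i. z ^ i) ` {..<m}) = m" by (simp add: card_image inj_on_gen_powers)
  show "(\<lambda>i. z ^ i) ` {..<m} \<subseteq> R" by (auto intro: pow_closed gen_closed)
qed (simp_all add: span_gen_powers independent_gen_powers)

text \<open>
  A homomorphism over \<open>K\<close> takes roots of a polynomial over \<open>K\<close> to roots.  The polynomial \<open>F\<close> of degree \<open>m\<close> has the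
  conjugates of \<open>z\<close> as its only roots, so \<open>\<theta>\<close> takes \<open>z\<close> to one of them, and \<open>z\<close> generates \<open>R\<close>.
\<close>
lemma hom_eq_iter:
  assumes "\<And>x y. \<lbrakk>x \<in> R; y \<in> R\<rbrakk> \<Longrightarrow> \<theta> (x + y) = \<theta> x + \<theta> y"
    and "\<And>x y. \<lbrakk>x \<in> R; y \<in> R\<rbrakk> \<Longrightarrow> \<theta> (x * y) = \<theta> x * \<theta> y" and "\<And>c. \<theta> (to_ac c) = to_ac c"
  shows "\<exists>i<m. \<forall>x\<in>R. \<theta> x = (\<tau> ^^ i) x"
proof -
  have hom: "\<theta> (K_poly h z) = K_poly h (\<theta> z)" for h
    using hom_K_poly[of \<theta> z h] assms gen_closed by auto
  obtain h where h: "Polynomial.degree h < m" "z ^ m = K_poly h z"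
    using eq_K_poly_gen[OF pow_closed[OF gen_closed]] by blast
  define F where "F = Polynomial.monom 1 m - h"
  have "Polynomial.degree F = m"
    unfolding F_def using h by (subst diff_conv_add_uminus, subst degree_add_eq_left) (auto simp: degree_monom_eq)
  have Fz: "K_poly F z = 0"
    using h by (simp add: F_def K_poly_diff map_poly_monom poly_monom)
  have "\<exists>i<m. \<theta> z = (\<tau> ^^ i) z"
  proof (rule ccontr)
    assume no: "\<not> ?thesis"
    let ?A = "insert (\<theta> z) ((\<lambda>i. (\<tau> ^^ i) z) ` {..<m})"
    have "F = 0"
    proof (rule K_poly_eq_0)
      have "card ?A = Suc m" using no by (subst card_insert_disjoint) (auto simp: card_image conjugates_inj)
      then show "Polynomial.degree F < card ?A" using \<open>Polynomial.degree F = m\<close> by simp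
      fix w assume "w \<in> ?A"
      then consider "w = \<theta> z" | i where "w = (\<tau> ^^ i) z" by blast
      then show "K_poly F w = 0"
      proof cases
        case 1
        then show ?thesis using hom[of F] Fz assms(3)[of 0] by simp
      next
        case 2
        then show ?thesis using iter_K_poly[OF gen_closed, of i F] Fz by (simp add: iter_0)
      qed
    qed
    then show False using \<open>Polynomial.degree F = m\<close> order_pos by simp
  qed
  then obtain i where i: "i < m" "\<theta> z = (\<tau> ^^ i) z" by blast
  have "\<theta> x = (\<tau> ^^ i) x" if "x \<in> R" for x
  proof -
    obtain h where "x = K_poly h z" using eq_K_poly_gen[OF \<open>x \<in> R\<close>] by blast
    then show ?thesis using hom[of h] iter_K_poly[OF gen_closed, of i h] i by simp
  qed
  then show ?thesis using i by blast
qed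

lemma subfield: "subfield R (ring_of_type_algebra :: 'k alg_closure ring)"
proof -
  interpret A: Ring.field "ring_of_type_algebra :: 'k alg_closure ring" by (rule field_from_type_algebra)
  have minus: "\<ominus>\<^bsub>ring_of_type_algebra\<^esub> x = - x" for x :: "'k alg_closure"
  proof -
    have "x \<oplus>\<^bsub>ring_of_type_algebra\<^esub> (- x) = \<zero>\<^bsub>ring_of_type_algebra\<^esub>"
      by (simp add: ring_of_type_algebra_def)
    then show ?thesis by (intro A.minus_equality) (auto simp: ring_of_type_algebra_def)
  qed
  have inv: "inv\<^bsub>ring_of_type_algebra\<^esub> x = inverse x" if "x \<noteq> 0" for x :: "'k alg_closure"
    using that by (intro A.inv_char) (auto simp: ring_of_type_algebra_def)
  have "subring R (ring_of_type_algebra :: 'k alg_closure ring)"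
  proof (rule A.subringI)
    fix h assume "h \<in> R"
    then show "\<ominus>\<^bsub>ring_of_type_algebra\<^esub> h \<in> R" by (simp add: minus uminus_closed)
  qed (auto simp: ring_of_type_algebra_def intro: add_closed mult_closed)
  then show ?thesis
  proof (rule A.subfieldI')
    fix k assume "k \<in> R - {\<zero>\<^bsub>ring_of_type_algebra\<^esub>}"
    then have "k \<in> R" "k \<noteq> 0" by (auto simp: ring_of_type_algebra_def)
    then show "inv\<^bsub>ring_of_type_algebra\<^esub> k \<in> R" by (simp add: inv inverse_closed)
  qed
qed

definition Fix :: "nat \<Rightarrow> 'k alg_closure set" where
  "Fix n = {x \<in> R. (\<tau> ^^ n) x = x}"

lemma iter_iter: "(\<tau> ^^ i) ((\<tau> ^^ j) x) = (\<tau> ^^ (i + j)) x"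
  by (simp add: funpow_add)

text \<open>
  An element with \<open>n\<close> different conjugates is sought among the values at natural numbers \<open>t\<close> of
  \<open>G 0\<close>, the product of \<open>X - \<tau>\<^bsup>nj\<^esup>(z)\<close> over \<open>j < m/n\<close>.  The conjugates \<open>G i\<close> for \<open>i < n\<close> are
  different polynomials, as they have no root in common, so their values differ for almost all \<open>t\<close>.
\<close>
lemma Fix_cyclic_action:
  assumes n: "n dvd m"
  shows "\<exists>y. cyclic_action (Fix n) \<tau> n y"
proof -
  have n0: "n > 0" using n order_pos by (metis dvd_0_left_iff gr0I less_irrefl)
  obtain r where r: "m = n * r" using n by blast
  define G where "G = (\<lambda>i. \<Prod>j<r. [:- (\<tau> ^^ (n * j + i)) z, 1:])"
  have G_root: "poly (G i) ((\<tau> ^^ i') z) = 0 \<longleftrightarrow> i = i'" if "i < n" "i' < n" for i i'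
  proof -
    have r0: "r > 0" using r order_pos by (metis gr0I mult_0_right less_irrefl)
    have "poly (G i) ((\<tau> ^^ i') z) = 0 \<longleftrightarrow> (\<exists>j<r. (\<tau> ^^ i') z = (\<tau> ^^ (n * j + i)) z)"
      by (auto simp: G_def poly_prod)
    also have "\<dots> \<longleftrightarrow> (\<exists>j<r. i' = n * j + i)"
    proof -
      have "n * j + i < m" if "j < r" for j
      proof -
        have "n * j + i < n * Suc j" using \<open>i < n\<close> by simp
        also have "\<dots> \<le> n * r" using that by (intro mult_le_mono2) simp
        finally show ?thesis by (simp add: r)
      qed
      moreover have "n * 1 \<le> n * r" using r0 by (intro mult_le_mono2) simp
      then have "i' < m" using \<open>i' < n\<close> unfolding r by linarith
      ultimately show ?thesis by (auto simp: iter_gen_eq_iff)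
    qed
    also have "\<dots> \<longleftrightarrow> i = i'"
    proof
      assume "\<exists>j<r. i' = n * j + i"
      then have "i' mod n = i mod n" by auto
      then show "i = i'" using that by simp
    qed (use r0 in auto)
    finally show ?thesis .
  qed
  have act_G: "(\<tau> ^^ k) (poly (G i) (of_nat t)) = poly (G (i + k)) (of_nat t)" for i k t
  proof -
    have t: "of_nat t = to_ac (of_nat t :: 'k)" by simp
    have cl: "of_nat t - (\<tau> ^^ l) z \<in> R" for l
      unfolding t by (intro diff_closed const_closed iter_closed gen_closed)
    have "(\<tau> ^^ k) (of_nat t - (\<tau> ^^ l) z) = of_nat t - (\<tau> ^^ (l + k)) z" for l
      unfolding t by (subst iter_diff) (auto simp del: to_ac_of_nat simp: const_closed iter_closed gen_closed iter_const iter_iter add.commute)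
    then show ?thesis
      using cl by (simp add: G_def poly_prod iter_prod add.assoc)
  qed
  have GR: "poly (G i) (of_nat t) \<in> R" for i t
  proof -
    have t: "of_nat t = to_ac (of_nat t :: 'k)" by simp
    have "of_nat t - (\<tau> ^^ l) z \<in> R" for l
      unfolding t by (intro diff_closed const_closed iter_closed gen_closed)
    then show ?thesis by (simp add: G_def poly_prod prod_closed)
  qed
  have G_n: "poly (G n) (of_nat t) = poly (G 0) (of_nat t)" for t
  proof -
    have "(\<Prod>j<r. of_nat t - (\<tau> ^^ (n * Suc j)) z) = (\<Prod>j<r. of_nat t - (\<tau> ^^ (n * j)) z)"
      using act_order[OF gen_closed] by (intro prod_cyclic_shift) (simp add: r)
    then show ?thesis by (simp add: G_def poly_prod add.commute)
  qed
  define D where "D = (\<Prod>(i, j)\<in>{(i, j). i < n \<and> j < n \<and> i \<noteq> j}. G i - G j)"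
  have fin: "finite {(i, j). i < n \<and> j < n \<and> i \<noteq> j}"
    by (rule finite_subset[of _ "{..<n} \<times> {..<n}"]) auto
  have "D \<noteq> 0"
  proof -
    have "G i - G j \<noteq> 0" if "i < n" "j < n" "i \<noteq> j" for i j
      using G_root[of i i] G_root[of j i] that by auto
    then show ?thesis unfolding D_def using fin by (auto simp: prod_zero_iff)
  qed
  then have "finite {x. poly D x = 0}" by (rule poly_roots_finite)
  moreover have "infinite (range (of_nat :: nat \<Rightarrow> 'k alg_closure))"
    using infinite_UNIV_nat by (simp add: finite_image_iff inj_on_def)
  ultimately have "\<not> range of_nat \<subseteq> {x. poly D x = 0}" using finite_subset by blast
  then obtain t :: nat where t: "poly D (of_nat t) \<noteq> 0" by auto
  have G_inj: "poly (G i) (of_nat t) \<noteq> poly (G j) (of_nat t)" if "i < n" "j < n" "i \<noteq> j" for i j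
  proof
    assume "poly (G i) (of_nat t) = poly (G j) (of_nat t)"
    then have "poly D (of_nat t) = 0"
      unfolding D_def poly_prod using fin that by (intro prod_zero) (auto intro!: bexI[of _ "(i, j)"])
    then show False using t by simp
  qed
  define y where "y = poly (G 0) (of_nat t)"
  have iter_y: "(\<tau> ^^ i) y = poly (G i) (of_nat t)" for i unfolding y_def using act_G[of i 0] by simp
  have "cyclic_action (Fix n) \<tau> n y"
  proof
    show "y \<in> Fix n" using GR[of 0] G_n iter_y[of n] by (simp add: Fix_def y_def)
    show "inj_on (\<lambda>i. (\<tau> ^^ i) y) {..<n}"
      using G_inj by (intro inj_onI) (auto simp: iter_y)
    fix x assume x: "x \<in> Fix n"
    have "(\<tau> ^^ n) (\<tau> x) = \<tau> ((\<tau> ^^ n) x)" by (simp flip: funpow_swap1)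
    then show "\<tau> x \<in> Fix n" using x by (auto simp: Fix_def act_closed)
  qed (auto simp: Fix_def const_closed add_closed mult_closed iter_add iter_mult iter_const act_add
      act_mult act_const n0 intro: act_fixed)
  then show ?thesis ..
qed

end

text \<open>
  Here \<open>\<tau>\<close> is the identity outside \<open>R\<close>, as for the elements of \<^const>\<open>Gal\<close>.
\<close>
locale cyclic_galois = cyclic_action R \<tau> m z
  for R :: "'k::field_char_0 alg_closure set" and \<tau> m z +
  assumes act_outside: "x \<notin> R \<Longrightarrow> \<tau> x = x"
begin

lemma iter_outside: "x \<notin> R \<Longrightarrow> (\<tau> ^^ i) x = x"
  by (induction i) (auto simp: act_outside)

lemma iter_in_Gal: "\<tau> ^^ i \<in> Gal R"
proof -
  have "bij_betw (\<tau> ^^ i) R R"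
  proof (rule bij_betw_byWitness[of _ "\<tau> ^^ (m * i - i)"])
    have le: "i \<le> m * i" using order_pos by (cases m) auto
    show "\<forall>a\<in>R. (\<tau> ^^ (m * i - i)) ((\<tau> ^^ i) a) = a" "\<forall>a\<in>R. (\<tau> ^^ i) ((\<tau> ^^ (m * i - i)) a) = a"
      using le by (simp_all add: iter_iter iter_mult_order)
  qed (auto simp: iter_closed)
  then show ?thesis
    unfolding Gal_def by (auto intro: bij_imp_permutes simp: iter_outside iter_add iter_mult iter_const)
qed

lemma Gal_eq: "Gal R = (\<lambda>i. \<tau> ^^ i) ` {..<m}"
proof
  show "(\<lambda>i. \<tau> ^^ i) ` {..<m} \<subseteq> Gal R" using iter_in_Gal by blast
  show "Gal R \<subseteq> (\<lambda>i. \<tau> ^^ i) ` {..<m}"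
  proof
    fix \<theta> assume \<theta>: "\<theta> \<in> Gal R"
    then obtain i where i: "i < m" "\<forall>x\<in>R. \<theta> x = (\<tau> ^^ i) x"
      using hom_eq_iter[of \<theta>] by (auto simp: Gal_def)
    have "\<theta> x = (\<tau> ^^ i) x" for x
      using i \<theta> by (cases "x \<in> R") (auto simp: Gal_def iter_outside permutes_not_in)
    then show "\<theta> \<in> (\<lambda>i. \<tau> ^^ i) ` {..<m}" using i by auto
  qed
qed

lemma inj_on_iter: "inj_on (\<lambda>i. \<tau> ^^ i) {..<m}"
  using conjugates_inj by (rule inj_on_imageI2[of "\<lambda>f. f z", unfolded o_def])

lemma order_iter: "\<tau> ^^ m = id"
  using act_order iter_outside by (intro ext) (metis id_apply)

lemma group_Gal: "group (Gal_group R)"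
proof (rule groupI)
  fix x assume "x \<in> carrier (Gal_group R)"
  then obtain i where i: "i < m" "x = \<tau> ^^ i" by (auto simp: Gal_group_def Gal_eq)
  have "\<tau> ^^ (m - i) \<circ> \<tau> ^^ i = id" using i order_iter by (simp flip: funpow_add)
  then show "\<exists>y\<in>carrier (Gal_group R). y \<otimes>\<^bsub>Gal_group R\<^esub> x = \<one>\<^bsub>Gal_group R\<^esub>"
    using iter_in_Gal i by (auto simp: Gal_group_def)
next
  fix x y assume "x \<in> carrier (Gal_group R)" "y \<in> carrier (Gal_group R)"
  then show "x \<otimes>\<^bsub>Gal_group R\<^esub> y \<in> carrier (Gal_group R)"
    using iter_in_Gal by (auto simp: Gal_group_def Gal_eq simp flip: funpow_add)
qed (use iter_in_Gal[of 0] in \<open>auto simp: Gal_group_def o_assoc id_def\<close>)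

lemma cyclic_galois_extension: "cyclic_galois_extension R \<tau>"
proof -
  interpret G: group "Gal_group R" by (rule group_Gal)
  have \<tau>: "\<tau> \<in> Gal R" using iter_in_Gal[of 1] by simp
  have "generate (Gal_group R) {\<tau>} \<subseteq> Gal R"
    using G.generate_incl[of "{\<tau>}"] \<tau> by (simp add: Gal_group_def)
  moreover have "\<tau> ^^ i \<in> generate (Gal_group R) {\<tau>}" for i
  proof (induction i)
    case 0
    show ?case using generate.one[of "Gal_group R" "{\<tau>}"] by (simp add: Gal_group_def id_def)
  next
    case (Suc i)
    show ?case using generate.eng[OF generate.incl[of \<tau>] Suc] by (simp add: Gal_group_def o_def)
  qed
  ultimately have gen: "generate (Gal_group R) {\<tau>} = Gal R" by (auto simp: Gal_eq)
  have "{x \<in> R. \<forall>\<theta>\<in>Gal R. \<theta> x = x} = range to_ac"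
    using \<tau> act_fixed const_closed by (auto simp: Gal_def)
  moreover have "\<exists>B. finite B \<and> ac.span B = R" using span_gen_powers by blast
  ultimately show ?thesis
    using subfield const_closed \<tau> gen
    by (auto simp: cyclic_galois_extension_def finite_galois_extension_def intermediate_field_def)
qed

end

lemma (in cyclic_action) act_of_sqrt:
  assumes x: "x \<in> R" and sq: "x ^ 2 = to_ac c" and ns: "\<And>y. y ^ 2 \<noteq> c"
  shows "\<tau> x = - x"
proof -
  have "\<tau> x ^ 2 = x ^ 2"
    using act_mult[OF x x] act_const[of c] sq by (simp add: power2_eq_square)
  then have "\<tau> x = x \<or> \<tau> x = - x" by (simp add: power2_eq_iff)
  moreover have "\<tau> x \<noteq> x"
  proof
    assume "\<tau> x = x"
    then obtain y where "x = to_ac y" using act_fixed x by blast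
    then have "to_ac (y ^ 2) = to_ac c" using sq by simp
    then show False using ns by (simp only: to_ac_eq_iff)
  qed
  ultimately show ?thesis by simp
qed

text \<open>
  The action negates the square root of \<open>p\<close> and a square root of \<open>- 1\<close>, neither of them being in \<open>K\<close>.
  So it fixes their product, which then is a square root of \<open>- p\<close> in \<open>K\<close>.
\<close>
lemma (in cyclic_action) no_sqrt_minus_1:
  assumes no_i: "\<And>y::'k. y ^ 2 \<noteq> - 1" and ns: "\<And>y::'k. y ^ 2 \<noteq> of_nat p \<and> y ^ 2 \<noteq> - of_nat p"
    and s: "s \<in> R" "s ^ 2 = of_nat p" and x: "x \<in> R"
  shows "x ^ 2 \<noteq> - 1"
proof
  assume sq: "x ^ 2 = - 1"
  have "\<tau> x = - x" using act_of_sqrt[OF x, of "- 1"] no_i sq by simp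
  moreover have "\<tau> s = - s" using act_of_sqrt[OF s(1), of "of_nat p"] ns s(2) by simp
  ultimately have "\<tau> (x * s) = x * s" using x s by (simp add: act_mult)
  then obtain y where y: "x * s = to_ac y" using act_fixed mult_closed x s(1) by blast
  have "to_ac (y ^ 2) = (x * s) ^ 2" by (simp add: y)
  also have "\<dots> = to_ac (- of_nat p)" by (simp add: power_mult_distrib sq s(2))
  finally have "to_ac (y ^ 2) = to_ac (- of_nat p)" .
  then have "y ^ 2 = - of_nat p" by (simp only: to_ac_eq_iff)
  then show False using ns by blast
qed

lemma (in cyclic_action) cyclic_galois_extend_id:
  "cyclic_galois R (\<lambda>x. if x \<in> R then \<tau> x else x) m z"
proof -
  let ?\<sigma> = "\<lambda>x. if x \<in> R then \<tau> x else x"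
  have iter: "(?\<sigma> ^^ i) x = (\<tau> ^^ i) x" if "x \<in> R" for i x
    using that by (induction i) (simp_all add: iter_closed)
  show ?thesis
  proof
    show "inj_on (\<lambda>i. (?\<sigma> ^^ i) z) {..<m}" using conjugates_inj by (simp add: iter gen_closed)
    show "(?\<sigma> ^^ m) x = x" if "x \<in> R" for x using that by (simp add: iter act_order)
  qed (auto simp: const_closed add_closed mult_closed act_closed act_add act_mult act_const order_pos gen_closed
      intro: act_fixed split: if_splits)
qed

section \<open>The skew-forms of a cyclic extension\<close>

lemma (in vector_space_pair) dim_injective_image:
  assumes f: "Vector_Spaces.linear s1 s2 f" and inj: "inj_on f (vs1.span U)"
  shows "vs2.dim (f ` U) = vs1.dim U"
proof -
  interpret f: Vector_Spaces.linear s1 s2 f by (rule f)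
  obtain B where B: "B \<subseteq> U" "vs1.independent B" "U \<subseteq> vs1.span B" "card B = vs1.dim U"
    using vs1.basis_exists by blast
  have span: "vs1.span B = vs1.span U"
    using B by (metis subset_antisym vs1.span_mono vs1.span_minimal vs1.subspace_span)
  have "vs2.span (f ` B) = vs2.span (f ` U)" by (simp add: f.span_image span)
  moreover have "vs2.independent (f ` B)"
    using B(2) inj by (intro f.independent_injective_image) (simp_all add: span)
  ultimately have "vs2.dim (f ` U) = card (f ` B)" by (rule vs2.dim_eq_card)
  also have "\<dots> = card B"
    using inj B(1) vs1.span_superset by (intro card_image) (meson inj_on_subset subset_trans)
  finally show ?thesis using B(4) by simp
qed

lemma dim_scaled:
  assumes "c \<noteq> 0"
  shows "ac.dim ((\<lambda>x. c * x) ` U) = ac.dim U"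
proof -
  interpret P: vector_space_pair "ac_scale :: 'k::field \<Rightarrow> _" "ac_scale :: 'k \<Rightarrow> _" ..
  have "Vector_Spaces.linear ac_scale ac_scale (\<lambda>x. c * x)"
    by unfold_locales (simp_all add: ac_scale_def algebra_simps)
  then show ?thesis using assms by (intro P.dim_injective_image) (auto intro: inj_onI)
qed

lemma prod_lessThan_add:
  fixes f :: "nat \<Rightarrow> 'a::comm_monoid_mult"
  shows "(\<Prod>i<a + b. f i) = (\<Prod>i<a. f i) * (\<Prod>i<b. f (a + i))"
  by (induction b) (simp_all add: mult.assoc)

lemma prod_periodic:
  fixes f :: "nat \<Rightarrow> 'a::comm_monoid_mult"
  assumes "\<And>t. f (m + t) = f t"
  shows "(\<Prod>t<m * r. f t) = (\<Prod>t<m. f t) ^ r"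
proof (induction r)
  case (Suc r)
  have "(\<Prod>t<m * Suc r. f t) = (\<Prod>t<m. f t) * (\<Prod>t<m * r. f (m + t))"
    by (simp only: mult_Suc_right prod_lessThan_add)
  then show ?case by (simp add: assms Suc)
qed simp

lemma prod_even_odd:
  fixes f :: "nat \<Rightarrow> 'a::comm_monoid_mult"
  shows "(\<Prod>t<m. f (2 * t)) * (\<Prod>t<m. f (Suc (2 * t))) = (\<Prod>t<2 * m. f t)"
  by (induction m) (simp_all add: mult_ac)

lemma power_2_power_eq_1:
  fixes r :: "'a::field"
  assumes "\<And>j. (r ^ j) ^ 2 \<noteq> - 1" "r ^ 2 ^ s = 1"
  shows "r = 1 \<or> r = - 1"
  using assms(2)
proof (induction s)
  case (Suc s)
  have "(r ^ 2 ^ s) ^ 2 = 1" using Suc.prems by (simp add: power_mult[symmetric] mult.commute)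
  then consider "r ^ 2 ^ s = 1" | "r ^ 2 ^ s = - 1" using power2_eq_1_iff by blast
  then show ?case
  proof cases
    case 1
    then show ?thesis by (rule Suc.IH)
  next
    case 2
    show ?thesis
    proof (cases s)
      case 0
      then show ?thesis using 2 by simp
    next
      case (Suc s')
      then have "(r ^ 2 ^ s') ^ 2 = - 1" using 2 by (simp add: power_mult[symmetric] mult.commute)
      then show ?thesis using assms(1) by blast
    qed
  qed
qed simp

context cyclic_galois
begin

lemma Tr_eq: "Tr R a = of_ac (\<Sum>i<m. (\<tau> ^^ i) a)"
  unfolding Tr_def Gal_eq by (subst sum.reindex[OF inj_on_iter]) simp

lemma trace_sum_act: "a \<in> R \<Longrightarrow> (\<Sum>i<m. (\<tau> ^^ i) (\<tau> a)) = (\<Sum>i<m. (\<tau> ^^ i) a)"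
proof -
  assume a: "a \<in> R"
  have "(\<Sum>i<m. (\<tau> ^^ Suc i) a) + a = (\<Sum>i<m. (\<tau> ^^ i) a) + a"
    using sum.lessThan_Suc_shift[of "\<lambda>i. (\<tau> ^^ i) a" m] sum.lessThan_Suc[of "\<lambda>i. (\<tau> ^^ i) a" m] act_order[OF a]
    by (simp add: add.commute del: funpow.simps(2))
  then show ?thesis by (simp add: funpow_swap1)
qed

lemma to_ac_Tr: "a \<in> R \<Longrightarrow> to_ac (Tr R a) = (\<Sum>i<m. (\<tau> ^^ i) a)"
proof -
  assume a: "a \<in> R"
  have "(\<Sum>i<m. (\<tau> ^^ i) a) \<in> range to_ac"
  proof (rule act_fixed)
    show "(\<Sum>i<m. (\<tau> ^^ i) a) \<in> R" using a by (intro sum_closed iter_closed)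
    show "\<tau> (\<Sum>i<m. (\<tau> ^^ i) a) = (\<Sum>i<m. (\<tau> ^^ i) a)"
      using iter_sum[of "{..<m}" "\<lambda>i. (\<tau> ^^ i) a" 1] trace_sum_act[OF a] a
      by (simp add: iter_closed funpow_swap1)
  qed
  then show ?thesis by (simp add: Tr_eq to_ac_of_ac)
qed

lemma Tr_add: "\<lbrakk>a \<in> R; b \<in> R\<rbrakk> \<Longrightarrow> Tr R (a + b) = Tr R a + Tr R b"
  by (rule to_ac_eq_iff[THEN iffD1]) (simp add: to_ac_Tr add_closed iter_add sum.distrib)

lemma Tr_uminus: "a \<in> R \<Longrightarrow> Tr R (- a) = - Tr R a"
  by (rule to_ac_eq_iff[THEN iffD1]) (simp add: to_ac_Tr uminus_closed iter_uminus sum_negf)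

lemma Tr_diff: "\<lbrakk>a \<in> R; b \<in> R\<rbrakk> \<Longrightarrow> Tr R (a - b) = Tr R a - Tr R b"
  using Tr_add[of a "- b"] by (simp add: uminus_closed Tr_uminus)

lemma Tr_scale: "a \<in> R \<Longrightarrow> Tr R (to_ac c * a) = c * Tr R a"
  by (rule to_ac_eq_iff[THEN iffD1])
    (simp add: to_ac_Tr mult_closed const_closed iter_mult iter_const sum_distrib_left)

lemma Tr_act: "a \<in> R \<Longrightarrow> Tr R (\<tau> a) = Tr R a"
  by (rule to_ac_eq_iff[THEN iffD1]) (simp add: to_ac_Tr act_closed trace_sum_act)

lemma Tr_nondegenerate:
  assumes c: "c \<in> R" and *: "\<And>y. y \<in> R \<Longrightarrow> Tr R (y * c) = 0"
  shows "c = 0"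
proof (rule ccontr)
  assume "c \<noteq> 0"
  then have "Tr R 1 = 0" using *[OF inverse_closed[OF c]] by simp
  then have "to_ac 0 = (of_nat m :: 'k alg_closure)" using to_ac_Tr[OF one_closed] by (simp add: iter_1)
  then show False using order_pos by simp
qed

abbreviation skew :: "'k alg_closure \<Rightarrow> 'k form" where
  "skew b \<equiv> skew_form R b \<tau>"

lemma skew_outside: "x \<notin> R \<or> y \<notin> R \<Longrightarrow> skew b x y = 0"
  by (auto simp: skew_form_def)

lemma skew_eq:
  assumes "b \<in> R" "x \<in> R" "y \<in> R"
  shows "skew b x y = Tr R (\<tau> y * (b * x - \<tau> b * \<tau> (\<tau> x)))"
proof -
  have "skew b x y = Tr R (b * x * \<tau> y) - Tr R (b * \<tau> x * y)"
    using assms by (simp add: skew_form_def right_diff_distrib Tr_diff mult_closed act_closed mult.assoc)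
  also have "Tr R (b * \<tau> x * y) = Tr R (\<tau> b * \<tau> (\<tau> x) * \<tau> y)"
    using Tr_act[of "b * \<tau> x * y"] assms by (simp add: act_mult mult_closed act_closed)
  also have "Tr R (b * x * \<tau> y) - \<dots> = Tr R (\<tau> y * (b * x - \<tau> b * \<tau> (\<tau> x)))"
    using assms by (simp add: algebra_simps Tr_diff mult_closed act_closed)
  finally show ?thesis .
qed

text \<open>
  By \<open>skew_eq\<close> the value is the trace of \<open>\<tau>(y)\<close> times \<open>b x - \<tau>(b) \<tau>\<^sup>2(x)\<close>, where \<open>\<tau>(y)\<close> is arbitrary,
  and the trace form is nondegenerate.
\<close>
lemma radical_skew:
  assumes b: "b \<in> R"
  shows "radical R (skew b) = {x \<in> R. b * x = \<tau> b * \<tau> (\<tau> x)}"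
proof (intro Set.set_eqI iffI)
  fix x assume "x \<in> {x \<in> R. b * x = \<tau> b * \<tau> (\<tau> x)}"
  then show "x \<in> radical R (skew b)" using b Tr_scale[of 0 0] by (auto simp: radical_def skew_eq)
next
  fix x assume "x \<in> radical R (skew b)"
  then have x: "x \<in> R" and rad: "\<And>y. y \<in> R \<Longrightarrow> skew b x y = 0" by (auto simp: radical_def)
  have "b * x - \<tau> b * \<tau> (\<tau> x) = 0"
  proof (rule Tr_nondegenerate)
    show "b * x - \<tau> b * \<tau> (\<tau> x) \<in> R" using b x by (intro diff_closed mult_closed act_closed)
    fix y assume y: "y \<in> R"
    have "\<tau> ((\<tau> ^^ (m - 1)) y) = (\<tau> ^^ m) y"
      using order_pos by (cases m) simp_all
    then have "\<tau> ((\<tau> ^^ (m - 1)) y) = y" using act_order[OF y] by simp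
    then show "Tr R (y * (b * x - \<tau> b * \<tau> (\<tau> x))) = 0"
      using rad[OF iter_closed[OF y, of "m - 1"]] skew_eq[OF b x iter_closed[OF y, of "m - 1"]] by simp
  qed
  then show "x \<in> {x \<in> R. b * x = \<tau> b * \<tau> (\<tau> x)}" using x by simp
qed

lemma skew_add: "\<lbrakk>a \<in> R; b \<in> R\<rbrakk> \<Longrightarrow> skew (a + b) = skew a + skew b"
  by (intro ext) (simp add: skew_form_def distrib_right Tr_add mult_closed diff_closed act_closed)

lemma skew_scale: "b \<in> R \<Longrightarrow> skew (ac_scale c b) = form_scale c (skew b)"
  by (intro ext)
    (simp add: skew_form_def ac_scale_def form_scale_def mult.assoc Tr_scale mult_closed diff_closed act_closed)

lemma skew_0: "skew 0 = 0"
  using skew_scale[of 0 0] by (simp add: ac_scale_def form_scale_def fun_eq_iff)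

lemma skew_sum: "(\<And>i. i \<in> A \<Longrightarrow> f i \<in> R) \<Longrightarrow> skew (sum f A) = (\<Sum>i\<in>A. skew (f i))"
  by (induction A rule: infinite_finite_induct) (simp_all add: skew_0 skew_add sum_closed)

lemma skew_in_Alt: "b \<in> R \<Longrightarrow> skew b \<in> Alt R"
proof -
  assume b: "b \<in> R"
  have "skew b (x + x') y = skew b x y + skew b x' y \<and> skew b y (x + x') = skew b y x + skew b y x'"
    if "x \<in> R" "x' \<in> R" "y \<in> R" for x x' y
  proof -
    have "b * ((x + x') * \<tau> y - \<tau> (x + x') * y) = b * (x * \<tau> y - \<tau> x * y) + b * (x' * \<tau> y - \<tau> x' * y)"
      "b * (y * \<tau> (x + x') - \<tau> y * (x + x')) = b * (y * \<tau> x - \<tau> y * x) + b * (y * \<tau> x' - \<tau> y * x')"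
      using that by (simp_all add: act_add algebra_simps)
    then show ?thesis
      using that b by (simp add: skew_form_def add_closed Tr_add mult_closed diff_closed act_closed)
  qed
  moreover have "skew b (ac_scale c x) y = c * skew b x y \<and> skew b x (ac_scale c y) = c * skew b x y"
    if "x \<in> R" "y \<in> R" for c x y
  proof -
    have 1: "to_ac c * x * \<tau> y - \<tau> (to_ac c * x) * y = to_ac c * (x * \<tau> y - \<tau> x * y)"
      and 2: "x * \<tau> (to_ac c * y) - \<tau> x * (to_ac c * y) = to_ac c * (x * \<tau> y - \<tau> x * y)"
      using that by (simp_all add: act_mult act_const const_closed algebra_simps)
    show ?thesis
      using that b
      by (simp add: skew_form_def ac_scale_def mult_closed const_closed 1 2 mult.left_commute[of b]
          Tr_scale diff_closed act_closed)
  qed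
  moreover have "skew b x x = 0" if "x \<in> R" for x
    using that Tr_scale[of 0 0] by (simp add: skew_form_def mult.commute)
  ultimately show ?thesis by (auto simp: Alt_def skew_outside)
qed


definition Neg :: "nat \<Rightarrow> 'k alg_closure set" where
  "Neg n = {x \<in> R. (\<tau> ^^ n) x = - x}"

lemma Fix_subset: "Fix n \<subseteq> R" and Neg_subset: "Neg n \<subseteq> R"
  by (auto simp: Fix_def Neg_def)

lemma Fix_add: "\<lbrakk>x \<in> Fix n; y \<in> Fix n\<rbrakk> \<Longrightarrow> x + y \<in> Fix n"
  and Neg_add: "\<lbrakk>x \<in> Neg n; y \<in> Neg n\<rbrakk> \<Longrightarrow> x + y \<in> Neg n"
  by (auto simp: Fix_def Neg_def add_closed iter_add)

lemma Fix_scale: "x \<in> Fix n \<Longrightarrow> ac_scale c x \<in> Fix n"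
  and Neg_scale: "x \<in> Neg n \<Longrightarrow> ac_scale c x \<in> Neg n"
  by (auto simp: Fix_def Neg_def ac_scale_def mult_closed const_closed iter_mult iter_const)

lemma Fix_0: "0 \<in> Fix n" and Neg_0: "0 \<in> Neg n"
  by (auto simp: Fix_def Neg_def iter_0)

lemma subspace_Fix: "ac.subspace (Fix n)" and subspace_Neg: "ac.subspace (Neg n)"
  by (auto intro!: ac.subspaceI Fix_0 Neg_0 Fix_add Neg_add Fix_scale Neg_scale)

lemma dim_Fix: "n dvd m \<Longrightarrow> ac.dim (Fix n) = n"
  using Fix_cyclic_action cyclic_action.dim by blast

text \<open>
  With \<open>y\<close> a generator of the fixed field of \<open>\<tau>\<^bsup>2n\<^esup>\<close> over \<open>K\<close>, the difference \<open>y - \<tau>\<^sup>n(y)\<close> is nonzero and is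
  negated by \<open>\<tau>\<^sup>n\<close>.
\<close>
lemma Neg_nonzero:
  assumes "2 * n dvd m"
  shows "\<exists>x\<in>Neg n. x \<noteq> 0"
proof -
  have "2 * n > 0" using assms order_pos by (metis dvd_0_left_iff gr0I less_irrefl)
  obtain y where y: "cyclic_action (Fix (2 * n)) \<tau> (2 * n) y" using Fix_cyclic_action[OF assms] by blast
  have yF: "y \<in> R" "(\<tau> ^^ (2 * n)) y = y"
    using cyclic_action.gen_closed[OF y] by (auto simp: Fix_def)
  have "(\<tau> ^^ n) y \<noteq> (\<tau> ^^ 0) y"
    using cyclic_action.iter_gen_eq_iff[OF y, of n 0] \<open>2 * n > 0\<close> by simp
  moreover have "(\<tau> ^^ n) (y - (\<tau> ^^ n) y) = - (y - (\<tau> ^^ n) y)"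
    using yF by (simp add: iter_diff iter_closed iter_iter mult_2)
  ultimately show ?thesis
    using yF by (intro bexI[of _ "y - (\<tau> ^^ n) y"]) (auto simp: Neg_def diff_closed iter_closed)
qed

text \<open>
  A nonzero element of \<open>Neg n\<close> spans it over the fixed field of \<open>\<tau>\<^sup>n\<close>.
\<close>
lemma dim_Neg:
  assumes "2 * n dvd m"
  shows "ac.dim (Neg n) = n"
proof -
  obtain \<theta> where \<theta>: "\<theta> \<in> Neg n" "\<theta> \<noteq> 0" using Neg_nonzero[OF assms] by blast
  have "Neg n = (\<lambda>x. \<theta> * x) ` Fix n"
  proof
    show "(\<lambda>x. \<theta> * x) ` Fix n \<subseteq> Neg n"
      using \<theta> by (auto simp: Fix_def Neg_def mult_closed iter_mult)
    show "Neg n \<subseteq> (\<lambda>x. \<theta> * x) ` Fix n"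
    proof
      fix x assume "x \<in> Neg n"
      then have "x / \<theta> \<in> Fix n" using \<theta> by (auto simp: Fix_def Neg_def divide_closed iter_divide)
      moreover have "x = \<theta> * (x / \<theta>)" using \<theta> by simp
      ultimately show "x \<in> (\<lambda>x. \<theta> * x) ` Fix n" by blast
    qed
  qed
  then show ?thesis using dim_scaled[OF \<theta>(2), of "Fix n"] dim_Fix assms by (metis dvd_mult_right)
qed

lemma inj_on_skew:
  assumes "m > 2"
  shows "inj_on skew R"
proof (rule inj_onI)
  fix a b assume ab: "a \<in> R" "b \<in> R" and eq: "skew a = skew b"
  define c where "c = a - b"
  have c: "c \<in> R" using ab by (simp add: c_def diff_closed)
  have "skew b + skew c = skew a" using skew_add[OF ab(2) c] by (simp add: c_def)
  then have "skew c = 0" using eq by simp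
  then have "radical R (skew c) = R" by (auto simp: radical_def)
  then have rad: "c * x = \<tau> c * \<tau> (\<tau> x)" if "x \<in> R" for x using that radical_skew[OF c] by blast
  have "\<tau> c = c" using rad[of 1] iter_1[of 2] by (simp add: numeral_2_eq_2)
  then have "c * (z - \<tau> (\<tau> z)) = 0" using rad[OF gen_closed] by (simp add: right_diff_distrib)
  moreover have "(\<tau> ^^ 2) z \<noteq> (\<tau> ^^ 0) z" using iter_gen_eq_iff[of 2 0] assms by simp
  ultimately have "c = 0" by (simp add: numeral_2_eq_2)
  then show "a = b" unfolding c_def by (rule right_minus_eq[THEN iffD1])
qed

text \<open>
  The map \<^term>\<open>skew\<close> is linear on \<open>R\<close> only; the proof replaces it by a linear map on the whole
  algebraic closure that agrees with it on \<open>U\<close>.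
\<close>
lemma dim_skew_image:
  assumes "m > 2" "U \<subseteq> R" "ac.subspace U"
  shows "form.dim (skew ` U) = ac.dim U"
proof -
  interpret P: vector_space_pair "ac_scale :: 'k \<Rightarrow> _" "form_scale :: 'k \<Rightarrow> _"
    by (intro vector_space_pair.intro ac.vector_space_axioms form.vector_space_axioms)
  obtain B where B: "B \<subseteq> U" "ac.independent B" "U \<subseteq> ac.span B" by (rule ac.basis_exists)
  obtain g where g: "Vector_Spaces.linear ac_scale form_scale g" "\<And>x. x \<in> B \<Longrightarrow> g x = skew x"
    using P.linear_independent_extend[OF B(2), of skew] by auto
  interpret g: Vector_Spaces.linear "ac_scale :: 'k \<Rightarrow> _" "form_scale :: 'k \<Rightarrow> _" g by (rule g)
  have "ac.subspace {x \<in> R. g x = skew x}"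
    using subspace
    by (intro ac.subspaceI) (auto simp: g.zero skew_0 g.add skew_add g.scale skew_scale ac.subspace_add ac.subspace_scale)
  moreover have "B \<subseteq> {x \<in> R. g x = skew x}" using B assms g by auto
  ultimately have "ac.span B \<subseteq> {x \<in> R. g x = skew x}" by (intro ac.span_minimal)
  then have eq: "g x = skew x" if "x \<in> U" for x using B that by auto
  have spanU: "ac.span U = U" using assms by (simp add: ac.span_eq_iff)
  have "inj_on g (ac.span U)"
    unfolding spanU using inj_on_subset[OF inj_on_skew[OF assms(1)] assms(2)] eq by (simp add: inj_on_def)
  then have "form.dim (g ` U) = ac.dim U" using P.dim_injective_image[OF g(1)] by blast
  moreover have "g ` U = skew ` U" using eq by (intro image_cong) auto
  ultimately show ?thesis by simp
qed

lemma subspace_skew_image: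
  assumes "U \<subseteq> R" "ac.subspace U"
  shows "form.subspace (skew ` U)"
proof (rule form.subspaceI)
  show "0 \<in> skew ` U" using skew_0 ac.subspace_0[OF assms(2)] by (metis image_eqI)
  show "f + g \<in> skew ` U" if fg: "f \<in> skew ` U" "g \<in> skew ` U" for f g
  proof -
    obtain a b where "f = skew a" "a \<in> U" "g = skew b" "b \<in> U" using fg by blast
    then show ?thesis using skew_add[of a b] ac.subspace_add[OF assms(2)] assms(1) by (metis image_eqI subsetD)
  qed
  show "form_scale c f \<in> skew ` U" if f: "f \<in> skew ` U" for c f
  proof -
    obtain a where "f = skew a" "a \<in> U" using f by blast
    then show ?thesis using skew_scale[of a c] ac.subspace_scale[OF assms(2)] assms(1) by (metis image_eqI subsetD)
  qed
qed

lemma rank_subspace_skew_image: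
  assumes "U \<subseteq> R" "ac.subspace U" "\<And>b. \<lbrakk>b \<in> U; b \<noteq> 0\<rbrakk> \<Longrightarrow> form_rank R (skew b) = r"
  shows "rank_subspace R r (skew ` U)"
  using assms skew_in_Alt subspace_skew_image[OF assms(1,2)] skew_0 unfolding rank_subspace_def by blast

lemma skew_space_eq: "skew_space R \<tau> = skew ` R"
  by (auto simp: skew_space_def)

text \<open>
  Write \<open>w = \<tau>(y)\<close>.  The norms of \<open>b\<close> and \<open>\<tau>(b)\<close> to the fixed field of \<open>\<tau>\<^sup>2\<close> are the \<open>2\<^sup>s\<close>th powers of \<open>y\<close> and
  \<open>w\<close>, and a nonzero element of the radical would make them equal.  As there is no square root of
  \<open>- 1\<close>, this would mean \<open>y = w\<close> or \<open>y = - w\<close>.  Both contradict \<open>y w = q\<^sup>2\<close> and \<open>\<tau>(q) = - q\<close>: in the first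
  case \<open>q\<close> is \<open>y\<close> or \<open>- y\<close> and so fixed by \<open>\<tau>\<close>, in the second case \<open>q/w\<close> is a square root of \<open>- 1\<close>.
\<close>
lemma form_rank_eq_order:
  assumes no_i: "\<And>x. x \<in> R \<Longrightarrow> x ^ 2 \<noteq> - 1"
    and m: "m = n * 2 ^ Suc s" and n: "even n" and b: "b \<in> Neg n" "b \<noteq> 0"
  shows "form_rank R (skew b) = m"
proof -
  have bR: "b \<in> R" and bn: "(\<tau> ^^ n) b = - b" using b by (auto simp: Neg_def)
  have b2n: "(\<tau> ^^ (2 * n + i)) b = (\<tau> ^^ i) b" for i
  proof -
    have "(\<tau> ^^ (i + (n + n))) b = (\<tau> ^^ i) ((\<tau> ^^ n) ((\<tau> ^^ n) b))" by (simp only: iter_iter)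
    also have "\<dots> = (\<tau> ^^ i) b" using bR by (simp add: bn iter_uminus)
    finally have "(\<tau> ^^ (i + (n + n))) b = (\<tau> ^^ i) b" .
    moreover have "2 * n + i = i + (n + n)" by simp
    ultimately show ?thesis by (simp only:)
  qed
  define y where "y = (\<Prod>t<n. (\<tau> ^^ (2 * t)) b)"
  define w where "w = (\<Prod>t<n. (\<tau> ^^ Suc (2 * t)) b)"
  define q where "q = (\<Prod>t<n. (\<tau> ^^ t) b)"
  have R: "y \<in> R" "w \<in> R" "q \<in> R" unfolding y_def w_def q_def using bR by (auto intro!: prod_closed iter_closed simp del: funpow.simps)
  have nz: "y \<noteq> 0" "w \<noteq> 0" "q \<noteq> 0" using bR b(2) by (simp_all add: y_def w_def q_def iter_eq_0_iff del: funpow.simps)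
  have \<tau>y: "\<tau> y = w"
    using iter_prod[of "{..<n}" "\<lambda>t. (\<tau> ^^ (2 * t)) b" 1] bR by (simp add: y_def w_def iter_closed)
  have "\<tau> w = (\<Prod>t<n. (\<tau> ^^ (2 * Suc t)) b)"
    using iter_prod[of "{..<n}" "\<lambda>t. (\<tau> ^^ Suc (2 * t)) b" 1] bR by (simp add: w_def iter_closed act_closed)
  also have "\<dots> = y" unfolding y_def using b2n[of 0] by (intro prod_cyclic_shift) simp
  finally have \<tau>w: "\<tau> w = y" .
  have yw: "y * w = q ^ 2"
  proof -
    have "y * w = (\<Prod>t<n + n. (\<tau> ^^ t) b)"
      unfolding y_def w_def using prod_even_odd[of "\<lambda>t. (\<tau> ^^ t) b" n] by (simp add: mult_2)
    also have "\<dots> = q * (\<Prod>t<n. (\<tau> ^^ (n + t)) b)" by (simp add: prod_lessThan_add q_def)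
    also have "(\<Prod>t<n. (\<tau> ^^ (n + t)) b) = (\<Prod>t<n. - (\<tau> ^^ t) b)"
    proof (rule prod.cong)
      fix t
      have "(\<tau> ^^ (n + t)) b = (\<tau> ^^ t) ((\<tau> ^^ n) b)" by (simp only: iter_iter add.commute)
      then show "(\<tau> ^^ (n + t)) b = - (\<tau> ^^ t) b" using bR by (simp add: bn iter_uminus)
    qed simp
    also have "\<dots> = (- 1) ^ n * q" by (simp add: q_def prod_uminus)
    finally show ?thesis using n by (simp add: power2_eq_square)
  qed
  have \<tau>q: "\<tau> q = - q"
  proof -
    have "\<tau> q = (\<Prod>t<n. (\<tau> ^^ Suc t) b)"
      using iter_prod[of "{..<n}" "\<lambda>t. (\<tau> ^^ t) b" 1] bR by (simp add: q_def iter_closed)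
    then have "b * \<tau> q = (\<Prod>t<Suc n. (\<tau> ^^ t) b)" by (simp only: prod.lessThan_Suc_shift) simp
    also have "\<dots> = b * - q" by (simp add: bn q_def mult.commute)
    finally show ?thesis using mult_left_cancel[OF b(2)] by blast
  qed
  have norm_eq: "y ^ 2 ^ s \<noteq> w ^ 2 ^ s"
  proof
    assume "y ^ 2 ^ s = w ^ 2 ^ s"
    then have "(y / w) ^ 2 ^ s = 1" using nz by (simp add: power_divide)
    moreover have "((y / w) ^ j) ^ 2 \<noteq> - 1" for j using no_i R by (simp add: pow_closed divide_closed)
    ultimately consider "y / w = 1" | "y / w = - 1" using power_2_power_eq_1 by blast
    then show False
    proof cases
      case 1
      then have "y = w" using nz by simp
      then have "y ^ 2 = q ^ 2" using yw by (simp add: power2_eq_square)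
      then have "q = y \<or> q = - y" by (auto simp: power2_eq_iff)
      then have "\<tau> q = q" using \<tau>y \<open>y = w\<close> iter_uminus[OF R(1), of 1] by auto
      then show False using \<tau>q nz by simp
    next
      case 2
      then have "y = - w" using nz by (simp add: field_simps)
      then have "q ^ 2 = - (w ^ 2)" using yw by (simp add: power2_eq_square)
      then have "(q / w) ^ 2 = - 1" using nz by (simp add: power_divide)
      then show False using no_i R divide_closed by blast
    qed
  qed
  have "radical R (skew b) = {0}"
  proof (rule ccontr)
    assume "radical R (skew b) \<noteq> {0}"
    moreover have "0 \<in> radical R (skew b)" unfolding radical_skew[OF bR] using iter_0[of 2] by (simp add: numeral_2_eq_2)
    ultimately obtain x where x: "x \<in> R" "x \<noteq> 0" "b * x = \<tau> b * \<tau> (\<tau> x)"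
      unfolding radical_skew[OF bR] by blast
    \<comment> \<open>The norm to the fixed field of \<open>\<tau>\<^sup>2\<close>.\<close>
    let ?N = "\<lambda>a. \<Prod>t<n * 2 ^ s. (\<tau> ^^ (2 * t)) a"
    have Nb: "?N b = y ^ 2 ^ s"
      unfolding y_def using b2n by (intro prod_periodic) (simp add: distrib_left)
    have N\<tau>b: "?N (\<tau> b) = w ^ 2 ^ s"
    proof -
      have "?N (\<tau> b) = (\<Prod>t<n * 2 ^ s. (\<tau> ^^ Suc (2 * t)) b)" by (simp only: funpow_Suc_right o_apply)
      also have "\<dots> = w ^ 2 ^ s"
        unfolding w_def
      proof (rule prod_periodic)
        fix t show "(\<tau> ^^ Suc (2 * (n + t))) b = (\<tau> ^^ Suc (2 * t)) b"
          using b2n[of "Suc (2 * t)"] by (simp add: distrib_left)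
      qed
      finally show ?thesis .
    qed
    have N\<tau>x: "?N (\<tau> (\<tau> x)) = ?N x"
    proof -
      have "(\<tau> ^^ (2 * t)) (\<tau> (\<tau> x)) = (\<tau> ^^ (2 * Suc t)) x" for t
        by (simp only: funpow_Suc_right o_apply mult_Suc_right add_2_eq_Suc)
      then have "?N (\<tau> (\<tau> x)) = (\<Prod>t<n * 2 ^ s. (\<tau> ^^ (2 * Suc t)) x)" by (simp only:)
      also have "\<dots> = ?N x"
        using act_order[OF x(1)] by (intro prod_cyclic_shift) (simp add: m mult_ac)
      finally show ?thesis .
    qed
    have mult: "?N (u * v) = ?N u * ?N v" if "u \<in> R" "v \<in> R" for u v
      using that by (simp add: iter_mult prod.distrib)
    have "?N b * ?N x = ?N (b * x)" using x bR by (intro mult[symmetric])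
    also have "\<dots> = ?N (\<tau> b * \<tau> (\<tau> x))" using x by (simp only:)
    also have "\<dots> = ?N (\<tau> b) * ?N (\<tau> (\<tau> x))" using x bR by (intro mult act_closed)
    finally have "?N b * ?N x = ?N (\<tau> b) * ?N x" by (simp only: N\<tau>x)
    moreover have "?N x \<noteq> 0" using x by (simp add: iter_eq_0_iff)
    ultimately show False using norm_eq by (simp add: Nb N\<tau>b)
  qed
  then show ?thesis
    using ac.dim_eq_card[of "{}" "{0 :: 'k alg_closure}"] by (simp add: form_rank_def dim ac.independent_empty)
qed

text \<open>
  Let \<open>c\<close> be the product of the \<open>\<tau>\<^bsup>2t\<^esup>(b)\<close> over \<open>2 t < n + 1\<close>.  Then \<open>\<tau>\<^sup>2(c) b = c \<tau>\<^bsup>n+1\<^esup>(b) = e c \<tau>(b)\<close>, so \<open>1/c\<close> solves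
  the equation of the radical up to the sign \<open>e\<close>, and a factor \<open>y\<close> with \<open>\<tau>\<^sup>2(y) = e y\<close> corrects the
  sign; for \<open>e = - 1\<close> it exists because 4 divides \<open>m\<close>.  Quotients of solutions are fixed by \<open>\<tau>\<^sup>2\<close>, so
  the radical has dimension 2.
\<close>
lemma form_rank_eq_order_minus_2:
  assumes m: "4 dvd m" and n: "odd n" and e: "e = 1 \<or> e = - 1" and b: "b \<in> R" "b \<noteq> 0" "(\<tau> ^^ n) b = e * b"
  shows "form_rank R (skew b) = m - 2"
proof -
  define h where "h = Suc n div 2"
  have h: "2 * h = Suc n" using n by (simp add: h_def)
  define c where "c = (\<Prod>t<h. (\<tau> ^^ (2 * t)) b)"
  have c: "c \<in> R" "c \<noteq> 0" using b by (auto simp: c_def iter_eq_0_iff intro!: prod_closed iter_closed)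
  have eR: "e \<in> R" and \<tau>e: "(\<tau> ^^ i) e = e" for i
    using e uminus_closed[OF one_closed] iter_uminus[OF one_closed] by (auto simp: iter_1)
  have \<tau>c: "(\<tau> ^^ 2) c * b = c * e * \<tau> b"
  proof -
    have "(\<tau> ^^ 2) c = (\<Prod>t<h. (\<tau> ^^ (2 * Suc t)) b)"
      unfolding c_def using b by (subst iter_prod) (auto simp: iter_closed iter_iter)
    then have "(\<tau> ^^ 2) c * b = (\<Prod>t<Suc h. (\<tau> ^^ (2 * t)) b)"
      by (simp only: prod.lessThan_Suc_shift) simp
    also have "\<dots> = c * \<tau> ((\<tau> ^^ n) b)" by (simp add: c_def h)
    also have "\<tau> ((\<tau> ^^ n) b) = e * \<tau> b" using b eR \<tau>e[of 1] by (simp add: act_mult)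
    finally show ?thesis by (simp add: mult_ac)
  qed
  have "\<exists>y\<in>R. y \<noteq> 0 \<and> (\<tau> ^^ 2) y = e * y"
  proof (cases "e = 1")
    case True
    then show ?thesis by (intro bexI[of _ 1]) (auto simp: iter_1)
  next
    case False
    then have "e = - 1" using e by simp
    then show ?thesis using Neg_nonzero[of 2] m by (auto simp: Neg_def)
  qed
  then obtain y where y: "y \<in> R" "y \<noteq> 0" "(\<tau> ^^ 2) y = e * y" by blast
  define x where "x = y / c"
  have x: "x \<in> R" "x \<noteq> 0" using y c by (auto simp: x_def divide_closed)
  have \<tau>c0: "(\<tau> ^^ 2) c \<noteq> 0" using c by (simp add: iter_eq_0_iff)
  have \<tau>x: "(\<tau> ^^ 2) x = e * y / (\<tau> ^^ 2) c" using y c by (simp add: x_def iter_divide)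
  have "b * y * (\<tau> ^^ 2) c = \<tau> b * e * y * c" using \<tau>c by (simp add: mult_ac)
  then have "b * (y / c) = \<tau> b * (e * y / (\<tau> ^^ 2) c)" using c \<tau>c0 y(2) by (simp add: field_simps)
  then have rel: "b * x = \<tau> b * (\<tau> ^^ 2) x" unfolding \<tau>x by (simp only: x_def)
  have "radical R (skew b) = (\<lambda>u. x * u) ` Fix 2"
  proof (intro Set.set_eqI iffI)
    fix v assume "v \<in> (\<lambda>u. x * u) ` Fix 2"
    then obtain u where u: "u \<in> R" "(\<tau> ^^ 2) u = u" "v = x * u" by (auto simp: Fix_def)
    have "b * v = \<tau> b * (\<tau> ^^ 2) v" using rel u x by (simp add: iter_mult flip: mult.assoc)
    then show "v \<in> radical R (skew b)"
      unfolding radical_skew[OF b(1)] using u x by (simp add: mult_closed numeral_2_eq_2)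
  next
    fix v assume "v \<in> radical R (skew b)"
    then have v: "v \<in> R" "b * v = \<tau> b * (\<tau> ^^ 2) v" unfolding radical_skew[OF b(1)] by (auto simp: numeral_2_eq_2)
    have nz: "(\<tau> ^^ 2) x \<noteq> 0" using x by (simp add: iter_eq_0_iff)
    have \<tau>b: "\<tau> b \<noteq> 0" using iter_eq_0_iff[OF b(1), of 1] b by simp
    have "(\<tau> ^^ 2) v / (\<tau> ^^ 2) x = (\<tau> b * (\<tau> ^^ 2) v) / (\<tau> b * (\<tau> ^^ 2) x)" using \<tau>b by simp
    also have "\<dots> = v / x" using b by (simp flip: v(2) rel)
    finally have "v / x \<in> Fix 2" using v x by (simp add: Fix_def divide_closed iter_divide)
    moreover have "v = x * (v / x)" using x by simp
    ultimately show "v \<in> (\<lambda>u. x * u) ` Fix 2" by blast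
  qed
  moreover have "2 dvd m" using m by (meson dvd_trans even_numeral)
  ultimately have "ac.dim (radical R (skew b)) = 2" using x by (simp add: dim_scaled dim_Fix)
  then show ?thesis by (simp add: form_rank_def dim)
qed

end

section \<open>The decomposition of the space of skew-forms\<close>

context cyclic_galois
begin

lemma Fix_double: "x \<in> Fix n \<Longrightarrow> x \<in> Fix (2 * n)"
  by (auto simp: Fix_def mult_2 simp flip: iter_iter)

lemma Neg_double: "x \<in> Neg n \<Longrightarrow> x \<in> Fix (2 * n)"
  by (auto simp: Fix_def Neg_def mult_2 iter_uminus simp flip: iter_iter)

lemma Fix_Neg_eq_0: "\<lbrakk>x \<in> Fix n; x \<in> Neg n\<rbrakk> \<Longrightarrow> x = 0"
  by (auto simp: Fix_def Neg_def equal_neg_zero)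

lemma half_closed: "x \<in> R \<Longrightarrow> x / 2 \<in> R" and iter_half: "x \<in> R \<Longrightarrow> (\<tau> ^^ i) (x / 2) = (\<tau> ^^ i) x / 2"
proof -
  have "2 \<in> R" using const_closed[of 2] by simp
  moreover have "(\<tau> ^^ i) 2 = 2" using iter_const[of i 2] by simp
  ultimately show "x \<in> R \<Longrightarrow> x / 2 \<in> R" "x \<in> R \<Longrightarrow> (\<tau> ^^ i) (x / 2) = (\<tau> ^^ i) x / 2"
    by (simp_all add: divide_closed iter_divide)
qed

lemma Fix_double_split:
  assumes x: "x \<in> Fix (2 * n)"
  shows "\<exists>w\<in>Neg n. x - w \<in> Fix n"
proof
  have xR: "x \<in> R" and x2: "(\<tau> ^^ n) ((\<tau> ^^ n) x) = x"
    using x by (auto simp: Fix_def mult_2 iter_iter)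
  let ?w = "(x - (\<tau> ^^ n) x) / 2"
  show "?w \<in> Neg n"
    using xR x2 by (simp add: Neg_def half_closed diff_closed iter_closed iter_half iter_diff minus_divide_left)
  have eq: "x - ?w = (x + (\<tau> ^^ n) x) / 2" by (simp add: field_simps)
  show "x - ?w \<in> Fix n"
    unfolding eq using xR x2 by (simp add: Fix_def half_closed add_closed iter_closed iter_half iter_add add.commute)
qed

lemma div_power_Suc: "2 ^ Suc j dvd m \<Longrightarrow> m div 2 ^ j = 2 * (m div 2 ^ Suc j)"
  by (auto simp: dvd_def mult_ac)

text \<open>
  The relation \<open>X\<^bsup>2n\<^esup> - 1 = (X\<^sup>n - 1) (X\<^sup>n + 1)\<close> splits the fixed field of \<open>\<tau>\<^bsup>2n\<^esup>\<close> as in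
  \<open>Fix_double_split\<close>; this is repeated \<open>j\<close> times, starting from \<open>R\<close>.
\<close>
lemma decomposition_exists:
  assumes "2 ^ j dvd m" "b \<in> R"
  shows "\<exists>w. (\<forall>i\<in>{1..j}. w i \<in> Neg (m div 2 ^ i)) \<and> b - (\<Sum>i=1..j. w i) \<in> Fix (m div 2 ^ j)"
  using assms(1)
proof (induction j)
  case 0
  then show ?case using assms(2) by (simp add: Fix_def act_order)
next
  case (Suc j)
  have "2 ^ j dvd m" using Suc.prems by (metis dvd_trans le_imp_power_dvd lessI less_imp_le)
  then obtain w where w: "\<forall>i\<in>{1..j}. w i \<in> Neg (m div 2 ^ i)" "b - (\<Sum>i=1..j. w i) \<in> Fix (m div 2 ^ j)"
    using Suc.IH by blast
  obtain v where v: "v \<in> Neg (m div 2 ^ Suc j)" "b - (\<Sum>i=1..j. w i) - v \<in> Fix (m div 2 ^ Suc j)"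
    using Fix_double_split[of _ "m div 2 ^ Suc j"] w(2) div_power_Suc[OF Suc.prems] by metis
  define w' where "w' = w(Suc j := v)"
  have "(\<Sum>i=1..Suc j. w' i) = (\<Sum>i=1..j. w i) + v"
    by (simp add: w'_def)
  then have "b - (\<Sum>i=1..Suc j. w' i) \<in> Fix (m div 2 ^ Suc j)" using v(2) by (simp add: diff_diff_eq)
  moreover have "\<forall>i\<in>{1..Suc j}. w' i \<in> Neg (m div 2 ^ i)"
    using w(1) v(1) by (simp add: w'_def)
  ultimately show ?case by blast
qed

lemma decomposition_unique:
  assumes "2 ^ j dvd m" "\<And>i. i \<in> {1..j} \<Longrightarrow> w i \<in> Neg (m div 2 ^ i)" "r \<in> Fix (m div 2 ^ j)"
    and "(\<Sum>i=1..j. w i) + r = 0"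
  shows "r = 0 \<and> (\<forall>i\<in>{1..j}. w i = 0)"
  using assms
proof (induction j arbitrary: r)
  case (Suc j)
  have dvd: "2 ^ j dvd m" using Suc.prems by (metis dvd_trans le_imp_power_dvd lessI less_imp_le)
  note half = div_power_Suc[OF Suc.prems(1)]
  have wj: "w (Suc j) \<in> Neg (m div 2 ^ Suc j)" using Suc.prems(2)[of "Suc j"] by simp
  have r': "w (Suc j) + r \<in> Fix (m div 2 ^ j)"
    unfolding half using wj Suc.prems(3) by (intro Fix_add Neg_double Fix_double)
  have "(\<Sum>i=1..j. w i) + (w (Suc j) + r) = 0" using Suc.prems(4) by (simp add: add.assoc)
  then have IH: "w (Suc j) + r = 0" "\<forall>i\<in>{1..j}. w i = 0"
    using Suc.IH[OF dvd _ r'] Suc.prems(2) by auto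
  then have "r = - w (Suc j)" by (simp add: eq_neg_iff_add_eq_0 add.commute)
  then have "r \<in> Neg (m div 2 ^ Suc j)" using Neg_scale[OF wj, of "- 1"] by (simp add: ac_scale_def)
  then have "r = 0" using Suc.prems(3) by (intro Fix_Neg_eq_0)
  then show ?case using IH by (auto simp: le_Suc_eq)
qed simp

text \<open>
  Since \<^term>\<open>skew\<close> is additive and injective on \<open>R\<close>, it carries direct sum decompositions of \<open>R\<close> to
  decompositions of the space of skew-forms.
\<close>
lemma is_direct_sum_skew:
  assumes m: "m > 2" and I: "finite I" and U: "\<And>i. i \<in> I \<Longrightarrow> U i \<subseteq> R \<and> ac.subspace (U i)"
    and ex: "\<And>b. b \<in> R \<Longrightarrow> \<exists>w. (\<forall>i\<in>I. w i \<in> U i) \<and> b = (\<Sum>i\<in>I. w i)"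
    and uniq: "\<And>w. \<lbrakk>\<forall>i\<in>I. w i \<in> U i; (\<Sum>i\<in>I. w i) = 0\<rbrakk> \<Longrightarrow> \<forall>i\<in>I. w i = 0"
  shows "is_direct_sum (skew ` R) I (\<lambda>i. skew ` U i)"
  unfolding is_direct_sum_def
proof (rule bij_betwI')
  fix u u' assume u: "u \<in> (\<Pi>\<^sub>E i\<in>I. skew ` U i)" and u': "u' \<in> (\<Pi>\<^sub>E i\<in>I. skew ` U i)"
  have "\<forall>i\<in>I. \<exists>a. a \<in> U i \<and> u i = skew a" "\<forall>i\<in>I. \<exists>a. a \<in> U i \<and> u' i = skew a"
    using u u' by (auto simp: PiE_iff)
  then obtain a a' where a: "\<And>i. i \<in> I \<Longrightarrow> a i \<in> U i \<and> u i = skew (a i)"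
    and a': "\<And>i. i \<in> I \<Longrightarrow> a' i \<in> U i \<and> u' i = skew (a' i)"
    by metis
  show "(\<Sum>i\<in>I. u i) = (\<Sum>i\<in>I. u' i) \<longleftrightarrow> u = u'"
  proof
    assume eq: "(\<Sum>i\<in>I. u i) = (\<Sum>i\<in>I. u' i)"
    have aR: "a i \<in> R" "a' i \<in> R" if "i \<in> I" for i using that a a' U by blast+
    have "skew (\<Sum>i\<in>I. a i) = (\<Sum>i\<in>I. skew (a i))" using aR by (intro skew_sum)
    also have "\<dots> = (\<Sum>i\<in>I. u i)" using a by (intro sum.cong) simp_all
    also note eq
    also have "(\<Sum>i\<in>I. u' i) = (\<Sum>i\<in>I. skew (a' i))" using a' by (intro sum.cong) simp_all
    also have "\<dots> = skew (\<Sum>i\<in>I. a' i)" using aR by (intro skew_sum[symmetric])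
    finally have "(\<Sum>i\<in>I. a i) = (\<Sum>i\<in>I. a' i)"
      using inj_on_skew[OF m] aR by (auto dest!: inj_onD intro: sum_closed)
    then have "(\<Sum>i\<in>I. a i - a' i) = 0" by (simp add: sum_subtractf)
    moreover have "\<forall>i\<in>I. a i - a' i \<in> U i" using a a' U ac.subspace_diff by blast
    ultimately have "\<forall>i\<in>I. a i - a' i = 0" using uniq[of "\<lambda>i. a i - a' i"] by simp
    then have "\<forall>i\<in>I. u i = u' i" using a a' by simp
    then show "u = u'" using u u' by (intro PiE_ext) auto
  qed simp
next
  fix u assume u: "u \<in> (\<Pi>\<^sub>E i\<in>I. skew ` U i)"
  then have "\<forall>i\<in>I. \<exists>a. a \<in> U i \<and> u i = skew a" by (auto simp: PiE_iff)
  then obtain a where a: "\<And>i. i \<in> I \<Longrightarrow> a i \<in> U i \<and> u i = skew (a i)" by metis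
  have aR: "a i \<in> R" if "i \<in> I" for i using that a U by blast
  have "(\<Sum>i\<in>I. u i) = (\<Sum>i\<in>I. skew (a i))" using a by (intro sum.cong) simp_all
  also have "\<dots> = skew (\<Sum>i\<in>I. a i)" using aR by (intro skew_sum[symmetric])
  finally show "(\<Sum>i\<in>I. u i) \<in> skew ` R" using aR sum_closed by blast
next
  fix f assume "f \<in> skew ` R"
  then obtain b where b: "b \<in> R" "f = skew b" by blast
  obtain w where w: "\<forall>i\<in>I. w i \<in> U i" "b = (\<Sum>i\<in>I. w i)" using ex[OF b(1)] by blast
  define u where "u = (\<lambda>i\<in>I. skew (w i))"
  have "u \<in> (\<Pi>\<^sub>E i\<in>I. skew ` U i)" using w by (auto simp: u_def)
  moreover have "f = (\<Sum>i\<in>I. u i)"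
  proof -
    have "(\<Sum>i\<in>I. u i) = (\<Sum>i\<in>I. skew (w i))" by (intro sum.cong) (simp_all add: u_def)
    also have "\<dots> = skew (\<Sum>i\<in>I. w i)" using w U by (intro skew_sum[symmetric]) blast
    finally show ?thesis using b w by simp
  qed
  ultimately show "\<exists>u\<in>\<Pi>\<^sub>E i\<in>I. skew ` U i. f = (\<Sum>i\<in>I. u i)" by blast
qed

theorem skew_space_decomposition:
  fixes \<alpha> k :: nat
  assumes m: "m = 2 ^ \<alpha> * k" and \<alpha>: "\<alpha> \<ge> 2" and k: "odd k"
    and no_i: "\<And>x. x \<in> R \<Longrightarrow> x ^ 2 \<noteq> - 1"
  shows "\<exists>(E :: nat \<Rightarrow> 'k form set) (V :: nat \<Rightarrow> 'k form set).
    is_direct_sum (skew_space R \<tau>) ({1..\<alpha> - 1} <+> {1..2}) (case_sum E V) \<and>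
    (\<forall>i\<in>{1..\<alpha> - 1}. E i \<subseteq> skew_space R \<tau> \<and> rank_subspace R m (E i) \<and>
       form.dim (E i) = m div 2 ^ i) \<and>
    (\<forall>j\<in>{1..2}. V j \<subseteq> skew_space R \<tau> \<and> rank_subspace R (m - 2) (V j) \<and>
       form.dim (V j) = k)"
proof -
  have k0: "k > 0" using k by (auto intro: Nat.gr0I)
  have "4 dvd (2::nat) ^ \<alpha>" using le_imp_power_dvd[OF \<alpha>, of "2 :: nat"] by simp
  then have m4: "4 dvd m" by (simp add: m)
  have m2: "m > 2" using m4 order_pos by (auto dest: dvd_imp_le)
  have md: "m div 2 ^ \<alpha> = k" by (simp add: m)
  have mi: "m div 2 ^ i * 2 ^ i = m" and mi2: "2 * (m div 2 ^ i) dvd m" if "i \<in> {1..\<alpha>}" for i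
  proof -
    have "2 ^ i dvd m" unfolding m using that by (simp add: le_imp_power_dvd dvd_mult2)
    then show eq: "m div 2 ^ i * 2 ^ i = m" by simp
    obtain i' where i': "i = Suc i'" using \<open>i \<in> {1..\<alpha>}\<close> by (cases i) auto
    have "2 * (m div 2 ^ i) * 2 ^ i' = m" using eq unfolding i' by (simp add: mult_ac)
    then show "2 * (m div 2 ^ i) dvd m" by (metis dvd_triv_left)
  qed
  define UE where "UE = (\<lambda>i :: nat. Neg (m div 2 ^ i))"
  define UV where "UV = (\<lambda>j :: nat. if j = 1 then Fix k else Neg k)"
  define E where "E = (\<lambda>i. skew ` UE i)"
  define V where "V = (\<lambda>j. skew ` UV j)"
  have sub: "UE i \<subseteq> R" "UV i \<subseteq> R" "ac.subspace (UE i)" "ac.subspace (UV i)" for i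
    by (auto simp: UE_def UV_def Fix_subset Neg_subset subspace_Fix subspace_Neg)
  \<comment> \<open>The coefficients of \<open>V\<^sub>2\<close> form the last of the spaces \<open>Neg (m div 2 ^ i)\<close>, the one with \<open>i = \<alpha>\<close>, and those of \<open>V\<^sub>1\<close> are what then remains.\<close>
  have sum_eq: "(\<Sum>i\<in>{1..\<alpha> - 1} <+> {1..2}. w i) = (\<Sum>i=1..\<alpha>. if i = \<alpha> then w (Inr 2) else w (Inl i)) + w (Inr 1)"
    for w :: "nat + nat \<Rightarrow> 'k alg_closure"
  proof -
    have "(\<Sum>i\<in>{1..\<alpha> - 1} <+> {1..2}. w i) = (\<Sum>i=1..\<alpha> - 1. w (Inl i)) + (w (Inr 1) + w (Inr 2))"
      by (simp add: sum.Plus numeral_2_eq_2)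
    moreover have "{1..\<alpha>} = insert \<alpha> {1..\<alpha> - 1}" using \<alpha> by auto
    moreover have "(\<Sum>i=1..\<alpha> - 1. if i = \<alpha> then w (Inr 2) else w (Inl i)) = (\<Sum>i=1..\<alpha> - 1. w (Inl i))"
      using \<alpha> by (intro sum.cong) auto
    moreover have "\<alpha> \<notin> {1..\<alpha> - 1}" using \<alpha> by auto
    ultimately show ?thesis by (simp add: add_ac)
  qed
  have "is_direct_sum (skew ` R) ({1..\<alpha> - 1} <+> {1..2}) (\<lambda>i. skew ` case_sum UE UV i)"
  proof (rule is_direct_sum_skew[OF m2])
    fix i assume "i \<in> {1..\<alpha> - 1} <+> {1..2 :: nat}"
    show "case_sum UE UV i \<subseteq> R \<and> ac.subspace (case_sum UE UV i)" using sub by (cases i) simp_all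
  next
    fix b assume "b \<in> R"
    then obtain w where w: "\<forall>i\<in>{1..\<alpha>}. w i \<in> Neg (m div 2 ^ i)" "b - (\<Sum>i=1..\<alpha>. w i) \<in> Fix (m div 2 ^ \<alpha>)"
      using decomposition_exists[of \<alpha> b] m by auto
    define w' where "w' = case_sum w (\<lambda>j :: nat. if j = 1 then b - (\<Sum>i=1..\<alpha>. w i) else w \<alpha>)"
    have "(\<Sum>i=1..\<alpha>. if i = \<alpha> then w' (Inr 2) else w' (Inl i)) = (\<Sum>i=1..\<alpha>. w i)"
      by (intro sum.cong) (auto simp: w'_def)
    then have "b = (\<Sum>i\<in>{1..\<alpha> - 1} <+> {1..2}. w' i)" unfolding sum_eq by (simp add: w'_def)
    moreover have "\<forall>i\<in>{1..\<alpha> - 1} <+> {1..2}. w' i \<in> case_sum UE UV i"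
    proof
      fix i assume i: "i \<in> {1..\<alpha> - 1} <+> {1..2 :: nat}"
      have "w \<alpha> \<in> Neg (m div 2 ^ \<alpha>)" using w(1) \<alpha> by simp
      then show "w' i \<in> case_sum UE UV i"
        using w i by (cases i) (auto simp: w'_def UE_def UV_def md)
    qed
    ultimately show "\<exists>w. (\<forall>i\<in>{1..\<alpha> - 1} <+> {1..2}. w i \<in> case_sum UE UV i) \<and> b = (\<Sum>i\<in>{1..\<alpha> - 1} <+> {1..2}. w i)"
      by blast
  next
    fix w assume w: "\<forall>i\<in>{1..\<alpha> - 1} <+> {1..2 :: nat}. w i \<in> case_sum UE UV i" and s: "(\<Sum>i\<in>{1..\<alpha> - 1} <+> {1..2}. w i) = 0"
    have wE: "w (Inl i) \<in> Neg (m div 2 ^ i)" if "i \<in> {1..\<alpha> - 1}" for i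
      using bspec[OF w, of "Inl i"] that by (simp add: UE_def InlI)
    have wV: "w (Inr 1) \<in> Fix k" "w (Inr 2) \<in> Neg k"
      using bspec[OF w, of "Inr 1"] bspec[OF w, of "Inr 2"] by (simp_all add: UV_def InrI)
    define v where "v = (\<lambda>i. if i = \<alpha> then w (Inr 2) else w (Inl i))"
    have "w (Inr 1) = 0 \<and> (\<forall>i\<in>{1..\<alpha>}. v i = 0)"
    proof (rule decomposition_unique)
      show "2 ^ \<alpha> dvd m" by (simp add: m)
      show "w (Inr 1) \<in> Fix (m div 2 ^ \<alpha>)" using wV by (simp add: md)
      show "v i \<in> Neg (m div 2 ^ i)" if "i \<in> {1..\<alpha>}" for i
        using that wE[of i] wV(2) by (auto simp: v_def md)
      show "(\<Sum>i=1..\<alpha>. v i) + w (Inr 1) = 0" using s unfolding sum_eq v_def .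
    qed
    then have z: "w (Inr 1) = 0" "\<And>i. i \<in> {1..\<alpha>} \<Longrightarrow> v i = 0" by auto
    show "\<forall>i\<in>{1..\<alpha> - 1} <+> {1..2}. w i = 0"
    proof
      fix i assume i: "i \<in> {1..\<alpha> - 1} <+> {1..2 :: nat}"
      show "w i = 0"
      proof (cases i)
        case (Inl i')
        then have i': "i' \<in> {1..\<alpha> - 1}" using i by auto
        then have "v i' = 0" "i' \<noteq> \<alpha>" using z(2)[of i'] \<alpha> by auto
        then show ?thesis using Inl by (simp add: v_def)
      next
        case (Inr j)
        then have "j = 1 \<or> j = 2" using i by auto
        moreover have "w (Inr 2) = 0" using z(2)[of \<alpha>] \<alpha> by (simp add: v_def)
        ultimately show ?thesis using Inr z(1) by auto
      qed
    qed
  qed simp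
  moreover have "(\<lambda>i. skew ` case_sum UE UV i) = case_sum E V"
    by (auto simp: E_def V_def fun_eq_iff split: sum.split)
  ultimately have sum: "is_direct_sum (skew_space R \<tau>) ({1..\<alpha> - 1} <+> {1..2}) (case_sum E V)"
    by (simp add: skew_space_eq)
  have E: "E i \<subseteq> skew_space R \<tau> \<and> rank_subspace R m (E i) \<and> form.dim (E i) = m div 2 ^ i" if i: "i \<in> {1..\<alpha> - 1}" for i
  proof (intro conjI)
    show "E i \<subseteq> skew_space R \<tau>" unfolding E_def skew_space_eq by (intro image_mono sub)
    have i': "i \<in> {1..\<alpha>}" using i by auto
    show "form.dim (E i) = m div 2 ^ i"
      unfolding E_def using dim_skew_image[OF m2 sub(1,3)] dim_Neg[OF mi2[OF i']] by (simp add: UE_def)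
    obtain s where s: "i = Suc s" using i by (cases i) auto
    have "even (m div 2 ^ i)"
    proof -
      have "\<alpha> = i + Suc (\<alpha> - Suc i)" using i by auto
      then have "m = 2 ^ i * (2 * (2 ^ (\<alpha> - Suc i) * k))" unfolding m by (metis mult.assoc power_Suc power_add)
      then have "m div 2 ^ i = 2 * (2 ^ (\<alpha> - Suc i) * k)" by simp
      then show ?thesis by simp
    qed
    moreover have "m = m div 2 ^ i * 2 ^ Suc s" using mi[OF i'] s by simp
    ultimately show "rank_subspace R m (E i)"
      unfolding E_def using form_rank_eq_order[OF no_i, of "m div 2 ^ i" s]
      by (intro rank_subspace_skew_image sub) (auto simp: UE_def)
  qed
  have V: "V j \<subseteq> skew_space R \<tau> \<and> rank_subspace R (m - 2) (V j) \<and> form.dim (V j) = k" for j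
  proof (intro conjI)
    show "V j \<subseteq> skew_space R \<tau>" unfolding V_def skew_space_eq by (intro image_mono sub)
    have "\<alpha> \<in> {1..\<alpha>}" using \<alpha> by simp
    then have "2 * k dvd m" using mi2[of \<alpha>] md by simp
    moreover from this have "k dvd m" by (rule dvd_mult_right)
    ultimately show "form.dim (V j) = k"
      unfolding V_def using dim_skew_image[OF m2 sub(2,4)] by (simp add: UV_def dim_Fix dim_Neg)
    show "rank_subspace R (m - 2) (V j)"
      unfolding V_def
    proof (intro rank_subspace_skew_image sub)
      fix b assume b: "b \<in> UV j" "b \<noteq> 0"
      then have "b \<in> R" "(\<tau> ^^ k) b = (if j = 1 then 1 else - 1) * b" by (auto simp: UV_def Fix_def Neg_def split: if_splits)
      then show "form_rank R (skew b) = m - 2"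
        using b(2) by (intro form_rank_eq_order_minus_2[OF m4 k]) auto
    qed
  qed
  show ?thesis using sum E V by blast
qed

end

section \<open>Cyclotomic extensions of prime order\<close>

text \<open>
  The polynomial \<open>f\<close> is a minimal polynomial of \<open>\<zeta>\<close> over \<open>K\<close>.
\<close>
locale cyclotomic_extension = root_of_unity p \<zeta>
  for p and \<zeta> :: "'k::field_char_0 alg_closure" +
  fixes f :: "'k poly"
  assumes f_nonzero: "f \<noteq> 0" and f_root: "K_poly f \<zeta> = 0" and f_dvd: "K_poly h \<zeta> = 0 \<Longrightarrow> f dvd h"
begin

text \<open>
  The exponents \<open>a\<close> for which \<open>\<zeta>\<^sup>a\<close> is conjugate to \<open>\<zeta>\<close> over \<open>K\<close>.
\<close>
definition conj_exp :: "nat \<Rightarrow> bool" where "conj_exp a \<longleftrightarrow> K_poly f (\<zeta> ^ a) = 0"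

lemma conj_exp_root: "\<lbrakk>conj_exp a; K_poly h \<zeta> = 0\<rbrakk> \<Longrightarrow> K_poly h (\<zeta> ^ a) = 0"
  using f_dvd[of h] by (auto simp: conj_exp_def dvd_def K_poly_mult)

lemma conj_exp_cong: "[a = b] (mod p) \<Longrightarrow> conj_exp a \<longleftrightarrow> conj_exp b"
  using power_cong by (simp add: conj_exp_def)

lemma conj_exp_1: "conj_exp 1"
  by (simp add: conj_exp_def f_root)

text \<open>
  The polynomial \<open>f(X\<^sup>a)\<close> vanishes at \<open>\<zeta>\<close>, hence at its conjugate \<open>\<zeta>\<^sup>b\<close>.
\<close>
lemma conj_exp_mult: "\<lbrakk>conj_exp a; conj_exp b\<rbrakk> \<Longrightarrow> conj_exp (a * b)"
proof -
  assume a: "conj_exp a" and b: "conj_exp b"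
  have "K_poly (pcompose f (Polynomial.monom 1 a)) \<zeta> = 0"
    using a by (simp add: K_poly_pcompose_monom conj_exp_def)
  then have "K_poly (pcompose f (Polynomial.monom 1 a)) (\<zeta> ^ b) = 0" by (rule conj_exp_root[OF b])
  then show "conj_exp (a * b)" by (simp add: K_poly_pcompose_monom conj_exp_def mult.commute[of a] power_mult)
qed

text \<open>
  Write \<open>\<Phi> = f g\<close>.  All \<open>p - 1\<close> roots of \<open>\<Phi>\<close> are roots of \<open>f\<close> or of \<open>g\<close>, whose degrees add up to \<open>p - 1\<close>, so
  each of the two factors has as many roots as its degree allows.
\<close>
lemma card_conj_exp: "card {a \<in> {1..<p}. conj_exp a} = Polynomial.degree f"
proof -
  define F where "F = (map_poly of_int \<Phi> :: 'k poly)"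
  have degF: "Polynomial.degree F = p - 1" by (simp add: F_def degree_map_poly degree_\<Phi>)
  have "poly.coeff F 0 = 1"
    using coeff_\<Phi>[of 0] prime_gt_0_nat[OF prime] by (simp add: F_def coeff_map_poly)
  then have F0: "F \<noteq> 0" by auto
  have Froot: "K_poly F (\<zeta> ^ a) = 0" if "a \<in> {1..<p}" for a
  proof -
    have "\<not> p dvd a" using that by (auto dest: dvd_imp_le)
    then show ?thesis by (simp add: F_def K_poly_eq_int_eval int_eval_\<Phi>)
  qed
  have "K_poly F (\<zeta> ^ 1) = 0" using Froot[of 1] prime_gt_1_nat[OF prime] by simp
  then have "f dvd F" by (intro f_dvd) simp
  then obtain g where g: "F = f * g" by blast
  have g0: "g \<noteq> 0" using F0 g by auto
  have deg: "Polynomial.degree f + Polynomial.degree g = p - 1"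
    using degF f_nonzero g0 by (simp add: g degree_mult_eq)
  have bound: "card {a \<in> {1..<p}. K_poly h (\<zeta> ^ a) = 0} \<le> Polynomial.degree h" if "h \<noteq> 0" for h :: "'k poly"
  proof -
    let ?A = "{a \<in> {1..<p}. K_poly h (\<zeta> ^ a) = 0}"
    have "inj_on (\<lambda>a. \<zeta> ^ a) ?A" by (rule inj_on_subset[OF inj_on_power]) auto
    then have c: "card ((\<lambda>a. \<zeta> ^ a) ` ?A) = card ?A" by (rule card_image)
    have "\<not> Polynomial.degree h < card ((\<lambda>a. \<zeta> ^ a) ` ?A)"
    proof
      assume "Polynomial.degree h < card ((\<lambda>a. \<zeta> ^ a) ` ?A)"
      then have "h = 0" by (rule K_poly_eq_0) blast
      then show False using that by blast
    qed
    then show ?thesis unfolding c by simp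
  qed
  have "K_poly f (\<zeta> ^ a) = 0 \<or> K_poly g (\<zeta> ^ a) = 0" if "a \<in> {1..<p}" for a
    using Froot[OF that] by (simp add: g K_poly_mult)
  then have "{1..<p} = {a \<in> {1..<p}. K_poly f (\<zeta> ^ a) = 0} \<union> {a \<in> {1..<p}. K_poly g (\<zeta> ^ a) = 0}"
    by blast
  then have "p - 1 \<le> card {a \<in> {1..<p}. K_poly f (\<zeta> ^ a) = 0} + card {a \<in> {1..<p}. K_poly g (\<zeta> ^ a) = 0}"
    using card_Un_le[of "{a \<in> {1..<p}. K_poly f (\<zeta> ^ a) = 0}" "{a \<in> {1..<p}. K_poly g (\<zeta> ^ a) = 0}"]
      card_atLeastLessThan[of 1 p] by argo
  then show ?thesis using bound[OF f_nonzero] bound[OF g0] deg unfolding conj_exp_def by linarith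
qed

definition ext_field :: "'k alg_closure set" where "ext_field = range (\<lambda>h. K_poly h \<zeta>)"

text \<open>
  Substitution of \<open>\<zeta>\<^sup>a\<close> for \<open>\<zeta>\<close>.  The choice of the polynomial does not matter if \<open>a\<close> is the exponent of
  a conjugate.
\<close>
definition ext_hom :: "nat \<Rightarrow> 'k alg_closure \<Rightarrow> 'k alg_closure" where
  "ext_hom a x = K_poly (SOME h. x = K_poly h \<zeta>) (\<zeta> ^ a)"

lemma ext_hom_eq: "conj_exp a \<Longrightarrow> ext_hom a (K_poly h \<zeta>) = K_poly h (\<zeta> ^ a)"
proof -
  assume a: "conj_exp a"
  define g where "g = (SOME g. K_poly h \<zeta> = K_poly g \<zeta>)"
  have "K_poly h \<zeta> = K_poly g \<zeta>" unfolding g_def by (rule someI) simp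
  then have "K_poly (h - g) \<zeta> = 0" by (simp add: K_poly_diff)
  then have "K_poly (h - g) (\<zeta> ^ a) = 0" by (rule conj_exp_root[OF a])
  then show ?thesis by (simp add: ext_hom_def g_def K_poly_diff)
qed

lemma iter_ext_hom:
  assumes a: "conj_exp a"
  shows "(ext_hom a ^^ i) (K_poly h \<zeta>) = K_poly h (\<zeta> ^ (a ^ i))"
proof (induction i arbitrary: h)
  case (Suc i)
  have "(ext_hom a ^^ Suc i) (K_poly h \<zeta>) = ext_hom a (K_poly (pcompose h (Polynomial.monom 1 (a ^ i))) \<zeta>)"
    by (simp add: Suc K_poly_pcompose_monom)
  also have "\<dots> = K_poly h ((\<zeta> ^ a) ^ (a ^ i))" 
    using ext_hom_eq[OF a, of "pcompose h (Polynomial.monom 1 (a ^ i))"] by (simp only: K_poly_pcompose_monom)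
  finally show ?case by (simp add: power_mult)
qed simp

text \<open>
  Let \<open>g\<close> be a primitive root modulo \<open>p\<close>.  The \<open>i\<close> for which \<open>g\<^sup>i\<close> is the exponent of a conjugate are closed under
  addition and periodic modulo \<open>p - 1\<close>, so they are the multiples of some divisor \<open>e\<close> of \<open>p - 1\<close>, and
  \<open>a = g\<^sup>e\<close> generates the group of exponents of conjugates.
\<close>
lemma exists_generating_exponent:
  "\<exists>a e. p - 1 = Polynomial.degree f * e \<and> conj_exp a \<and> [a ^ Polynomial.degree f = 1] (mod p) \<and>
     inj_on (\<lambda>i. a ^ i mod p) {..<Polynomial.degree f}"
proof -
  have p1: "p > 1" by (rule prime_gt_1_nat[OF prime])
  obtain g where g: "residue_primroot p g" using prime_primitive_root_exists[OF p1 prime] by blast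
  have bij: "bij_betw (\<lambda>i. g ^ i mod p) {..<p - 1} {1..<p}"
    using residue_primroot_is_generator[OF p1 g] prime
    by (simp add: totient_prime totatives_prime atLeastSucLessThan_greaterThanLessThan)
  have cop: "coprime p g" using g by (simp add: residue_primroot_def)
  have period: "[g ^ (p - 1) = 1] (mod p)"
    using euler_theorem[of g p] cop prime by (simp add: totient_prime coprime_commute)
  have g_mod: "[g ^ (i + (p - 1) * j) = g ^ i] (mod p)" for i j
    using cong_mult[OF cong_refl[of "g ^ i"] cong_pow[OF period, of j]] by (simp add: power_add power_mult)
  define I where "I = {i. conj_exp (g ^ i)}"
  have I_add: "i + j \<in> I" if "i \<in> I" "j \<in> I" for i j
    using that conj_exp_mult by (simp add: I_def power_add)
  have I_mod: "i + (p - 1) * j \<in> I \<longleftrightarrow> i \<in> I" for i j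
    using conj_exp_cong[OF g_mod] by (simp add: I_def)
  have I_0: "0 \<in> I" using conj_exp_1 by (simp add: I_def)
  have I_mult: "i * j \<in> I" if "i \<in> I" for i j
    using that I_0 I_add by (induction j) auto
  define e where "e = (LEAST e. e > 0 \<and> e \<in> I)"
  have "p - 1 > 0 \<and> p - 1 \<in> I" using I_mod[of 0 1] I_0 p1 by simp
  then have e: "e > 0" "e \<in> I"
    unfolding e_def using LeastI[of "\<lambda>e. e > 0 \<and> e \<in> I" "p - 1"] by auto
  have e_min: "\<not> (0 < i \<and> i \<in> I)" if "i < e" for i
    using not_less_Least that unfolding e_def by blast
  have I_iff: "i \<in> I \<longleftrightarrow> e dvd i" for i
  proof
    assume "e dvd i"
    then show "i \<in> I" using I_mult[OF e(2)] by auto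
  next
    assume i: "i \<in> I"
    define q where "q = i div e"
    have "i + e * ((p - 2) * q) \<in> I" using I_add[OF i I_mult[OF e(2)]] .
    \<comment> \<open>Modulo \<open>p - 1\<close>, adding \<open>p - 2\<close> times \<open>e q\<close> amounts to subtracting \<open>e q\<close>.\<close>
    moreover have "i + e * ((p - 2) * q) = i mod e + (p - 1) * (e * q)"
    proof -
      define p' where "p' = p - 2"
      have p': "p = Suc (Suc p')" using p1 by (simp add: p'_def)
      have "i = i mod e + e * q" by (simp add: q_def)
      then have "i + e * ((p - 2) * q) = i mod e + (e * q + e * (p' * q))" by (simp add: p')
      then show ?thesis by (simp add: p' algebra_simps)
    qed
    ultimately have "i mod e \<in> I" by (simp only: I_mod)
    then have "i mod e = 0" using e_min[of "i mod e"] e(1) by auto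
    then show "e dvd i" by (simp add: dvd_eq_mod_eq_0)
  qed
  have "e dvd p - 1" using I_iff \<open>p - 1 > 0 \<and> p - 1 \<in> I\<close> by blast
  then obtain m where m: "p - 1 = m * e" by (metis dvdE mult.commute)
  have "card {a \<in> {1..<p}. conj_exp a} = card ((\<lambda>i. g ^ i mod p) ` {i \<in> {..<p - 1}. i \<in> I})"
  proof (rule arg_cong[of _ _ card])
    have "conj_exp (g ^ i mod p) \<longleftrightarrow> i \<in> I" for i
      unfolding I_def mem_Collect_eq by (rule conj_exp_cong) (simp add: unique_euclidean_semiring_class.cong_def)
    then show "{a \<in> {1..<p}. conj_exp a} = (\<lambda>i. g ^ i mod p) ` {i \<in> {..<p - 1}. i \<in> I}"
      unfolding bij_betw_imp_surj_on[OF bij, symmetric] by auto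
  qed
  also have "\<dots> = card {i \<in> {..<p - 1}. i \<in> I}"
    using bij by (intro card_image inj_on_subset[OF bij_betw_imp_inj_on]) auto
  also have "{i \<in> {..<p - 1}. i \<in> I} = (\<lambda>j. e * j) ` {..<m}"
    unfolding m using e by (auto simp: I_iff mult.commute elim!: dvdE)
  also have "card \<dots> = m" using e by (simp add: card_image inj_on_def)
  finally have deg: "Polynomial.degree f = m" by (simp only: card_conj_exp)
  show ?thesis
  proof (rule exI[of _ "g ^ e"], rule exI[of _ e], intro conjI)
    show "p - 1 = Polynomial.degree f * e" using m by (simp only: deg)
    show "conj_exp (g ^ e)" using e by (simp add: I_def)
    have "(g ^ e) ^ m = g ^ (p - 1)" unfolding m by (simp add: power_mult[symmetric] mult.commute)
    then show "[(g ^ e) ^ Polynomial.degree f = 1] (mod p)" using period by (simp add: deg)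
    show "inj_on (\<lambda>i. (g ^ e) ^ i mod p) {..<Polynomial.degree f}"
    proof (rule inj_onI)
      fix i j assume ij: "i \<in> {..<Polynomial.degree f}" "j \<in> {..<Polynomial.degree f}"
        and eq: "(g ^ e) ^ i mod p = (g ^ e) ^ j mod p"
      have "e * i \<in> {..<p - 1}" "e * j \<in> {..<p - 1}" unfolding m using ij e by (simp_all add: deg mult.commute)
      then have "e * i = e * j"
        using bij_betw_imp_inj_on[OF bij] eq by (auto dest: inj_onD simp flip: power_mult)
      then show "i = j" using e by simp
    qed
  qed
qed

text \<open>
  The action takes \<open>\<zeta>\<close> to \<open>\<zeta>\<^sup>a\<close> with \<open>a\<close> from \<open>exists_generating_exponent\<close>.  If \<open>x = h(\<zeta>)\<close> is fixed and \<open>h\<close>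
  has degree less than that of \<open>f\<close>, then \<open>h - x\<close> vanishes at all conjugates of \<open>\<zeta>\<close>, so \<open>h\<close> is constant
  and \<open>x\<close> lies in \<open>K\<close>.
\<close>
lemma cyclic_action_ext_field:
  "\<exists>\<tau> e. cyclic_action ext_field \<tau> (Polynomial.degree f) \<zeta> \<and> p - 1 = Polynomial.degree f * e"
proof -
  define m where "m = Polynomial.degree f"
  obtain a e where e: "p - 1 = m * e" and a: "conj_exp a" and am: "[a ^ m = 1] (mod p)"
    and inj: "inj_on (\<lambda>i. a ^ i mod p) {..<m}"
    using exists_generating_exponent unfolding m_def by blast
  have m0: "m > 0" using e prime_gt_1_nat[OF prime] by (intro Nat.gr0I) simp
  have closed: "K_poly h \<zeta> \<in> ext_field" for h by (simp add: ext_field_def)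
  have elim: "\<exists>h. x = K_poly h \<zeta>" if "x \<in> ext_field" for x using that by (auto simp: ext_field_def)
  note hom = ext_hom_eq[OF a] and iter = iter_ext_hom[OF a]
  have const: "K_poly [:c:] x = to_ac c" for c x by (simp add: K_poly_pCons)
  have \<zeta>: "\<zeta> = K_poly (Polynomial.monom 1 1) \<zeta>" by (simp add: K_poly_monom)
  have iter_\<zeta>: "(ext_hom a ^^ i) \<zeta> = \<zeta> ^ (a ^ i)" for i
    using iter[of i "Polynomial.monom 1 1"] by (simp add: K_poly_monom)
  have inj_\<zeta>: "inj_on (\<lambda>i. \<zeta> ^ (a ^ i)) {..<m}"
    using inj by (auto simp: inj_on_def power_eq_iff unique_euclidean_semiring_class.cong_def)
  have "cyclic_action ext_field (ext_hom a) m \<zeta>"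
  proof
    fix c show "to_ac c \<in> ext_field" using closed[of "[:c:]"] by (simp only: const)
  next
    fix c show "ext_hom a (to_ac c) = to_ac c" using hom[of "[:c:]"] by (simp only: const)
  next
    fix x y assume "x \<in> ext_field" "y \<in> ext_field"
    then obtain g h where gh: "x = K_poly g \<zeta>" "y = K_poly h \<zeta>" using elim by blast
    show "x + y \<in> ext_field" using closed[of "g + h"] by (simp only: gh K_poly_add)
    show "x * y \<in> ext_field" using closed[of "g * h"] by (simp only: gh K_poly_mult)
    show "ext_hom a (x + y) = ext_hom a x + ext_hom a y"
      using hom[of "g + h"] hom[of g] hom[of h] by (simp only: gh K_poly_add)
    show "ext_hom a (x * y) = ext_hom a x * ext_hom a y"
      using hom[of "g * h"] hom[of g] hom[of h] by (simp only: gh K_poly_mult)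
  next
    fix x assume "x \<in> ext_field"
    then obtain h where h: "x = K_poly h \<zeta>" using elim by blast
    show "ext_hom a x \<in> ext_field"
      using closed[of "pcompose h (Polynomial.monom 1 a)"] by (simp only: h hom K_poly_pcompose_monom)
    show "(ext_hom a ^^ m) x = x"
      using iter[of m h] power_cong[OF am] by (simp only: h) simp
    assume fixed: "ext_hom a x = x"
    have iter_x: "(ext_hom a ^^ i) x = x" for i by (induction i) (simp_all add: fixed)
    define h0 where "h0 = h mod f"
    have x: "x = K_poly h0 \<zeta>"
    proof -
      have "K_poly h \<zeta> = K_poly (f * (h div f) + h0) \<zeta>" by (simp add: h0_def)
      then show ?thesis by (simp only: h K_poly_add K_poly_mult f_root) simp
    qed
    have deg: "Polynomial.degree h0 < m"
      unfolding h0_def m_def using degree_mod_less[OF f_nonzero, of h] m0 by (auto simp: m_def)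
    have "map_poly to_ac h0 = [:x:]"
    proof (rule poly_eqI_degree)
      have card: "card ((\<lambda>i. \<zeta> ^ (a ^ i)) ` {..<m}) = m" using inj_\<zeta> by (simp add: card_image)
      show "card ((\<lambda>i. \<zeta> ^ (a ^ i)) ` {..<m}) > Polynomial.degree (map_poly to_ac h0)"
        unfolding card using deg by (simp add: degree_map_poly)
      show "card ((\<lambda>i. \<zeta> ^ (a ^ i)) ` {..<m}) > Polynomial.degree [:x:]"
        unfolding card using m0 by simp
      fix w assume "w \<in> (\<lambda>i. \<zeta> ^ (a ^ i)) ` {..<m}"
      then obtain i where "w = \<zeta> ^ (a ^ i)" by blast
      then show "K_poly h0 w = poly [:x:] w" using iter[of i h0] iter_x[of i] by (simp flip: x)
    qed
    then have "x = poly.coeff (map_poly to_ac h0) 0" by simp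
    then show "x \<in> range to_ac" by (simp add: coeff_map_poly)
  next
    show "m > 0" by (rule m0)
    show "\<zeta> \<in> ext_field" using closed \<zeta> by metis
    show "inj_on (\<lambda>i. (ext_hom a ^^ i) \<zeta>) {..<m}" using inj_\<zeta> by (simp add: iter_\<zeta>)
  qed
  then show ?thesis using e by (auto simp: m_def)
qed

end

section \<open>Existence of the extension and of the decomposition\<close>

text \<open>
  If \<open>B\<close> is a basis of \<open>K\<close> over \<open>\<rat>\<close>, the \<open>b \<zeta>\<^sup>l\<close> with \<open>b \<in> B\<close> and \<open>l < m\<close> span \<open>K(\<zeta>)\<close> over \<open>\<rat>\<close>, while \<open>p - 1\<close>
  powers of \<open>\<zeta>\<close> are independent.
\<close>
lemma (in cyclotomic_extension) degree_bound:
  fixes B :: "'k set"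
  assumes "finite_dimensional_vector_space (\<lambda>(q::rat) (x::'k). of_rat q * x) B"
    and act: "cyclic_action ext_field \<tau> m \<zeta>"
  shows "p - 1 \<le> card B * m"
proof -
  interpret q: finite_dimensional_vector_space "\<lambda>(q::rat) (x::'k). of_rat q * x" B by (rule assms)
  interpret A: cyclic_action ext_field \<tau> m \<zeta> by (rule act)
  define S where "S = (\<lambda>(b, l). to_ac b * \<zeta> ^ l) ` (B \<times> {..<m})"
  have finS: "finite S" by (simp add: S_def q.finite_Basis)
  have cS: "to_ac c * \<zeta> ^ l \<in> rat.span S" if l: "l < m" for c l
  proof -
    have "q.subspace {c. to_ac c * \<zeta> ^ l \<in> rat.span S}"
    proof (rule q.subspaceI)
      show "0 \<in> {c. to_ac c * \<zeta> ^ l \<in> rat.span S}" by (simp add: rat.span_zero)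
      show "x + y \<in> {c. to_ac c * \<zeta> ^ l \<in> rat.span S}"
        if "x \<in> {c. to_ac c * \<zeta> ^ l \<in> rat.span S}" "y \<in> {c. to_ac c * \<zeta> ^ l \<in> rat.span S}" for x y
        using that by (simp add: distrib_right rat.span_add)
      show "of_rat r * x \<in> {c. to_ac c * \<zeta> ^ l \<in> rat.span S}"
        if "x \<in> {c. to_ac c * \<zeta> ^ l \<in> rat.span S}" for r x
        using that rat.span_scale[of "to_ac x * \<zeta> ^ l" S r] by (simp add: rat_scale_def mult.assoc)
    qed
    moreover have "B \<subseteq> {c. to_ac c * \<zeta> ^ l \<in> rat.span S}"
      using l by (auto simp: S_def intro!: rat.span_base)
    ultimately have "q.span B \<subseteq> {c. to_ac c * \<zeta> ^ l \<in> rat.span S}" by (intro q.span_minimal)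
    then show ?thesis using q.span_Basis by auto
  qed
  have "(\<lambda>j. \<zeta> ^ j) ` {..<p - 1} \<subseteq> rat.span S"
  proof
    fix x assume "x \<in> (\<lambda>j. \<zeta> ^ j) ` {..<p - 1}"
    then have "x \<in> ext_field" using A.pow_closed[OF A.gen_closed] by auto
    then obtain h where h: "Polynomial.degree h < m" "x = K_poly h \<zeta>" using A.eq_K_poly_gen by blast
    show "x \<in> rat.span S"
      unfolding h K_poly_altdef using h(1) by (intro rat.span_sum cS) auto
  qed
  then have "card ((\<lambda>j. \<zeta> ^ j) ` {..<p - 1}) \<le> card S"
    using rat.independent_span_bound[OF finS rat_independent_powers] root_of_unity_axioms by blast
  moreover have "card ((\<lambda>j. \<zeta> ^ j) ` {..<p - 1}) = p - 1"
    using inj_on_subset[OF inj_on_power, of "{..<p - 1}"] by (subst card_image) auto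
  moreover have "card S \<le> card B * m"
    unfolding S_def using card_image_le[of "B \<times> {..<m}"] by (simp add: q.finite_Basis card_cartesian_product)
  ultimately show ?thesis by simp
qed

text \<open>
  The factor \<open>d!\<close> in the modulus makes up for the divisor \<open>e\<close> of \<open>p - 1\<close> by which the degree of \<open>K(\<zeta>)\<close>
  over \<open>K\<close> falls short of \<open>p - 1\<close>: since \<open>e \<le> d\<close> divides \<open>d!\<close>, the degree remains a multiple of \<open>n\<close>.
\<close>
theorem exists_cyclic_extension_without_i:
  assumes K: "number_field TYPE('k::field_char_0)" and no_i: "\<not> (\<exists>x::'k. x ^ 2 = - 1)" and n: "n > 0"
  shows "\<exists>(L :: 'k alg_closure set) \<sigma> z. cyclic_galois L \<sigma> n z \<and> (\<forall>x\<in>L. x ^ 2 \<noteq> - 1)"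
proof -
  obtain B where B: "finite_dimensional_vector_space (\<lambda>(q::rat) (x::'k). of_rat q * x) B"
    using K by (auto simp: number_field_def)
  define S where "S = {p::nat. Factorial_Ring.prime p \<and> (\<exists>s::'k. s ^ 2 \<in> {of_nat p, - of_nat p})}"
  have "finite S" unfolding S_def using K by (rule finite_primes_pm_square)
  then obtain b where b: "\<And>p. p \<in> S \<Longrightarrow> p \<le> b" by (meson finite_nat_set_iff_bounded_le)
  define d where "d = card B"
  obtain p where p: "Factorial_Ring.prime p" "p > b" "4 * n * fact d dvd p - 1"
    using exists_prime_cong_1[of "4 * n * fact d" b] n by auto
  have "p \<notin> S" using b[of p] p(2) by auto
  then have ns: "y ^ 2 \<noteq> of_nat p \<and> y ^ 2 \<noteq> - of_nat p" for y :: 'k using p(1) by (auto simp: S_def)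
  obtain \<zeta> :: "'k alg_closure" where \<zeta>: "root_of_unity p \<zeta>" using exists_root_of_unity[OF p(1)] by blast
  interpret root_of_unity p \<zeta> by (rule \<zeta>)
  obtain f where f: "f \<noteq> 0" "K_poly f \<zeta> = 0" "\<And>h. K_poly h \<zeta> = 0 \<Longrightarrow> f dvd h"
    using exists_minimal_poly[of \<zeta>] by blast
  interpret cyclotomic_extension p \<zeta> f by unfold_locales (use f in auto)
  define m where "m = Polynomial.degree f"
  obtain \<tau> e where act: "cyclic_action ext_field \<tau> m \<zeta>" and e: "p - 1 = m * e"
    using cyclic_action_ext_field unfolding m_def by blast
  interpret A: cyclic_action ext_field \<tau> m \<zeta> by (rule act)
  have "m * e \<le> m * d" using degree_bound[OF B act] unfolding e d_def by (simp only: mult.commute)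
  then have "e \<le> d" using A.order_pos by simp
  moreover have "e > 0" using e prime_gt_1_nat[OF p(1)] by (intro Nat.gr0I) simp
  ultimately have "e dvd fact d" by (simp add: dvd_fact)
  then obtain e' where e': "fact d = e * e'" by blast
  obtain t where "p - 1 = 4 * n * fact d * t" using p(3) by blast
  then have "m * e = (n * (4 * e' * t)) * e" unfolding e e' by (simp only: mult_ac)
  then have "m = n * (4 * e' * t)" using \<open>e > 0\<close> by simp
  then have nm: "n dvd m" by simp
  have "4 dvd p - 1" using p(3) by (metis dvd_mult_left)
  then obtain h where h: "int_eval h \<zeta> ^ 2 = of_nat p" using p_eq_square by blast
  have "int_eval h \<zeta> \<in> ext_field" using A.K_poly_closed[OF A.gen_closed] by (simp flip: K_poly_eq_int_eval)
  then have no_i': "x ^ 2 \<noteq> - 1" if "x \<in> ext_field" for x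
    using A.no_sqrt_minus_1[OF _ ns _ h that] no_i by blast
  obtain y where "cyclic_action (A.Fix n) \<tau> n y" using A.Fix_cyclic_action[OF nm] by blast
  then have "cyclic_galois (A.Fix n) (\<lambda>x. if x \<in> A.Fix n then \<tau> x else x) n y"
    by (rule cyclic_action.cyclic_galois_extend_id)
  moreover have "\<forall>x\<in>A.Fix n. x ^ 2 \<noteq> - 1" using no_i' by (simp add: A.Fix_def)
  ultimately show ?thesis by blast
qed

theorem theoremB:
  fixes n \<alpha> k :: nat
  assumes "number_field TYPE('k::field_char_0)"
    and "\<not> (\<exists>x::'k. x ^ 2 = - 1)"
    and "n = 2 ^ \<alpha> * k" and "\<alpha> \<ge> 2" and "odd k"
  shows "\<exists>(L :: 'k alg_closure set) \<sigma> (E :: nat \<Rightarrow> 'k form set) (V :: nat \<Rightarrow> 'k form set).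
    cyclic_galois_extension L \<sigma> \<and> ac.dim L = n \<and>
    is_direct_sum (skew_space L \<sigma>) ({1..\<alpha> - 1} <+> {1..2}) (case_sum E V) \<and>
    (\<forall>i\<in>{1..\<alpha> - 1}. E i \<subseteq> skew_space L \<sigma> \<and> rank_subspace L n (E i) \<and>
       form.dim (E i) = n div 2 ^ i) \<and>
    (\<forall>j\<in>{1..2}. V j \<subseteq> skew_space L \<sigma> \<and> rank_subspace L (n - 2) (V j) \<and>
       form.dim (V j) = k)"
proof -
  have "n > 0" using assms(3,5) by (auto intro: Nat.gr0I)
  then obtain L :: "'k alg_closure set" and \<sigma> z where L: "cyclic_galois L \<sigma> n z" "\<forall>x\<in>L. x ^ 2 \<noteq> - 1"
    using exists_cyclic_extension_without_i[OF assms(1,2)] by blast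
  interpret cyclic_galois L \<sigma> n z by (rule L(1))
  show ?thesis
    by (rule exI[of _ L], rule exI[of _ \<sigma>], simp only: cyclic_galois_extension dim simp_thms)
      (rule skew_space_decomposition[OF assms(3-5) bspec[OF L(2)]])
qed

end
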